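(* For every $n$ there exists a multi-set $\mathcal{L}_n$ of permutations of $[n]$ such that the wait-and-pick algorithm with checkpoint $\lfloor n/e\rfloor$, when it processes the elements in an order chosen uniformly at random from $\mathcal{L}_n$, selects the element of maximum value with probability at least $$\frac{1}{e} - \frac{3\log\log^2 n}{e\log^{1/2} n}$$ for every adversarial assignment of values. The multi-set $\mathcal{L}_n$ is computable in time polynomial in $n$, and the uniform distribution on $\mathcal{L}_n$ has entropy $O(\log\log n)$.
   Context: Free order (classical) secretary problem: an adversary, knowing the algorithm and the distribution of orders, assigns distinct real values to elements $1,\dots,n$; the algorithm inspects elements one by one in the chosen order (a permutation of $[n]$), learns each value on inspection and must irrevocably accept or reject it, accepting exactly one element; success means accepting the element with the largest value. The wait-and-pick algorithm with checkpoint $m$ observes the first $m$ elements without accepting, then accepts the first later element whose value is larger than all previously observed values, or the last element if no such element appears. Choosing uniformly from a multi-set means each copy is chosen with probability $1/|\mathcal{L}_n|$. Entropy of a distribution $p$ is $-\sum_\pi p(\pi)\log p(\pi)$; $\log\log^2 n$ is as printed in the paper (the intended reading is $(\log\log n)^2$). *)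

theory Defs
  imports
    "HOL-Probability.Probability"
    "HOL-Combinatorics.Multiset_Permutations"
    "HOL-Computational_Algebra.Polynomial"
    "HOL-Library.Landau_Symbols"
begin

section \<open>The wait-and-pick algorithm\<close>

text \<open>
  An inspection order of \<open>{1..n}\<close> is a list \<open>ord\<close> in \<open>permutations_of_set {1..n}\<close>: the element
  \<open>ord ! t\<close> is inspected at time \<open>t\<close>, counted from 0, so that the times before the checkpoint \<open>m\<close>
  are those with \<open>t < m\<close>.
\<close>

definition wait_and_pick :: "nat \<Rightarrow> (nat \<Rightarrow> real) \<Rightarrow> nat list \<Rightarrow> nat" where
  "wait_and_pick m v ord =
     (case find (\<lambda>t. m \<le> t \<and> (\<forall>s<t. v (ord ! s) < v (ord ! t))) [0..<length ord] of
        Some t \<Rightarrow> ord ! t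
      | None \<Rightarrow> last ord)"

definition picks_max :: "nat \<Rightarrow> nat \<Rightarrow> (nat \<Rightarrow> real) \<Rightarrow> nat list \<Rightarrow> bool" where
  "picks_max n m v ord \<longleftrightarrow> v (wait_and_pick m v ord) = Max (v ` {1..n})"


section \<open>Entropy\<close>

text \<open>Meant for distributions of finite support; in nats, that is, with the natural logarithm.\<close>

definition shannon_entropy :: "'a pmf \<Rightarrow> real" where
  "shannon_entropy p = - (\<Sum>x\<in>set_pmf p. pmf p x * ln (pmf p x))"


section \<open>Computability in polynomial time\<close>

text \<open>
  The model is a random access machine, presented as a structured language: a memory consists of
  unbounded arrays of natural numbers indexed by names, of which a program mentions only finitely
  many; a scalar variable is the cell 0 of an array. Every command costs one unit of time.

  The arithmetic operations are addition, truncated subtraction, division and remainder, but not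
  multiplication. Hence for a fixed program the bit length of every number that arises within \<open>t\<close>
  steps on input \<open>n\<close> is \<open>O(t + log n)\<close>, and the unit-cost measure is polynomially related to the
  running time of Turing machines.
\<close>

type_synonym memory = "string \<Rightarrow> nat \<Rightarrow> nat"

datatype aexp =
    Const nat
  | Cell string aexp
  | Add aexp aexp
  | Sub aexp aexp
  | Div aexp aexp
  | Mod aexp aexp

datatype bexp =
    Less aexp aexp
  | Neg bexp
  | Conj bexp bexp

datatype com =
    Skip
  | Assign string aexp aexp
  | Seq com com
  | Cond bexp com com
  | While bexp com

primrec aval :: "aexp \<Rightarrow> memory \<Rightarrow> nat" where
  "aval (Const k) \<sigma> = k"
| "aval (Cell x a) \<sigma> = \<sigma> x (aval a \<sigma>)"
| "aval (Add a b) \<sigma> = aval a \<sigma> + aval b \<sigma>"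
| "aval (Sub a b) \<sigma> = aval a \<sigma> - aval b \<sigma>"
| "aval (Div a b) \<sigma> = aval a \<sigma> div aval b \<sigma>"
| "aval (Mod a b) \<sigma> = aval a \<sigma> mod aval b \<sigma>"

primrec bval :: "bexp \<Rightarrow> memory \<Rightarrow> bool" where
  "bval (Less a b) \<sigma> \<longleftrightarrow> aval a \<sigma> < aval b \<sigma>"
| "bval (Neg b) \<sigma> \<longleftrightarrow> \<not> bval b \<sigma>"
| "bval (Conj b c) \<sigma> \<longleftrightarrow> bval b \<sigma> \<and> bval c \<sigma>"

text \<open>
  \<open>exec c \<sigma> t \<tau>\<close>: started in memory \<open>\<sigma>\<close>, the program \<open>c\<close> halts after \<open>t\<close> steps in memory \<open>\<tau>\<close>.
  The command \<open>Assign x a b\<close> stores the value of \<open>b\<close> in the cell of \<open>x\<close> whose index is the value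
  of \<open>a\<close>.
\<close>

inductive exec :: "com \<Rightarrow> memory \<Rightarrow> nat \<Rightarrow> memory \<Rightarrow> bool" where
  Skip: "exec Skip \<sigma> 1 \<sigma>"
| Assign: "exec (Assign x a b) \<sigma> 1 (\<sigma>(x := (\<sigma> x)(aval a \<sigma> := aval b \<sigma>)))"
| Seq: "exec c \<sigma> t \<sigma>' \<Longrightarrow> exec d \<sigma>' u \<tau> \<Longrightarrow> exec (Seq c d) \<sigma> (t + u) \<tau>"
| CondTrue: "bval b \<sigma> \<Longrightarrow> exec c \<sigma> t \<tau> \<Longrightarrow> exec (Cond b c d) \<sigma> (t + 1) \<tau>"
| CondFalse: "\<not> bval b \<sigma> \<Longrightarrow> exec d \<sigma> t \<tau> \<Longrightarrow> exec (Cond b c d) \<sigma> (t + 1) \<tau>"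
| WhileFalse: "\<not> bval b \<sigma> \<Longrightarrow> exec (While b c) \<sigma> 1 \<sigma>"
| WhileTrue: "bval b \<sigma> \<Longrightarrow> exec c \<sigma> t \<sigma>' \<Longrightarrow> exec (While b c) \<sigma>' u \<tau> \<Longrightarrow>
    exec (While b c) \<sigma> (t + u + 1) \<tau>"

definition input_memory :: "nat \<Rightarrow> memory" where
  "input_memory n = (\<lambda>x i. if x = ''in'' \<and> i = 0 then n else 0)"

text \<open>
  A list of lists is output as a sequence of numbers in which the outer list and every inner list
  are preceded by their lengths. This determines the list of lists, whatever the array \<open>out\<close>
  contains after the end of the sequence.
\<close>

definition encode_lists :: "nat list list \<Rightarrow> nat list" where
  "encode_lists xss = length xss # concat (map (\<lambda>xs. length xs # xs) xss)"

definition outputs :: "memory \<Rightarrow> nat list list \<Rightarrow> bool" where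
  "outputs \<tau> xss \<longleftrightarrow> (\<forall>i < length (encode_lists xss). \<tau> ''out'' i = encode_lists xss ! i)"

text \<open>
  The time is polynomial in the number \<open>n\<close> itself, not in its bit length. A multiset is computed
  by listing its elements with multiplicity, in any order.
\<close>

definition polytime_computable :: "(nat \<Rightarrow> nat list multiset) \<Rightarrow> bool" where
  "polytime_computable L \<longleftrightarrow>
     (\<exists>c. \<exists>p :: nat poly. \<forall>n. \<exists>t \<tau> xss.
        exec c (input_memory n) t \<tau> \<and> t \<le> poly p n \<and> outputs \<tau> xss \<and> mset xss = L n)"

end

theory Submission
  imports
    Defs
    "HOL-Library.Log_Nat"
    "HOL-Real_Asymp.Real_Asymp"
begin

text \<open>
  Elements are hashed into \<open>p\<close> buckets, where \<open>p\<close> is about \<open>log n / log log n\<close>, and the buckets are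
  inspected in the order given by a permutation of \<open>[p]\<close>. The hash functions are a balanced family in
  which any two elements collide with frequency \<open>O(1 / p)\<close>, so the \<open>O(log log n)\<close> largest elements
  are usually in distinct buckets. If they are, wait-and-pick succeeds as soon as the bucket of the
  maximum comes after the checkpoint and, among the buckets of the next largest elements, the first
  one that precedes it comes before the checkpoint. A random permutation does this with probability
  \<open>1 / e - O(1 / p)\<close>.

  Both families have polylogarithmic size and are found by the same greedy algorithm: every round
  takes the candidate that minimises the weighted number of violated tests and then multiplies the
  weights of the violated tests by \<open>(N + 1) / N\<close>. There are at most polynomially many candidates and
  tests because \<open>p ^ p \<le> 2 n\<close>. The loss is \<open>O((log log n) ^ 3 / log n)\<close>, which is eventually below
  the required bound; the remaining finitely many \<open>n\<close> use all permutations, wired into the program.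
\<close>

section \<open>Program logic\<close>

text \<open>An adversary has too many assignments of values to test each of them; two reductions
  leave polynomially many tests. The hash functions shift blocks of \<open>p\<close> consecutive
  elements cyclically, so a collision of two elements depends only on the shifts of their blocks and
  on the difference of their residues. A greedy round fixes the shift of a single block, so it has
  only \<open>p\<close> candidates. Once the \<open>k + 1\<close> largest elements are separated,
  success is forced by the tuple of their buckets, and there are at most \<open>p ^ (k + 1)\<close>
  tuples. Cyclic shifts also keep the buckets balanced whatever the greedy algorithm chooses. Hence
  the checkpoint at \<open>n / e\<close> elements falls within a constant number of buckets of
  \<open>p / e\<close>; giving up the buckets in between costs \<open>O(1 / p)\<close>. The depth
  \<open>k\<close> is of order \<open>log log n\<close>, so that the maximum is preceded by none of
  the next \<open>k\<close> ranks with frequency at most \<open>1 / log n\<close>. The union bound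
  over pairs of top elements costs \<open>O(k ^ 2 / p)\<close>, the dominant loss. The weights force
  every single test to fail in about the average fraction of the rounds. The machine has neither
  multiplication nor the number \<open>e\<close>; repeated addition and a quotient of integer powers
  replace them.\<close>

lemma exec_Skip_iff: "exec Skip \<sigma> t \<tau> \<longleftrightarrow> t = 1 \<and> \<tau> = \<sigma>"
  by (subst exec.simps) auto

lemma exec_Assign_iff:
  "exec (Assign x a b) \<sigma> t \<tau> \<longleftrightarrow> t = 1 \<and> \<tau> = \<sigma>(x := (\<sigma> x)(aval a \<sigma> := aval b \<sigma>))"
  by (subst exec.simps) auto

lemma exec_Cond_iff:
  "exec (Cond b c d) \<sigma> t \<tau> \<longleftrightarrow> (\<exists>u. t = u + 1 \<and> exec (if bval b \<sigma> then c else d) \<sigma> u \<tau>)"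
  by (subst exec.simps) auto

lemma exec_Seq_iff:
  "exec (Seq c d) \<sigma> t \<tau> \<longleftrightarrow> (\<exists>u u' \<sigma>'. t = u + u' \<and> exec c \<sigma> u \<sigma>' \<and> exec d \<sigma>' u' \<tau>)"
  by (subst exec.simps) auto

text \<open>Total correctness with a time budget. The existential form matches
  \<open>polytime_computable\<close>, which asks for some halting run.\<close>

definition ok :: "com \<Rightarrow> memory \<Rightarrow> nat \<Rightarrow> (memory \<Rightarrow> bool) \<Rightarrow> bool" where
  "ok c \<sigma> t Q \<longleftrightarrow> (\<exists>u \<tau>. exec c \<sigma> u \<tau> \<and> u \<le> t \<and> Q \<tau>)"

lemma ok_mono: "ok c \<sigma> t Q \<Longrightarrow> t \<le> t' \<Longrightarrow> (\<And>\<tau>. Q \<tau> \<Longrightarrow> Q' \<tau>) \<Longrightarrow> ok c \<sigma> t' Q'"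
  unfolding ok_def by (meson order_trans)

lemma ok_Skip [simp]: "ok Skip \<sigma> t Q \<longleftrightarrow> 1 \<le> t \<and> Q \<sigma>"
  unfolding ok_def exec_Skip_iff by blast

lemma ok_Assign [simp]:
  "ok (Assign x a b) \<sigma> t Q \<longleftrightarrow> 1 \<le> t \<and> Q (\<sigma>(x := (\<sigma> x)(aval a \<sigma> := aval b \<sigma>)))"
  unfolding ok_def exec_Assign_iff by blast

lemma ok_Cond [simp]:
  "ok (Cond b c d) \<sigma> t Q \<longleftrightarrow> 1 \<le> t \<and> (if bval b \<sigma> then ok c \<sigma> (t - 1) Q else ok d \<sigma> (t - 1) Q)"
proof -
  have "u + 1 \<le> t \<longleftrightarrow> 1 \<le> t \<and> u \<le> t - 1" for u by auto
  then show ?thesis unfolding ok_def exec_Cond_iff by (cases "bval b \<sigma>") (simp_all only: if_True if_False, blast+)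
qed

lemma ok_SeqI:
  assumes "ok c \<sigma> t Q'" "\<And>\<tau>. Q' \<tau> \<Longrightarrow> ok d \<tau> u Q" "t + u \<le> T"
  shows "ok (Seq c d) \<sigma> T Q"
proof -
  obtain t1 \<tau> where 1: "exec c \<sigma> t1 \<tau>" "t1 \<le> t" "Q' \<tau>" using assms(1) unfolding ok_def by blast
  obtain t2 \<tau>' where 2: "exec d \<tau> t2 \<tau>'" "t2 \<le> u" "Q \<tau>'" using assms(2)[OF 1(3)] unfolding ok_def by blast
  have "t1 + t2 \<le> T" using 1 2 assms(3) by simp
  then show ?thesis unfolding ok_def using exec.Seq[OF 1(1) 2(1)] 2(3) by blast
qed

text \<open>Rules for an assignment, a skip or a conditional at the head of a sequence act as
  weakest preconditions, so the simplifier executes straight-line code. An explicit intermediate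
  assertion (\<open>ok_SeqI\<close>) is left for loops and subprograms.\<close>

lemma ok_Seq_Assign [simp]:
  "ok (Seq (Assign x a b) d) \<sigma> t Q \<longleftrightarrow>
     1 \<le> t \<and> ok d (\<sigma>(x := (\<sigma> x)(aval a \<sigma> := aval b \<sigma>))) (t - 1) Q"
proof -
  have "1 + u \<le> t \<longleftrightarrow> 1 \<le> t \<and> u \<le> t - 1" for u by auto
  then show ?thesis unfolding ok_def exec_Seq_iff exec_Assign_iff by blast
qed

lemma ok_Seq_Skip [simp]: "ok (Seq Skip d) \<sigma> t Q \<longleftrightarrow> 1 \<le> t \<and> ok d \<sigma> (t - 1) Q"
proof -
  have "1 + u \<le> t \<longleftrightarrow> 1 \<le> t \<and> u \<le> t - 1" for u by auto
  then show ?thesis unfolding ok_def exec_Seq_iff exec_Skip_iff by blast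
qed

lemma ok_Seq_Cond [simp]:
  "ok (Seq (Cond b c d) e) \<sigma> t Q \<longleftrightarrow>
     1 \<le> t \<and> (if bval b \<sigma> then ok (Seq c e) \<sigma> (t - 1) Q else ok (Seq d e) \<sigma> (t - 1) Q)"
proof -
  have "(u + 1) + u' \<le> t \<longleftrightarrow> 1 \<le> t \<and> u + u' \<le> t - 1" for u u' by auto
  then show ?thesis unfolding ok_def exec_Seq_iff exec_Cond_iff
    by (cases "bval b \<sigma>") (simp_all only: if_True if_False, blast+)
qed

primrec writes :: "com \<Rightarrow> string set" where
  "writes Skip = {}"
| "writes (Assign x a b) = {x}"
| "writes (Seq c d) = writes c \<union> writes d"
| "writes (Cond b c d) = writes c \<union> writes d"
| "writes (While b c) = writes c"

lemma exec_frame: "exec c \<sigma> t \<tau> \<Longrightarrow> x \<notin> writes c \<Longrightarrow> \<tau> x = \<sigma> x"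
  by (induction rule: exec.induct) auto

text \<open>A subprogram can be specified by its result alone; that it preserves everything else is
  read off its syntax.\<close>

lemma ok_frame:
  assumes "ok c \<sigma> t Q"
  shows "ok c \<sigma> t (\<lambda>\<tau>. Q \<tau> \<and> (\<forall>x. x \<notin> writes c \<longrightarrow> \<tau> x = \<sigma> x))"
  using assms exec_frame unfolding ok_def by blast

abbreviation "Var x \<equiv> Cell x (Const 0)"
abbreviation "Put x a \<equiv> Assign x (Const 0) a"

definition For :: "string \<Rightarrow> aexp \<Rightarrow> com \<Rightarrow> com" where
  "For i b c = Seq (Put i (Const 0))
     (While (Less (Var i) b) (Seq c (Put i (Add (Var i) (Const 1)))))"

lemma writes_For [simp]: "writes (For i b c) = insert i (writes c)"
  by (simp add: For_def)

text \<open>The invariant \<open>I j\<close> is only ever used in memories where the loop variable has the value \<open>j\<close>.\<close>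

lemma ok_For:
  assumes init: "I 0 (\<sigma>(i := (\<sigma> i)(0 := 0)))"
    and bound: "\<And>j \<tau>. j \<le> n \<Longrightarrow> I j \<tau> \<Longrightarrow> \<tau> i 0 = j \<Longrightarrow> aval b \<tau> = n"
    and step: "\<And>j \<tau>. j < n \<Longrightarrow> I j \<tau> \<Longrightarrow> \<tau> i 0 = j \<Longrightarrow>
      ok c \<tau> t (\<lambda>\<tau>. \<tau> i 0 = j \<and> I (Suc j) (\<tau>(i := (\<tau> i)(0 := Suc j))))"
    and final: "\<And>\<tau>. I n \<tau> \<Longrightarrow> \<tau> i 0 = n \<Longrightarrow> Q \<tau>"
    and time: "2 + n * (t + 2) \<le> T"
  shows "ok (For i b c) \<sigma> T Q"
proof -
  let ?w = "While (Less (Var i) b) (Seq c (Put i (Add (Var i) (Const 1))))"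
  \<comment> \<open>Each pass pays for the body, the increment and the loop test; the additional 1
    is the last test, which fails.\<close>
  have loop: "j \<le> n \<Longrightarrow> I j \<tau> \<Longrightarrow> \<tau> i 0 = j \<Longrightarrow> ok ?w \<tau> (1 + (n - j) * (t + 2)) Q" for j \<tau>
  proof (induction "n - j" arbitrary: j \<tau>)
    case 0
    then have "j = n" by simp
    then have "exec ?w \<tau> 1 \<tau>" using 0 bound[of j \<tau>] by (intro exec.WhileFalse) simp
    then show ?case using final 0 \<open>j = n\<close> unfolding ok_def by auto
  next
    case (Suc d)
    then have j: "j < n" by simp
    obtain u \<tau>' where u: "exec c \<tau> u \<tau>'" "u \<le> t" "\<tau>' i 0 = j"
      "I (Suc j) (\<tau>'(i := (\<tau>' i)(0 := Suc j)))"
      using step[OF j] Suc unfolding ok_def by blast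
    let ?\<tau> = "\<tau>'(i := (\<tau>' i)(0 := Suc j))"
    have 1: "exec (Seq c (Put i (Add (Var i) (Const 1)))) \<tau> (u + 1) ?\<tau>"
      using u exec.Seq[OF u(1) exec.Assign[of i "Const 0" "Add (Var i) (Const 1)" \<tau>']] by simp
    obtain u2 \<tau>2 where u2: "exec ?w ?\<tau> u2 \<tau>2" "u2 \<le> 1 + (n - Suc j) * (t + 2)" "Q \<tau>2"
    proof -
      have "ok ?w ?\<tau> (1 + (n - Suc j) * (t + 2)) Q"
        using j u(4) Suc(2) by (intro Suc(1)) auto
      then show ?thesis using that unfolding ok_def by blast
    qed
    have "exec ?w \<tau> ((u + 1) + u2 + 1) \<tau>2"
      using Suc j bound[of j \<tau>] by (intro exec.WhileTrue[OF _ 1 u2(1)]) simp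
    moreover have "n - j = Suc (n - Suc j)" using j by simp
    then have "(u + 1) + u2 + 1 \<le> 1 + (n - j) * (t + 2)" using u u2 by simp
    ultimately show ?case using u2(3) unfolding ok_def by blast
  qed
  show ?thesis unfolding For_def
    using ok_mono[OF loop[OF _ init, simplified] _, of "T - 1" Q] time by auto
qed

section \<open>A greedy algorithm with multiplicative weights\<close>

text \<open>Multiplication by repeated addition costs time linear in the second factor only. Weights
  and powers, whose values may be huge, are therefore always the first factor.\<close>

definition Times :: "string \<Rightarrow> aexp \<Rightarrow> aexp \<Rightarrow> com" where
  "Times z a b = Seq (Put z (Const 0)) (For ''i'' b (Put z (Add (Var z) a)))"

lemma writes_Times [simp]: "writes (Times z a b) = {z, ''i''}"
  by (auto simp: Times_def)

text \<open>The loop re-evaluates both factors in every pass, so their values must survive changes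
  of \<open>z\<close> and of the loop variable.\<close>

lemma ok_Times:
  assumes "z \<noteq> ''i''"
    and ab: "\<And>\<tau>. \<forall>x. x \<noteq> z \<and> x \<noteq> ''i'' \<longrightarrow> \<tau> x = \<sigma> x \<Longrightarrow> aval a \<tau> = u \<and> aval b \<tau> = w"
    and "3 + 3 * w \<le> T"
  shows "ok (Times z a b) \<sigma> T (\<lambda>\<tau>. \<tau> z 0 = u * w \<and> (\<forall>x. x \<noteq> z \<and> x \<noteq> ''i'' \<longrightarrow> \<tau> x = \<sigma> x))"
  unfolding Times_def ok_Seq_Assign using assms
  by (auto intro!: ok_For[where n = w and t = 1 and
      I = "\<lambda>j \<tau>. \<tau> z 0 = u * j \<and> (\<forall>x. x \<noteq> z \<and> x \<noteq> ''i'' \<longrightarrow> \<tau> x = \<sigma> x)"])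

text \<open>The usual weight \<open>(1 + 1 / N) ^ violations\<close> scaled by \<open>N ^ r\<close>,
  which keeps all weights natural numbers. In \<open>bad A r c j\<close> the choices made so far are
  \<open>A\<close>, the round is \<open>r\<close>, the candidate is \<open>c\<close> and the test is
  \<open>j\<close>.\<close>

definition weight :: "nat \<Rightarrow> ((nat \<Rightarrow> nat) \<Rightarrow> nat \<Rightarrow> nat \<Rightarrow> nat \<Rightarrow> bool) \<Rightarrow> (nat \<Rightarrow> nat) \<Rightarrow> nat \<Rightarrow> nat \<Rightarrow> nat"
  where "weight N bad A r j = (\<Prod>r'<r. N + of_bool (bad A r' (A r') j))"

lemma weight_0 [simp]: "weight N bad A 0 j = 1"
  by (simp add: weight_def)

lemma weight_Suc:
  "weight N bad A (Suc r) j = weight N bad A r j * (N + of_bool (bad A r (A r) j))"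
  by (simp add: weight_def)

text \<open>Only minimality is recorded, so the analysis is independent of how the program breaks
  ties.\<close>

definition greedy_choice :: "nat \<Rightarrow> nat \<Rightarrow> nat \<Rightarrow> ((nat \<Rightarrow> nat) \<Rightarrow> nat \<Rightarrow> nat \<Rightarrow> nat \<Rightarrow> bool) \<Rightarrow> (nat \<Rightarrow> nat) \<Rightarrow> nat \<Rightarrow> bool"
  where "greedy_choice M C N bad A r \<longleftrightarrow> A r < C \<and>
    (\<forall>c<C. (\<Sum>j<M. weight N bad A r j * of_bool (bad A r (A r) j))
         \<le> (\<Sum>j<M. weight N bad A r j * of_bool (bad A r c j)))"

text \<open>The verdict of a round depends on the array of choices only through earlier rounds.
  Hence storing later choices in the same array invalidates neither past weights nor past
  minimality.\<close>

definition local_test :: "((nat \<Rightarrow> nat) \<Rightarrow> nat \<Rightarrow> nat \<Rightarrow> nat \<Rightarrow> bool) \<Rightarrow> bool" where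
  "local_test bad \<longleftrightarrow> (\<forall>A A' r c j. (\<forall>i<r. A i = A' i) \<longrightarrow> bad A r c j = bad A' r c j)"

lemma weight_local:
  "local_test bad \<Longrightarrow> (\<And>i. i < r \<Longrightarrow> A i = A' i) \<Longrightarrow> weight N bad A r j = weight N bad A' r j"
  unfolding weight_def local_test_def
  by (intro prod.cong refl arg_cong2[where f = "(+)"] arg_cong[where f = of_bool])
     (metis lessThan_iff order.strict_trans)

lemma greedy_choice_local:
  assumes "local_test bad" and A: "\<And>i. i \<le> r \<Longrightarrow> A i = A' i"
  shows "greedy_choice M C N bad A r = greedy_choice M C N bad A' r"
proof -
  have "weight N bad A r j = weight N bad A' r j" for j
    using assms by (intro weight_local) auto
  moreover have "bad A r c j = bad A' r c j" for c j
    using assms unfolding local_test_def by (meson less_imp_le)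
  ultimately show ?thesis unfolding greedy_choice_def using A[of r] by simp
qed

definition Cost :: "com \<Rightarrow> com" where
  "Cost bad = Seq (Put ''acc'' (Const 0))
     (For ''j'' (Var ''M'') (Seq bad
        (Cond (Less (Const 0) (Var ''f'')) (Put ''acc'' (Add (Var ''acc'') (Cell ''W'' (Var ''j'')))) Skip)))"

text \<open>No number is large enough to initialise \<open>best\<close>, so candidate 0 is accepted
  unconditionally and a later one only if it is strictly cheaper.\<close>

definition Choose :: "com \<Rightarrow> com" where
  "Choose bad = For ''c'' (Var ''C'') (Seq (Cost bad)
     (Cond (Conj (Less (Const 0) (Var ''c'')) (Neg (Less (Var ''acc'') (Var ''best'')))) Skip
        (Seq (Put ''best'' (Var ''acc'')) (Put ''a'' (Var ''c'')))))"

definition Update :: "com \<Rightarrow> com" where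
  "Update bad = For ''j'' (Var ''M'') (Seq bad
     (Seq (Times ''acc'' (Cell ''W'' (Var ''j'')) (Var ''N''))
     (Seq (Cond (Less (Const 0) (Var ''f'')) (Put ''acc'' (Add (Var ''acc'') (Cell ''W'' (Var ''j'')))) Skip)
          (Assign ''W'' (Var ''j'') (Var ''acc'')))))"

text \<open>The winner is copied back to \<open>c\<close> because \<open>Update\<close> runs the
  same test program, which reads its candidate from there.\<close>

definition Greedy :: "string \<Rightarrow> com \<Rightarrow> com" where
  "Greedy A bad = Seq (For ''j'' (Var ''M'') (Assign ''W'' (Var ''j'') (Const 1)))
     (For ''r'' (Var ''R'') (Seq (Choose bad)
        (Seq (Put ''c'' (Var ''a'')) (Seq (Assign A (Var ''r'') (Var ''a'')) (Update bad)))))"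

definition greedy_vars :: "string set" where
  "greedy_vars = {''i'', ''j'', ''r'', ''c'', ''a'', ''acc'', ''best'', ''W''}"

lemma writes_Greedy [simp]: "writes (Greedy A bad) = insert A (greedy_vars \<union> writes bad)"
  by (auto simp: Greedy_def Choose_def Cost_def Update_def greedy_vars_def)

definition agree :: "string set \<Rightarrow> memory \<Rightarrow> memory \<Rightarrow> bool" where
  "agree E \<sigma> \<tau> \<longleftrightarrow> (\<forall>x\<in>E. \<sigma> x = \<tau> x)"

lemma agree_upd [simp]: "x \<notin> E \<Longrightarrow> agree E (\<sigma>(x := v)) \<rho> = agree E \<sigma> \<rho>"
  by (auto simp: agree_def)

text \<open>\<open>E\<close> collects parameters that no part of the greedy program writes, and the
  reference memory \<open>\<rho>\<close> fixes their values. The test program \<open>cmd\<close> is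
  known only by its verdict in \<open>f\<close>, so both families instantiate the same correctness
  proof.\<close>

locale greedy =
  fixes arr :: string and cmd :: com and bad :: "(nat \<Rightarrow> nat) \<Rightarrow> nat \<Rightarrow> nat \<Rightarrow> nat \<Rightarrow> bool"
    and E :: "string set" and \<rho> :: memory and tb M C N R :: nat
  assumes E: "{''R'', ''C'', ''M'', ''N''} \<subseteq> E" "arr \<notin> E" "E \<inter> greedy_vars = {}" "E \<inter> writes cmd = {}"
    and arr: "arr \<notin> greedy_vars" "arr \<notin> writes cmd" "arr \<noteq> ''f''"
    and cmd: "writes cmd \<inter> greedy_vars = {}"
    and vals: "\<rho> ''M'' 0 = M" "\<rho> ''C'' 0 = C" "\<rho> ''N'' 0 = N" "\<rho> ''R'' 0 = R"
    and loc: "local_test bad"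
    and ok_cmd: "\<And>\<sigma>. agree E \<sigma> \<rho> \<Longrightarrow> ok cmd \<sigma> tb
       (\<lambda>\<tau>. \<tau> ''f'' 0 = of_bool (bad (\<sigma> arr) (\<sigma> ''r'' 0) (\<sigma> ''c'' 0) (\<sigma> ''j'' 0)))"
begin

definition "same \<sigma> \<tau> \<longleftrightarrow> (\<forall>x. x \<notin> writes cmd \<longrightarrow> \<tau> x = \<sigma> x)"

lemma names [simp]:
  "''i'' \<notin> writes cmd" "''j'' \<notin> writes cmd" "''r'' \<notin> writes cmd" "''c'' \<notin> writes cmd"
  "''a'' \<notin> writes cmd" "''acc'' \<notin> writes cmd" "''best'' \<notin> writes cmd" "''W'' \<notin> writes cmd"
  "arr \<notin> writes cmd"
  "''i'' \<notin> E" "''j'' \<notin> E" "''r'' \<notin> E" "''c'' \<notin> E"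
  "''a'' \<notin> E" "''acc'' \<notin> E" "''best'' \<notin> E" "''W'' \<notin> E" "arr \<notin> E"
  "arr \<noteq> ''i''" "arr \<noteq> ''j''" "arr \<noteq> ''r''" "arr \<noteq> ''c''" "arr \<noteq> ''a''" "arr \<noteq> ''acc''" "arr \<noteq> ''best''" "arr \<noteq> ''W''"
  "''i'' \<noteq> arr" "''j'' \<noteq> arr" "''r'' \<noteq> arr" "''c'' \<noteq> arr" "''a'' \<noteq> arr" "''acc'' \<noteq> arr" "''best'' \<noteq> arr" "''W'' \<noteq> arr"
  using E arr cmd unfolding greedy_vars_def by auto

lemma agreeD [simp]:
  assumes "agree E \<tau> \<rho>"
  shows "\<tau> ''M'' 0 = M" "\<tau> ''C'' 0 = C" "\<tau> ''N'' 0 = N" "\<tau> ''R'' 0 = R"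
  using assms E(1) vals unfolding agree_def by auto

lemma ok_cmd': "agree E \<sigma> \<rho> \<Longrightarrow> ok cmd \<sigma> tb
   (\<lambda>\<tau>. \<tau> ''f'' 0 = of_bool (bad (\<sigma> arr) (\<sigma> ''r'' 0) (\<sigma> ''c'' 0) (\<sigma> ''j'' 0)) \<and> agree E \<tau> \<rho> \<and> same \<sigma> \<tau>)"
  by (rule ok_mono[OF ok_frame[OF ok_cmd]]) (use E(4) in \<open>auto simp: same_def agree_def\<close>)

definition "cost A W r c m = (\<Sum>j<m. W j * of_bool (bad A r c j))"

lemma ok_Cost:
  assumes "agree E \<sigma> \<rho>"
  shows "ok (Cost cmd) \<sigma> (3 + M * (tb + 4)) (\<lambda>\<tau>. agree E \<tau> \<rho> \<and>
     \<tau> ''acc'' 0 = cost (\<sigma> arr) (\<sigma> ''W'') (\<sigma> ''r'' 0) (\<sigma> ''c'' 0) M \<and>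
     (\<forall>x\<in>{arr, ''W'', ''r'', ''c'', ''a'', ''best''}. \<tau> x = \<sigma> x))"
  unfolding Cost_def ok_Seq_Assign
proof (rule conjI, simp, rule ok_For[where n = M and t = "tb + 2" and
      I = "\<lambda>j \<tau>. agree E \<tau> \<rho> \<and> \<tau> ''acc'' 0 = cost (\<sigma> arr) (\<sigma> ''W'') (\<sigma> ''r'' 0) (\<sigma> ''c'' 0) j \<and>
         (\<forall>x\<in>{arr, ''W'', ''r'', ''c'', ''a'', ''best''}. \<tau> x = \<sigma> x)"], goal_cases)
  case (3 j \<tau>)
  show ?case
    by (rule ok_SeqI[OF ok_cmd'[of \<tau>], where u = 2]) (use 3 in \<open>auto simp: same_def cost_def\<close>)
qed (use assms in \<open>auto simp: cost_def algebra_simps\<close>)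

lemma ok_Choose:
  assumes "agree E \<sigma> \<rho>" "0 < C"
  shows "ok (Choose cmd) \<sigma> (2 + C * (8 + M * (tb + 4))) (\<lambda>\<tau>. agree E \<tau> \<rho> \<and>
     \<tau> ''a'' 0 < C \<and>
     (\<forall>c<C. cost (\<sigma> arr) (\<sigma> ''W'') (\<sigma> ''r'' 0) (\<tau> ''a'' 0) M \<le> cost (\<sigma> arr) (\<sigma> ''W'') (\<sigma> ''r'' 0) c M) \<and>
     (\<forall>x\<in>{arr, ''W'', ''r''}. \<tau> x = \<sigma> x))"
proof -
  define K where "K c = cost (\<sigma> arr) (\<sigma> ''W'') (\<sigma> ''r'' 0) c M" for c
  show ?thesis
    unfolding Choose_def K_def[symmetric]
  proof (rule ok_For[where n = C and t = "6 + M * (tb + 4)" and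
        I = "\<lambda>c \<tau>. agree E \<tau> \<rho> \<and> (\<forall>x\<in>{arr, ''W'', ''r''}. \<tau> x = \<sigma> x) \<and>
           (0 < c \<longrightarrow> \<tau> ''a'' 0 < C \<and> \<tau> ''best'' 0 = K (\<tau> ''a'' 0) \<and> (\<forall>c'<c. K (\<tau> ''a'' 0) \<le> K c'))"],
       goal_cases)
    case (3 c \<tau>)
    then have *: "cost (\<tau> arr) (\<tau> ''W'') (\<tau> ''r'' 0) (\<tau> ''c'' 0) M = K c"
      by (simp add: K_def)
    show ?case
    proof (rule ok_SeqI[OF ok_Cost[of \<tau>], where u = 3], goal_cases)
      case (2 \<tau>')
      have *: "\<tau>' ''acc'' 0 = K c" "agree E \<tau>' \<rho>"
        "\<tau>' arr = \<tau> arr" "\<tau>' ''W'' = \<tau> ''W''" "\<tau>' ''r'' = \<tau> ''r''" "\<tau>' ''c'' = \<tau> ''c''"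
        "\<tau>' ''a'' = \<tau> ''a''" "\<tau>' ''best'' = \<tau> ''best''" using 2 * by simp_all
      have c': "\<forall>c'<Suc c. Q c'" if "\<forall>c'<c. Q c'" "Q c" for Q using that less_Suc_eq by auto
      have b: "bval (Conj (Less (Const 0) (Var ''c'')) (Neg (Less (Var ''acc'') (Var ''best'')))) \<tau>'
          = (0 < c \<and> \<tau> ''best'' 0 \<le> K c)"
        using * \<open>\<tau> ''c'' 0 = c\<close> by (simp add: not_less)
      show ?case
      proof (cases "0 < c \<and> \<tau> ''best'' 0 \<le> K c")
        case True
        with 3 have "\<forall>c'<Suc c. K (\<tau> ''a'' 0) \<le> K c'" by (intro c') simp_all
        moreover have "\<tau> ''a'' 0 < C" "\<tau> ''best'' 0 = K (\<tau> ''a'' 0)" "\<tau> arr = \<sigma> arr"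
          "\<tau> ''W'' = \<sigma> ''W''" "\<tau> ''r'' = \<sigma> ''r''" "\<tau> ''c'' 0 = c" using True 3 by simp_all
        ultimately show ?thesis using * unfolding ok_Cond b if_P[OF True] ok_Skip
          by (intro conjI impI) simp_all
      next
        case False
        have "\<forall>c'<c. K c \<le> K c'"
        proof (intro allI impI)
          fix c' assume "c' < c"
          then have "K c < K (\<tau> ''a'' 0)" "K (\<tau> ''a'' 0) \<le> K c'" using False 3(2) by auto
          then show "K c \<le> K c'" by simp
        qed
        then have "\<forall>c'<Suc c. K c \<le> K c'" by (intro c') auto
        moreover have "\<tau> arr = \<sigma> arr" "\<tau> ''W'' = \<sigma> ''W''" "\<tau> ''r'' = \<sigma> ''r''" "\<tau> ''c'' 0 = c"
          using 3 by simp_all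
        ultimately show ?thesis using * \<open>c < C\<close> unfolding ok_Cond b if_not_P[OF False] ok_Seq_Assign ok_Assign
          by (intro conjI impI) simp_all
      qed
    qed (use 3 in auto)
  qed (use assms in auto)
qed

lemma ok_Update:
  assumes "agree E \<sigma> \<rho>"
  shows "ok (Update cmd) \<sigma> (2 + M * (tb + 3 * N + 8)) (\<lambda>\<tau>. agree E \<tau> \<rho> \<and>
     (\<forall>j<M. \<tau> ''W'' j = \<sigma> ''W'' j * (N + of_bool (bad (\<sigma> arr) (\<sigma> ''r'' 0) (\<sigma> ''c'' 0) j))) \<and>
     (\<forall>x\<in>{arr, ''r'', ''c''}. \<tau> x = \<sigma> x))"
proof -
  define D where "D j = N + of_bool (bad (\<sigma> arr) (\<sigma> ''r'' 0) (\<sigma> ''c'' 0) j)" for j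
  define W' where "W' k j = (if j < k then \<sigma> ''W'' j * D j else \<sigma> ''W'' j)" for k j
  have W'_Suc: "W' (Suc k) = (W' k)(k := \<sigma> ''W'' k * D k)" for k
    by (auto simp: W'_def)
  define I where "I k \<tau> \<longleftrightarrow> agree E \<tau> \<rho> \<and> \<tau> arr = \<sigma> arr \<and> \<tau> ''r'' = \<sigma> ''r'' \<and> \<tau> ''c'' = \<sigma> ''c'' \<and> \<tau> ''W'' = W' k"
    for k and \<tau> :: memory
  show ?thesis
    unfolding Update_def D_def[symmetric]
  proof (rule ok_For[where n = M and t = "tb + 3 * N + 6" and I = I], goal_cases)
    case (3 k \<tau>)
    then have 3: "agree E \<tau> \<rho>" "\<tau> arr = \<sigma> arr" "\<tau> ''r'' = \<sigma> ''r''" "\<tau> ''c'' = \<sigma> ''c''" "\<tau> ''W'' = W' k" "\<tau> ''j'' 0 = k"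
      by (auto simp: I_def)
    show ?case
    proof (rule ok_SeqI[OF ok_cmd'[OF 3(1)], where u = "3 * N + 6"], goal_cases)
      case (1 \<tau>')
      then have 1: "\<tau>' ''f'' 0 = of_bool (bad (\<sigma> arr) (\<sigma> ''r'' 0) (\<sigma> ''c'' 0) k)" "agree E \<tau>' \<rho>"
        "\<tau>' arr = \<sigma> arr" "\<tau>' ''r'' = \<sigma> ''r''" "\<tau>' ''c'' = \<sigma> ''c''" "\<tau>' ''W'' = W' k" "\<tau>' ''j'' 0 = k"
        using 3 by (simp_all add: same_def)
      have W: "W' k k = \<sigma> ''W'' k" by (simp add: W'_def)
      show ?case
      proof (rule ok_SeqI[OF ok_Times[where u = "\<sigma> ''W'' k" and w = N and T = "3 + 3 * N"], where u = 3], goal_cases)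
        case (2 \<tau>'')
        then have "\<tau>'' ''W'' = \<tau>' ''W''" "\<tau>'' ''j'' = \<tau>' ''j''" "\<tau>'' ''N'' = \<tau>' ''N''" by simp_all
        then show ?case using 1 W by simp
      next
        case (4 \<tau>'')
        then have 4: "\<tau>'' ''acc'' 0 = \<sigma> ''W'' k * N" "\<And>x. x \<noteq> ''acc'' \<Longrightarrow> x \<noteq> ''i'' \<Longrightarrow> \<tau>'' x = \<tau>' x"
          by simp_all
        have ag: "agree E \<tau>'' \<rho>"
          unfolding agree_def
        proof
          fix x assume "x \<in> E"
          then have "x \<noteq> ''acc''" "x \<noteq> ''i''" by auto
          then show "\<tau>'' x = \<rho> x" using 1(2) 4(2) \<open>x \<in> E\<close> by (simp add: agree_def)
        qed
        have st: "\<tau>'' arr = \<sigma> arr" "\<tau>'' ''r'' = \<sigma> ''r''" "\<tau>'' ''c'' = \<sigma> ''c''" "\<tau>'' ''W'' = W' k"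
          "\<tau>'' ''j'' 0 = k" "\<tau>'' ''f'' 0 = \<tau>' ''f'' 0"
          using 1 4(2) by simp_all
        show ?case
        proof (cases "bad (\<sigma> arr) (\<sigma> ''r'' 0) (\<sigma> ''c'' 0) k")
          case True
          then have "\<sigma> ''W'' k * D k = \<sigma> ''W'' k * N + \<sigma> ''W'' k" "0 < \<tau>'' ''f'' 0" using 1 st by (simp_all add: D_def)
          with st 4(1) ag W show ?thesis by (simp add: I_def W'_Suc)
        next
          case False
          then have "D k = N" "\<tau>'' ''f'' 0 = 0" using 1 st by (simp_all add: D_def)
          with st 4(1) ag W show ?thesis by (simp add: I_def W'_Suc)
        qed
      qed auto
    qed simp
  next
    case 1 show ?case using assms by (simp add: I_def W'_def[abs_def])
  next
    case (2 k \<tau>) then show ?case by (simp add: I_def)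
  next
    case (4 \<tau>) then show ?case by (simp add: I_def W'_def)
  next
    case 5 show ?case by (simp add: algebra_simps)
  qed
qed

lemma ok_Greedy:
  assumes "agree E \<sigma> \<rho>" "0 < C"
  shows "ok (Greedy arr cmd) \<sigma> (5 + M * 3 + R * (8 + C * (8 + M * (tb + 4)) + M * (tb + 3 * N + 8)))
    (\<lambda>\<tau>. \<forall>r<R. greedy_choice M C N bad (\<tau> arr) r)"
proof -
  define I where "I r \<tau> \<longleftrightarrow> agree E \<tau> \<rho> \<and> (\<forall>r'<r. greedy_choice M C N bad (\<tau> arr) r') \<and>
    (\<forall>j<M. \<tau> ''W'' j = weight N bad (\<tau> arr) r j)" for r and \<tau> :: memory
  define t where "t = 6 + C * (8 + M * (tb + 4)) + M * (tb + 3 * N + 8)"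
  have init: "ok (For ''j'' (Var ''M'') (Assign ''W'' (Var ''j'') (Const 1))) \<sigma> (2 + M * 3)
      (\<lambda>\<tau>. agree E \<tau> \<rho> \<and> (\<forall>j<M. \<tau> ''W'' j = 1))"
  proof (rule ok_For[where n = M and t = 1 and
        I = "\<lambda>k \<tau>. agree E \<tau> \<rho> \<and> (\<forall>j<k. \<tau> ''W'' j = 1)"], goal_cases)
    case (3 k \<tau>)
    then show ?case by (simp add: less_Suc_eq)
  qed (use assms in simp_all)
  have step: "ok (Seq (Choose cmd) (Seq (Put ''c'' (Var ''a'')) (Seq (Assign arr (Var ''r'') (Var ''a'')) (Update cmd))))
      \<tau> t (\<lambda>\<tau>. \<tau> ''r'' 0 = r \<and> I (Suc r) (\<tau>(''r'' := (\<tau> ''r'')(0 := Suc r))))"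
    if "r < R" "I r \<tau>" "\<tau> ''r'' 0 = r" for r \<tau>
  proof (rule ok_SeqI[OF ok_Choose[of \<tau>], where u = "4 + M * (tb + 3 * N + 8)"], goal_cases)
    case (3 \<tau>1)
    have I: "agree E \<tau> \<rho>" "\<And>r'. r' < r \<Longrightarrow> greedy_choice M C N bad (\<tau> arr) r'"
      "\<And>j. j < M \<Longrightarrow> \<tau> ''W'' j = weight N bad (\<tau> arr) r j"
      using that unfolding I_def by blast+
    define a where "a = \<tau>1 ''a'' 0"
    have st: "\<tau>1 arr = \<tau> arr" "\<tau>1 ''W'' = \<tau> ''W''" "\<tau>1 ''r'' 0 = r" "agree E \<tau>1 \<rho>" "a < C"
      using 3 that unfolding a_def by simp_all
    have best: "cost (\<tau> arr) (\<tau> ''W'') r a M \<le> cost (\<tau> arr) (\<tau> ''W'') r c M" if "c < C" for c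
      using 3 that \<open>\<tau> ''r'' 0 = r\<close> unfolding a_def by simp
    \<comment> \<open>Storing the choice changes the array at index \<open>r\<close> only. By
      locality the weights and verdicts of round \<open>r\<close>, from which the choice was
      computed, are the same for the new array.\<close>
    define A where "A = (\<tau> arr)(r := a)"
    have w: "weight N bad (\<tau> arr) r j = weight N bad A r j" for j
      by (intro weight_local loc) (auto simp: A_def)
    have b: "bad (\<tau> arr) r c j = bad A r c j" for c j
      using loc[unfolded local_test_def, rule_format, of r "\<tau> arr" A c j] by (simp add: A_def)
    have c: "cost (\<tau> arr) (\<tau> ''W'') r c M = (\<Sum>j<M. weight N bad A r j * of_bool (bad A r c j))" for c
      unfolding cost_def using I(3) by (intro sum.cong) (simp_all add: w b)
    have Ar: "A r = a" by (simp add: A_def)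
    have g: "greedy_choice M C N bad A r'" if "r' < Suc r" for r'
    proof (cases "r' = r")
      case True
      show ?thesis unfolding greedy_choice_def True Ar c[symmetric] using best st(5) by blast
    next
      case False
      then have "r' < r" using that by simp
      then show ?thesis using I(2)[of r']
        by (subst greedy_choice_local[OF loc, of _ _ "\<tau> arr"]) (auto simp: A_def)
    qed
    have W: "weight N bad A (Suc r) j = \<tau> ''W'' j * (N + of_bool (bad A r a j))" if "j < M" for j
      using I(3)[OF that] by (simp add: weight_Suc w Ar)
    define \<tau>2 where "\<tau>2 = \<tau>1(''c'' := (\<tau>1 ''c'')(0 := a), arr := A)"
    have st2: "agree E \<tau>2 \<rho>" "\<tau>2 arr = A" "\<tau>2 ''r'' 0 = r" "\<tau>2 ''c'' 0 = a" "\<tau>2 ''W'' = \<tau> ''W''"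
      using st by (simp_all add: \<tau>2_def)
    have "ok (Update cmd) \<tau>2 (2 + M * (tb + 3 * N + 8))
        (\<lambda>\<tau>. \<tau> ''r'' 0 = r \<and> I (Suc r) (\<tau>(''r'' := (\<tau> ''r'')(0 := Suc r))))"
    proof (rule ok_mono[OF ok_Update[OF st2(1)]], goal_cases)
      case (2 \<tau>')
      then have *: "\<tau>' arr = A" "\<tau>' ''r'' 0 = r" "agree E \<tau>' \<rho>"
        "\<And>j. j < M \<Longrightarrow> \<tau>' ''W'' j = weight N bad A (Suc r) j"
        using st2 by (simp_all add: W)
      show ?case using * g unfolding I_def by simp
    qed simp
    moreover have "\<tau>1(''c'' := (\<tau>1 ''c'')(0 := a), arr := (\<tau>1 arr)(r := a)) = \<tau>2"
      by (simp add: \<tau>2_def A_def st)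
    ultimately show ?case using st unfolding ok_Seq_Assign by (simp flip: a_def)
  qed (use that assms in \<open>auto simp: I_def t_def\<close>)
  show ?thesis
    unfolding Greedy_def
  proof (rule ok_SeqI[OF init, where u = "2 + R * (t + 2)"], goal_cases)
    case (1 \<tau>)
    show ?case
    proof (rule ok_For[where n = R and t = t and I = I], goal_cases)
      case 1
      show ?case using \<open>agree E \<tau> \<rho> \<and> _\<close> by (simp add: I_def)
    next
      case (2 k \<tau>)
      then show ?case by (simp add: I_def)
    next
      case (3 k \<tau>)
      then show ?case by (rule step)
    next
      case (4 \<tau>)
      then show ?case by (simp add: I_def)
    qed simp
  qed (simp add: t_def algebra_simps)
qed

end

section \<open>Subroutines\<close>

definition Eq :: "aexp \<Rightarrow> aexp \<Rightarrow> bexp" where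
  "Eq a b = Conj (Neg (Less a b)) (Neg (Less b a))"

lemma bval_Eq [simp]: "bval (Eq a b) \<sigma> \<longleftrightarrow> aval a \<sigma> = aval b \<sigma>"
  by (auto simp: Eq_def)

definition Bits :: "string \<Rightarrow> aexp \<Rightarrow> com" where
  "Bits z a = Seq (Put ''y'' a) (Seq (Put z (Const 0)) (For ''i'' a
     (Cond (Less (Const 0) (Var ''y''))
        (Seq (Put ''y'' (Div (Var ''y'') (Const 2))) (Put z (Add (Var z) (Const 1)))) Skip)))"

lemma ok_Bits:
  assumes z: "z \<noteq> ''i''" "z \<noteq> ''y''"
    and a: "\<And>\<tau>. \<forall>x. x \<notin> {z, ''i'', ''y''} \<longrightarrow> \<tau> x = \<sigma> x \<Longrightarrow> aval a \<tau> = u"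
    and a\<sigma>: "aval a \<sigma> = u"
    and T: "4 + 5 * u \<le> T"
  shows "ok (Bits z a) \<sigma> T (\<lambda>\<tau>. \<tau> z 0 = floorlog 2 u \<and> (\<forall>x. x \<notin> {z, ''i'', ''y''} \<longrightarrow> \<tau> x = \<sigma> x))"
proof -
  let ?loop = "For ''i'' a
     (Cond (Less (Const 0) (Var ''y''))
        (Seq (Put ''y'' (Div (Var ''y'') (Const 2))) (Put z (Add (Var z) (Const 1)))) Skip)"
  have rec: "floorlog 2 m = Suc (floorlog 2 (m div 2))" if "0 < m" for m
    using that by (subst compute_floorlog) simp
  \<comment> \<open>Halving lowers a positive number by at least one, so \<open>y\<close> is at most
    \<open>u - j\<close> after \<open>j\<close> passes and is exhausted after \<open>u\<close>
    passes. Linear time suffices because time is measured in \<open>n\<close> itself.\<close>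
  define I where "I j \<tau> \<longleftrightarrow> \<tau> z 0 + floorlog 2 (\<tau> ''y'' 0) = floorlog 2 u \<and> \<tau> ''y'' 0 \<le> u - j \<and>
      (\<forall>x. x \<notin> {z, ''i'', ''y''} \<longrightarrow> \<tau> x = \<sigma> x)" for j and \<tau> :: memory
  define \<sigma>' where "\<sigma>' = \<sigma>(''y'' := (\<sigma> ''y'')(0 := u), z := (\<sigma> z)(0 := 0))"
  have "ok ?loop \<sigma>' (2 + u * 5)
    (\<lambda>\<tau>. \<tau> z 0 = floorlog 2 u \<and> (\<forall>x. x \<notin> {z, ''i'', ''y''} \<longrightarrow> \<tau> x = \<sigma> x))"
  proof (rule ok_For[where I = I and n = u and t = 3], goal_cases)
    case 1
    show ?case using z by (simp add: I_def \<sigma>'_def)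
  next
    case (2 j \<tau>)
    then show ?case by (intro a) (simp add: I_def)
  next
    case (3 j \<tau>)
    then have I: "\<tau> z 0 + floorlog 2 (\<tau> ''y'' 0) = floorlog 2 u" "\<tau> ''y'' 0 \<le> u - j"
      "\<forall>x. x \<notin> {z, ''i'', ''y''} \<longrightarrow> \<tau> x = \<sigma> x" by (auto simp: I_def)
    show ?case
    proof (cases "0 < \<tau> ''y'' 0")
      case True
      then have "\<tau> ''y'' 0 div 2 \<le> u - Suc j" using I(2) by linarith
      then show ?thesis using I(1,3) 3(3) z rec[OF True] True by (simp add: I_def)
    next
      case False
      then show ?thesis using I 3(3) z by (simp add: I_def)
    qed
  next
    case (4 \<tau>)
    have "\<tau> ''y'' 0 = 0" using 4 by (simp add: I_def)
    moreover have "\<tau> z 0 + floorlog 2 (\<tau> ''y'' 0) = floorlog 2 u"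
      using 4 unfolding I_def by blast
    moreover have "\<forall>x. x \<notin> {z, ''i'', ''y''} \<longrightarrow> \<tau> x = \<sigma> x" using 4 by (simp add: I_def)
    moreover have "floorlog 2 0 = 0" by (simp add: floorlog_eq_zero_iff)
    ultimately show ?case by simp
  qed simp
  then have *: "ok ?loop \<sigma>' (T - 2)
    (\<lambda>\<tau>. \<tau> z 0 = floorlog 2 u \<and> (\<forall>x. x \<notin> {z, ''i'', ''y''} \<longrightarrow> \<tau> x = \<sigma> x))"
    by (rule ok_mono) (use T in auto)
  show ?thesis
    using * T z a\<sigma> unfolding Bits_def by (simp add: \<sigma>'_def numeral_2_eq_2)
qed

text \<open>Round \<open>r\<close> is read as \<open>s * B + \<beta>\<close>: it chooses the shift
  of block \<open>\<beta>\<close> for hash function \<open>s\<close>. The test \<open>j\<close>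
  codes a triple of a block, an earlier block and a residue difference \<open>d\<close>. It is
  active only in the rounds of its first block, and is violated when the new shift \<open>c\<close>
  exceeds the shift of the earlier block by \<open>d\<close> modulo \<open>p\<close>. This is a
  collision of elements of the two blocks whose residues differ by \<open>d\<close>.\<close>

definition hash_bad :: "nat \<Rightarrow> nat \<Rightarrow> (nat \<Rightarrow> nat) \<Rightarrow> nat \<Rightarrow> nat \<Rightarrow> nat \<Rightarrow> bool" where
  "hash_bad B p A r c j \<longleftrightarrow> j div p div B = r mod B \<and> j div p mod B < r mod B \<and>
     c = (A (r - r mod B + j div p mod B) + j mod p) mod p"

text \<open>The shift consulted belongs to an earlier block of the same hash function, so its index
  is below \<open>r\<close>.\<close>

lemma local_hash_bad: "local_test (hash_bad B p)"
proof -
  have "r - r mod B + m < r" if "m < r mod B" for r m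
    using that mod_less_eq_dividend[of r B] by linarith
  then show ?thesis unfolding local_test_def hash_bad_def by metis
qed

definition Hash_test :: com where
  "Hash_test =
    (let b = Div (Var ''j'') (Var ''p''); b1 = Div b (Var ''B''); b2 = Mod b (Var ''B''); \<beta> = Mod (Var ''r'') (Var ''B'')
     in Cond (Conj (Eq b1 \<beta>) (Conj (Less b2 \<beta>) (Eq (Var ''c'')
          (Mod (Add (Cell ''H'' (Add (Sub (Var ''r'') \<beta>) b2)) (Mod (Var ''j'') (Var ''p''))) (Var ''p'')))))
        (Put ''f'' (Const 1)) (Put ''f'' (Const 0)))"

lemma writes_Hash_test [simp]: "writes Hash_test = {''f''}"
  by (simp add: Hash_test_def Let_def)

lemma ok_Hash_test:
  "\<sigma> ''B'' 0 = B \<Longrightarrow> \<sigma> ''p'' 0 = p \<Longrightarrow> ok Hash_test \<sigma> 2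
     (\<lambda>\<tau>. \<tau> ''f'' 0 = of_bool (hash_bad B p (\<sigma> ''H'') (\<sigma> ''r'' 0) (\<sigma> ''c'' 0) (\<sigma> ''j'' 0)))"
  by (simp add: Hash_test_def Let_def hash_bad_def)

section \<open>Base-\<open>p\<close> codes and the test of a permutation\<close>

definition digit :: "nat \<Rightarrow> nat \<Rightarrow> nat \<Rightarrow> nat" where
  "digit p c b = c div p ^ b mod p"

text \<open>
  Here \<open>b 0\<close>, \<open>\<dots>\<close>, \<open>b k\<close> are the buckets of the \<open>k + 1\<close> largest elements in decreasing order and \<open>g\<close>
  gives the positions of the buckets. The best of these elements that comes before the largest one
  comes before the checkpoint, and the largest one comes after it.
\<close>

definition top_event :: "nat \<Rightarrow> nat \<Rightarrow> nat \<Rightarrow> (nat \<Rightarrow> nat) \<Rightarrow> (nat \<Rightarrow> nat) \<Rightarrow> bool" where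
  "top_event k m m' g b \<longleftrightarrow> m' \<le> g (b 0) \<and>
     (\<exists>i<k. g (b (Suc i)) < m \<and> (\<forall>j<i. g (b 0) < g (b (Suc j))))"

text \<open>The digits of \<open>c\<close> list the values of a candidate map, those of
  \<open>j\<close> the buckets of the \<open>k + 1\<close> largest elements. Tests with repeated
  buckets are never violated, and a map that is not injective violates all the others. So candidates
  and tests can range over all codes below a power of \<open>p\<close>.\<close>

definition perm_bad :: "nat \<Rightarrow> nat \<Rightarrow> nat \<Rightarrow> nat \<Rightarrow> (nat \<Rightarrow> nat) \<Rightarrow> nat \<Rightarrow> nat \<Rightarrow> nat \<Rightarrow> bool" where
  "perm_bad p k m m' A r c j \<longleftrightarrow> inj_on (digit p j) {..<Suc k} \<and>
     \<not> (inj_on (digit p c) {..<p} \<and> top_event k m m' (digit p c) (digit p j))"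

lemma local_perm_bad: "local_test (perm_bad p k m m')"
  by (simp add: local_test_def perm_bad_def)

text \<open>Expressions cannot exponentiate; the powers of \<open>p\<close> come from the table
  \<open>Pw\<close>, filled once during the setup.\<close>

definition Digit :: "aexp \<Rightarrow> aexp \<Rightarrow> aexp" where
  "Digit c b = Mod (Div c (Cell ''Pw'' b)) (Var ''p'')"

definition Inj :: "string \<Rightarrow> aexp \<Rightarrow> aexp \<Rightarrow> com" where
  "Inj z c len = Seq (Put z (Const 1)) (For ''x'' len (For ''y'' (Var ''x'')
     (Cond (Eq (Digit c (Var ''x'')) (Digit c (Var ''y''))) (Put z (Const 0)) Skip)))"

lemma writes_Inj [simp]: "writes (Inj z c len) = {z, ''x'', ''y''}"
  by (auto simp: Inj_def)

lemma inj_on_lessThan_Suc_iff: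
  "inj_on f {..<Suc n} \<longleftrightarrow> inj_on f {..<n} \<and> (\<forall>i<n. f n \<noteq> f i)" for n :: nat
  by (simp add: lessThan_Suc) (auto simp: image_iff)

lemma ok_Inj:
  assumes z: "z \<noteq> ''x''" "z \<noteq> ''y''" "z \<noteq> ''p''" "z \<noteq> ''Pw''"
    and ev: "\<And>\<tau>. \<forall>x. x \<notin> {z, ''x'', ''y''} \<longrightarrow> \<tau> x = \<sigma> x \<Longrightarrow> aval c \<tau> = v \<and> aval len \<tau> = n"
    and p: "\<sigma> ''p'' 0 = p" and Pw: "\<And>i. i < n \<Longrightarrow> \<sigma> ''Pw'' i = p ^ i"
    and T: "3 + n * (4 + n * 4) \<le> T"
  shows "ok (Inj z c len) \<sigma> T (\<lambda>\<tau>. \<tau> z 0 = of_bool (inj_on (digit p v) {..<n}) \<and>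
     (\<forall>x. x \<notin> {z, ''x'', ''y''} \<longrightarrow> \<tau> x = \<sigma> x))"
proof -
  define F where "F \<tau> \<longleftrightarrow> (\<forall>x. x \<notin> {z, ''x'', ''y''} \<longrightarrow> \<tau> x = \<sigma> x)" for \<tau> :: memory
  have F_upd [simp]: "F (\<tau>(x := w)) = F \<tau>" if "x \<in> {z, ''x'', ''y''}" for \<tau> x w
    using that by (auto simp: F_def)
  have F: "aval c \<tau> = v" "aval len \<tau> = n" "\<tau> ''p'' 0 = p" "\<And>i. i < n \<Longrightarrow> \<tau> ''Pw'' i = p ^ i"
    if "F \<tau>" for \<tau>
    using ev[OF that[unfolded F_def]] that z p Pw by (auto simp: F_def)
  define J where "J a b = (inj_on (digit p v) {..<a} \<and> (\<forall>i<b. digit p v a \<noteq> digit p v i))" for a b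
  define I where "I a b \<tau> \<longleftrightarrow> F \<tau> \<and> \<tau> z 0 = of_bool (J a b)" for a b and \<tau> :: memory
  have step: "ok (For ''y'' (Var ''x'') (Cond (Eq (Digit c (Var ''x'')) (Digit c (Var ''y''))) (Put z (Const 0)) Skip))
      \<tau> (2 + n * 4) (\<lambda>\<tau>. \<tau> ''x'' 0 = a \<and> I (Suc a) 0 (\<tau>(''x'' := (\<tau> ''x'')(0 := Suc a))))"
    if "a < n" "I a 0 \<tau>" "\<tau> ''x'' 0 = a" for a \<tau>
  proof (rule ok_For[where n = a and t = 2 and I = "\<lambda>b \<tau>. I a b \<tau> \<and> \<tau> ''x'' 0 = a"], goal_cases)
    case 1
    then show ?case using that z by (simp add: I_def)
  next
    case (2 b \<tau>)
    then show ?case by simp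
  next
    case (3 b \<tau>)
    then have *: "F \<tau>" "\<tau> z 0 = of_bool (J a b)" by (auto simp: I_def)
    have D: "aval (Digit c (Var ''x'')) \<tau> = digit p v a" "aval (Digit c (Var ''y'')) \<tau> = digit p v b"
      using F[OF *(1)] 3 \<open>a < n\<close> by (simp_all add: Digit_def digit_def)
    have J: "J a (Suc b) \<longleftrightarrow> J a b \<and> digit p v a \<noteq> digit p v b"
      by (auto simp: J_def less_Suc_eq)
    show ?case using * 3 z by (simp add: I_def D J)
  next
    case (4 \<tau>)
    have "J a a = J (Suc a) 0" by (simp add: J_def inj_on_lessThan_Suc_iff)
    then show ?case using 4 z by (simp add: I_def)
  next
    case 5
    show ?case using \<open>a < n\<close> by simp
  qed
  have "ok (For ''x'' len (For ''y'' (Var ''x'')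
      (Cond (Eq (Digit c (Var ''x'')) (Digit c (Var ''y''))) (Put z (Const 0)) Skip)))
      (\<sigma>(z := (\<sigma> z)(0 := 1))) (T - 1) (\<lambda>\<tau>. \<tau> z 0 = of_bool (inj_on (digit p v) {..<n}) \<and> F \<tau>)"
  proof (rule ok_For[where n = n and t = "2 + n * 4" and I = "\<lambda>a. I a 0"], goal_cases)
    case 1
    have "F \<sigma>" by (simp add: F_def)
    then show ?case using z by (simp add: I_def J_def)
  next
    case (2 a \<tau>)
    then show ?case using F by (simp add: I_def)
  next
    case (3 a \<tau>)
    then show ?case by (rule step)
  next
    case (4 \<tau>)
    then show ?case by (simp add: I_def J_def)
  next
    case 5
    show ?case using T by (simp add: algebra_simps)
  qed
  then show ?thesis unfolding Inj_def F_def using T by simp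
qed

text \<open>\<open>u\<close> says that no rank scanned so far comes before the maximum.
  \<open>f\<close> is set before \<open>u\<close> is updated, because the rank that decides the
  event may itself be the first to precede the maximum.\<close>

definition Scan :: com where
  "Scan =
    (let g = (\<lambda>i. Digit (Var ''c'') (Digit (Var ''j'') i)); y = g (Add (Var ''x'') (Const 1)) in
     Seq (Put ''u'' (Const 1)) (Seq (Put ''f'' (Const 0)) (For ''x'' (Var ''k'')
       (Seq (Cond (Conj (Less (Const 0) (Var ''u'')) (Less y (Var ''m''))) (Put ''f'' (Const 1)) Skip)
            (Cond (Less (g (Const 0)) y) Skip (Put ''u'' (Const 0)))))))"

definition Perm_test :: com where
  "Perm_test = Seq (Inj ''d'' (Var ''j'') (Add (Var ''k'') (Const 1)))
     (Seq (Inj ''e'' (Var ''c'') (Var ''p'')) (Seq Scan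
       (Cond (Conj (Less (Const 0) (Var ''d'')) (Neg (Conj (Less (Const 0) (Var ''e''))
           (Conj (Less (Const 0) (Var ''f'')) (Neg (Less (Digit (Var ''c'') (Digit (Var ''j'') (Const 0))) (Var ''m2'')))))))
         (Put ''f'' (Const 1)) (Put ''f'' (Const 0)))))"

lemma writes_Perm_test [simp]: "writes Perm_test = {''d'', ''e'', ''f'', ''u'', ''x'', ''y''}"
  by (auto simp: Perm_test_def Scan_def Let_def)

lemma digit_less: "0 < p \<Longrightarrow> digit p c b < p"
  by (simp add: digit_def)

lemma ok_Scan:
  assumes p: "\<sigma> ''p'' 0 = p" "0 < p" and Pw: "\<And>i. i \<le> p \<Longrightarrow> \<sigma> ''Pw'' i = p ^ i"
    and k: "\<sigma> ''k'' 0 = k" "k < p" and m: "\<sigma> ''m'' 0 = m"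
    and cj: "\<sigma> ''c'' 0 = c" "\<sigma> ''j'' 0 = j"
  shows "ok Scan \<sigma> (4 + p * 6) (\<lambda>\<tau>. \<tau> ''f'' 0 = of_bool (\<exists>i<k. digit p c (digit p j (Suc i)) < m \<and>
       (\<forall>i'<i. digit p c (digit p j 0) < digit p c (digit p j (Suc i')))) \<and>
     (\<forall>x. x \<notin> {''u'', ''f'', ''x''} \<longrightarrow> \<tau> x = \<sigma> x))"
proof -
  define g where "g i = digit p c (digit p j i)" for i
  define a where "a i = Digit (Var ''c'') (Digit (Var ''j'') i)" for i
  define y where "y = a (Add (Var ''x'') (Const 1))"
  define F where "F \<tau> \<longleftrightarrow> (\<forall>x. x \<notin> {''u'', ''f'', ''x''} \<longrightarrow> \<tau> x = \<sigma> x)" for \<tau> :: memory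
  have F_upd [simp]: "F (\<tau>(x := w)) = F \<tau>" if "x \<in> {''u'', ''f'', ''x''}" for \<tau> x w
    using that by (auto simp: F_def)
  have FD: "\<tau> ''p'' 0 = p" "\<And>i. i \<le> p \<Longrightarrow> \<tau> ''Pw'' i = p ^ i" "\<tau> ''k'' 0 = k" "\<tau> ''m'' 0 = m"
    "\<tau> ''c'' 0 = c" "\<tau> ''j'' 0 = j" if "F \<tau>" for \<tau>
    using that p Pw k m cj by (simp_all add: F_def)
  have ag: "aval (a e) \<tau> = g i" if "F \<tau>" "aval e \<tau> = i" "i \<le> p" for \<tau> e i
  proof -
    have "digit p j i \<le> p" using digit_less[OF p(2), of j i] by simp
    then show ?thesis using FD[OF that(1)] that(2,3)
      by (simp add: a_def g_def Digit_def digit_def)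
  qed
  define A where "A i \<longleftrightarrow> (\<forall>i'<i. g 0 < g (Suc i'))" for i
  define B where "B i \<longleftrightarrow> (\<exists>i'<i. g (Suc i') < m \<and> A i')" for i
  define I where "I i \<tau> \<longleftrightarrow> F \<tau> \<and> \<tau> ''u'' 0 = of_bool (A i) \<and> \<tau> ''f'' 0 = of_bool (B i)"
    for i and \<tau> :: memory
  have "ok (For ''x'' (Var ''k'')
       (Seq (Cond (Conj (Less (Const 0) (Var ''u'')) (Less y (Var ''m''))) (Put ''f'' (Const 1)) Skip)
            (Cond (Less (a (Const 0)) y) Skip (Put ''u'' (Const 0)))))
      (\<sigma>(''u'' := (\<sigma> ''u'')(0 := 1), ''f'' := (\<sigma> ''f'')(0 := 0))) (2 + p * 6)
     (\<lambda>\<tau>. \<tau> ''f'' 0 = of_bool (B k) \<and> F \<tau>)"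
  proof (rule ok_For[where n = k and t = 4 and I = I], goal_cases)
    case 1
    have "F \<sigma>" by (simp add: F_def)
    then show ?case by (simp add: I_def A_def B_def)
  next
    case (2 i \<tau>)
    then show ?case by (simp add: I_def FD)
  next
    case (3 i \<tau>)
    then have *: "F \<tau>" "\<tau> ''u'' 0 = of_bool (A i)" "\<tau> ''f'' 0 = of_bool (B i)" by (auto simp: I_def)
    have v: "aval y \<tau>' = g (Suc i)" "aval (a (Const 0)) \<tau>' = g 0" "\<tau>' ''m'' 0 = m"
      if "F \<tau>'" "\<tau>' ''x'' = \<tau> ''x''" for \<tau>'
      using 3 k ag[OF that(1)] FD[OF that(1)] that by (simp_all add: y_def)
    have A: "A (Suc i) \<longleftrightarrow> A i \<and> g 0 < g (Suc i)" by (auto simp: A_def less_Suc_eq)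
    have B: "B (Suc i) \<longleftrightarrow> B i \<or> g (Suc i) < m \<and> A i" by (auto simp: B_def less_Suc_eq)
    show ?case
      using * 3(3) by (auto simp: v I_def A B)
  next
    case (4 \<tau>)
    then show ?case by (simp add: I_def)
  next
    case 5
    show ?case using k by simp
  qed
  then show ?thesis
    unfolding Scan_def Let_def B_def A_def F_def g_def y_def a_def by simp
qed

lemma ok_Perm_test:
  assumes p: "\<sigma> ''p'' 0 = p" "0 < p" and Pw: "\<And>i. i \<le> p \<Longrightarrow> \<sigma> ''Pw'' i = p ^ i"
    and k: "\<sigma> ''k'' 0 = k" "k < p" and m: "\<sigma> ''m'' 0 = m" "\<sigma> ''m2'' 0 = m'"
  shows "ok Perm_test \<sigma> (12 + p * (14 + p * 8)) (\<lambda>\<tau>. \<tau> ''f'' 0 =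
     of_bool (perm_bad p k m m' A r (\<sigma> ''c'' 0) (\<sigma> ''j'' 0)))"
proof -
  define c where "c = \<sigma> ''c'' 0"
  define j where "j = \<sigma> ''j'' 0"
  have 1: "ok (Inj ''d'' (Var ''j'') (Add (Var ''k'') (Const 1))) \<sigma> (3 + p * (4 + p * 4))
      (\<lambda>\<tau>. \<tau> ''d'' 0 = of_bool (inj_on (digit p j) {..<Suc k}) \<and>
        (\<forall>x. x \<notin> {''d'', ''x'', ''y''} \<longrightarrow> \<tau> x = \<sigma> x))"
    using p Pw k mult_le_mono[of "Suc k" p "4 + Suc k * 4" "4 + p * 4"]
    by (intro ok_Inj) (simp_all add: j_def)
  show ?thesis
    unfolding Perm_test_def c_def[symmetric] j_def[symmetric]
  proof (rule ok_SeqI[OF 1, where u = "9 + p * (10 + p * 4)"], goal_cases)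
    case (1 \<tau>)
    have 2: "ok (Inj ''e'' (Var ''c'') (Var ''p'')) \<tau> (3 + p * (4 + p * 4))
      (\<lambda>\<tau>'. \<tau>' ''e'' 0 = of_bool (inj_on (digit p c) {..<p}) \<and>
        (\<forall>x. x \<notin> {''e'', ''x'', ''y''} \<longrightarrow> \<tau>' x = \<tau> x))"
      using 1 p Pw by (intro ok_Inj) (simp_all add: c_def)
    show ?case
    proof (rule ok_SeqI[OF 2, where u = "6 + p * 6"], goal_cases)
      case (1 \<tau>1)
      have st: "\<tau>1 ''p'' 0 = p" "\<And>i. i \<le> p \<Longrightarrow> \<tau>1 ''Pw'' i = p ^ i" "\<tau>1 ''k'' 0 = k" "\<tau>1 ''m'' 0 = m"
        "\<tau>1 ''c'' 0 = c" "\<tau>1 ''j'' 0 = j" "\<tau>1 ''m2'' 0 = m'"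
        "\<tau>1 ''d'' 0 = of_bool (inj_on (digit p j) {..<Suc k})"
        "\<tau>1 ''e'' 0 = of_bool (inj_on (digit p c) {..<p})"
        using 1 \<open>\<tau> ''d'' 0 = _ \<and> _\<close> p Pw k m by (simp_all add: c_def j_def)
      show ?case
      proof (rule ok_SeqI[OF ok_Scan[OF st(1) p(2) st(2) st(3) k(2) st(4-6)], where u = 2], goal_cases)
        case (2 \<tau>2)
        have st2: "\<tau>2 ''p'' 0 = p" "\<And>i. i \<le> p \<Longrightarrow> \<tau>2 ''Pw'' i = p ^ i"
          "\<tau>2 ''c'' 0 = c" "\<tau>2 ''j'' 0 = j" "\<tau>2 ''m2'' 0 = m'"
          "\<tau>2 ''d'' 0 = of_bool (inj_on (digit p j) {..<Suc k})"
          "\<tau>2 ''e'' 0 = of_bool (inj_on (digit p c) {..<p})"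
          using 2 st by simp_all
        define X where "X \<longleftrightarrow> (\<exists>i<k. digit p c (digit p j (Suc i)) < m \<and>
          (\<forall>i'<i. digit p c (digit p j 0) < digit p c (digit p j (Suc i'))))"
        have f: "\<tau>2 ''f'' 0 = of_bool X" using 2 unfolding X_def by blast
        have "digit p j 0 \<le> p" using digit_less[OF p(2), of j 0] by simp
        then have d: "aval (Digit (Var ''c'') (Digit (Var ''j'') (Const 0))) \<tau>2 = digit p c (digit p j 0)"
          using st2 by (simp add: Digit_def digit_def)
        show ?case
          unfolding perm_bad_def top_event_def X_def[symmetric]
          using st2 f by (auto simp: d not_le)
      qed simp_all
    qed (simp add: algebra_simps)
  qed (simp add: algebra_simps)
qed

section \<open>Hash functions, bucketed orders and their output\<close>

definition Push :: "aexp \<Rightarrow> com" where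
  "Push a = Seq (Assign ''out'' (Var ''ptr'') a) (Put ''ptr'' (Add (Var ''ptr'') (Const 1)))"

definition written :: "memory \<Rightarrow> nat list \<Rightarrow> bool" where
  "written \<sigma> zs \<longleftrightarrow> \<sigma> ''ptr'' 0 = length zs \<and> (\<forall>i<length zs. \<sigma> ''out'' i = zs ! i)"

lemma written_upd [simp]:
  "x \<noteq> ''ptr'' \<Longrightarrow> x \<noteq> ''out'' \<Longrightarrow> written (\<sigma>(x := v)) zs = written \<sigma> zs"
  by (simp add: written_def)

lemma ok_Push:
  assumes "written \<sigma> zs" "aval a \<sigma> = v" "E \<inter> {''out'', ''ptr''} = {}" "agree E \<sigma> \<rho>"
  shows "ok (Push a) \<sigma> 2 (\<lambda>\<tau>. written \<tau> (zs @ [v]) \<and> agree E \<tau> \<rho> \<and>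
    (\<forall>x. x \<notin> {''out'', ''ptr''} \<longrightarrow> \<tau> x = \<sigma> x))"
  using assms by (auto simp: Push_def written_def nth_append less_Suc_eq)

text \<open>Block \<open>q\<close> of \<open>p\<close> consecutive elements is shifted cyclically by
  \<open>H (s * B + q)\<close>. A complete block meets every bucket exactly once, whatever the
  shift, and this is the source of balance.\<close>

definition hash :: "nat \<Rightarrow> nat \<Rightarrow> (nat \<Rightarrow> nat) \<Rightarrow> nat \<Rightarrow> nat \<Rightarrow> nat" where
  "hash p B H s x = (x mod p + H (s * B + x div p)) mod p"

definition arrange :: "nat \<Rightarrow> nat \<Rightarrow> (nat \<Rightarrow> nat) \<Rightarrow> nat list" where
  "arrange n p h = concat (map (\<lambda>q. map Suc (filter (\<lambda>x. h x = q) [0..<n])) [0..<p])"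

text \<open>Every hash function is combined with every permutation, so the guarantees of the two
  families multiply: a good hash function meets all \<open>S\<close> permutations.\<close>

definition orders :: "nat \<Rightarrow> nat \<Rightarrow> nat \<Rightarrow> nat \<Rightarrow> (nat \<Rightarrow> nat) \<Rightarrow> (nat \<Rightarrow> nat) \<Rightarrow> nat list list" where
  "orders n p B S H G = concat (map (\<lambda>s. map (\<lambda>t.
     arrange n p (\<lambda>x. digit p (G t) (hash p B H s x))) [0..<S]) [0..<S])"

text \<open>\<open>sb\<close> caches the product \<open>s * B\<close>, which an expression cannot
  form.\<close>

definition Position :: aexp where
  "Position = Digit (Cell ''G'' (Var ''t'')) (Mod (Add (Mod (Var ''x'') (Var ''p''))
     (Cell ''H'' (Add (Var ''sb'') (Div (Var ''x'') (Var ''p''))))) (Var ''p''))"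

definition Arrange :: com where
  "Arrange = For ''q'' (Var ''p'') (For ''x'' (Var ''in'')
     (Cond (Eq Position (Var ''q'')) (Push (Add (Var ''x'') (Const 1))) Skip))"

definition Output :: com where
  "Output = Seq (Put ''ptr'' (Const 0)) (Seq (Times ''z'' (Var ''S'') (Var ''S'')) (Seq (Push (Var ''z''))
     (For ''s'' (Var ''S'') (Seq (Times ''sb'' (Var ''s'') (Var ''B''))
       (For ''t'' (Var ''S'') (Seq (Push (Var ''in'')) Arrange))))))"

lemma ok_Arrange:
  assumes E: "{''in'', ''p'', ''B'', ''S'', ''H'', ''G'', ''Pw'', ''s'', ''sb'', ''t''} \<subseteq> E"
      "E \<inter> {''q'', ''x'', ''out'', ''ptr''} = {}"
    and \<rho>: "\<rho> ''p'' 0 = p" "\<rho> ''in'' 0 = n" "\<rho> ''sb'' 0 = \<rho> ''s'' 0 * B" "0 < p" "\<And>i. i \<le> p \<Longrightarrow> \<rho> ''Pw'' i = p ^ i"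
    and \<sigma>: "agree E \<sigma> \<rho>" "written \<sigma> zs"
  shows "ok Arrange \<sigma> (2 + p * (4 + n * 5)) (\<lambda>\<tau>. agree E \<tau> \<rho> \<and>
     written \<tau> (zs @ arrange n p (\<lambda>x. digit p (\<rho> ''G'' (\<rho> ''t'' 0)) (hash p B (\<rho> ''H'') (\<rho> ''s'' 0) x))))"
proof -
  define h where "h x = digit p (\<rho> ''G'' (\<rho> ''t'' 0)) (hash p B (\<rho> ''H'') (\<rho> ''s'' 0) x)" for x
  have nE [simp]: "''q'' \<notin> E" "''x'' \<notin> E" "''out'' \<notin> E" "''ptr'' \<notin> E" using E(2) by auto
  have ag: "\<tau> ''p'' 0 = p" "\<tau> ''in'' 0 = n" "\<tau> ''sb'' 0 = \<rho> ''s'' 0 * B" "\<And>i. i \<le> p \<Longrightarrow> \<tau> ''Pw'' i = p ^ i"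
    "\<tau> ''G'' = \<rho> ''G''" "\<tau> ''H'' = \<rho> ''H''" "\<tau> ''t'' = \<rho> ''t''" if "agree E \<tau> \<rho>" for \<tau>
    using that E(1) \<rho> by (auto simp: agree_def)
  have pos: "aval Position \<tau> = h (\<tau> ''x'' 0)" if "agree E \<tau> \<rho>" for \<tau>
  proof -
    have "hash p B (\<rho> ''H'') (\<rho> ''s'' 0) x \<le> p" for x using \<open>0 < p\<close> by (simp add: hash_def less_imp_le)
    then show ?thesis using ag[OF that] by (simp add: Position_def Digit_def digit_def h_def hash_def)
  qed
  define f where "f q = map Suc (filter (\<lambda>x. h x = q) [0..<n])" for q
  define J where "J q x \<tau> \<longleftrightarrow> agree E \<tau> \<rho> \<and>
     written \<tau> (zs @ concat (map f [0..<q]) @ map Suc (filter (\<lambda>x. h x = q) [0..<x]))"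
    for q x and \<tau> :: memory
  have "ok Arrange \<sigma> (2 + p * (4 + n * 5)) (\<lambda>\<tau>. agree E \<tau> \<rho> \<and> written \<tau> (zs @ concat (map f [0..<p])))"
    unfolding Arrange_def
  proof (rule ok_For[where n = p and t = "2 + n * 5" and I = "\<lambda>q. J q 0"], goal_cases)
    case 1
    show ?case using \<sigma> by (simp add: J_def)
  next
    case (2 q \<tau>)
    then show ?case using ag by (simp add: J_def)
  next
    case (3 q \<tau>)
    show ?case
    proof (rule ok_For[where n = n and t = 3 and I = "\<lambda>x \<tau>. J q x \<tau> \<and> \<tau> ''q'' 0 = q"], goal_cases)
      case 1
      show ?case using 3 by (simp add: J_def)
    next
      case (2 x \<tau>)
      then show ?case using ag by (simp add: J_def)
    next
      case (3 x \<tau>)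
      then have J: "agree E \<tau> \<rho>" "\<tau> ''q'' 0 = q" "\<tau> ''x'' 0 = x"
        "written \<tau> (zs @ concat (map f [0..<q]) @ map Suc (filter (\<lambda>x. h x = q) [0..<x]))"
        by (auto simp: J_def)
      show ?case
      proof (cases "h x = q")
        case True
        have "ok (Push (Add (Var ''x'') (Const 1))) \<tau> 2 (\<lambda>\<tau>. \<tau> ''x'' 0 = x \<and>
             J q (Suc x) (\<tau>(''x'' := (\<tau> ''x'')(0 := Suc x))) \<and> (\<tau>(''x'' := (\<tau> ''x'')(0 := Suc x))) ''q'' 0 = q)"
          by (rule ok_mono[OF ok_Push[where v = "Suc x" and E = E and \<rho> = \<rho>, OF J(4)]])
             (use True J E(2) in \<open>simp_all add: J_def\<close>)
        then show ?thesis using True J pos[OF J(1)] by simp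
      next
        case False
        then show ?thesis using J pos[OF J(1)] by (simp add: J_def)
      qed
    next
      case (4 \<tau>)
      then show ?case by (simp add: J_def f_def)
    qed simp
  next
    case (4 \<tau>)
    then show ?case by (simp add: J_def)
  qed (simp add: algebra_simps)
  then show ?thesis unfolding arrange_def f_def h_def .
qed

section \<open>The list of orders\<close>

lemma mset_arrange:
  assumes "\<And>x. x < n \<Longrightarrow> h x < p"
  shows "mset (arrange n p h) = mset (map Suc [0..<n])"
proof -
  have "mset (concat (map (\<lambda>q. map Suc (filter (\<lambda>x. h x = q) xs)) [0..<p])) =
      image_mset Suc (filter_mset (\<lambda>x. h x < p) (mset xs))" for xs
  proof (induction p)
    case (Suc p)
    have "filter_mset (\<lambda>x. h x < Suc p) (mset xs) =
        filter_mset (\<lambda>x. h x < p) (mset xs) + filter_mset (\<lambda>x. h x = p) (mset xs)"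
      by (induction xs) (auto simp: less_Suc_eq)
    then show ?case using Suc by simp
  qed simp
  moreover have "filter_mset (\<lambda>x. h x < p) (mset [0..<n]) = mset [0..<n]"
    using assms by (intro filter_mset_eq_conv[THEN iffD2]) auto
  ultimately show ?thesis unfolding arrange_def by simp
qed

lemma length_arrange: "(\<And>x. x < n \<Longrightarrow> h x < p) \<Longrightarrow> length (arrange n p h) = n"
  using arg_cong[OF mset_arrange, of n h p size] by simp

lemma encode_orders:
  assumes "0 < p"
  shows "encode_lists (orders n p B S H G) = (S * S) # concat (map (\<lambda>s. concat (map (\<lambda>t.
     n # arrange n p (\<lambda>x. digit p (G t) (hash p B H s x))) [0..<S])) [0..<S])"
proof -
  have "length (orders n p B S H G) = S * S"
    by (simp add: orders_def length_concat comp_def sum_list_triv)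
  moreover have "map (\<lambda>xs. length xs # xs) (orders n p B S H G) = concat (map (\<lambda>s. map (\<lambda>t.
     n # arrange n p (\<lambda>x. digit p (G t) (hash p B H s x))) [0..<S]) [0..<S])"
    by (simp add: orders_def map_concat comp_def length_arrange digit_less[OF assms])
  moreover have "concat (concat yss) = concat (map concat yss)" for yss :: "nat list list list"
    by (induction yss) auto
  ultimately show ?thesis
    unfolding encode_lists_def by (simp add: comp_def)
qed

lemma outputs_written: "written \<tau> (encode_lists xss) \<Longrightarrow> outputs \<tau> xss"
  by (simp add: written_def outputs_def)

lemma ok_Output:
  assumes p: "\<sigma> ''p'' 0 = p" "0 < p" and n: "\<sigma> ''in'' 0 = n" and B: "\<sigma> ''B'' 0 = B" and S: "\<sigma> ''S'' 0 = S"
    and Pw: "\<And>i. i \<le> p \<Longrightarrow> \<sigma> ''Pw'' i = p ^ i"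
  shows "ok Output \<sigma> (8 + 3 * S + S * (7 + 3 * B + S * (6 + p * (4 + n * 5))))
    (\<lambda>\<tau>. outputs \<tau> (orders n p B S (\<sigma> ''H'') (\<sigma> ''G'')))"
proof -
  define f where "f s t = n # arrange n p (\<lambda>x. digit p (\<sigma> ''G'' t) (hash p B (\<sigma> ''H'') s x))" for s t
  define g where "g s = concat (map (f s) [0..<S])" for s
  define E where "E = {''in'', ''p'', ''B'', ''S'', ''H'', ''G'', ''Pw''}"
  have nE: "''i'' \<notin> E" "''z'' \<notin> E" "''out'' \<notin> E" "''ptr'' \<notin> E" "''s'' \<notin> E" "''sb'' \<notin> E" "''t'' \<notin> E"
    "''q'' \<notin> E" "''x'' \<notin> E" by (simp_all add: E_def)
  have ag: "\<tau> ''p'' 0 = p" "\<tau> ''in'' 0 = n" "\<tau> ''B'' 0 = B" "\<tau> ''S'' 0 = S" "\<And>i. i \<le> p \<Longrightarrow> \<tau> ''Pw'' i = p ^ i"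
    "\<tau> ''G'' = \<sigma> ''G''" "\<tau> ''H'' = \<sigma> ''H''" if "agree E \<tau> \<sigma>" for \<tau>
    using that p n B S Pw by (auto simp: agree_def E_def)
  have enc: "encode_lists (orders n p B S (\<sigma> ''H'') (\<sigma> ''G'')) = [S * S] @ concat (map g [0..<S])"
    unfolding encode_orders[OF p(2)] g_def f_def by simp
  define T where "T = 4 + p * (4 + n * 5)"
  have inner: "ok (Seq (Push (Var ''in'')) Arrange) \<tau> T (\<lambda>\<tau>'. agree E \<tau>' \<sigma> \<and> written \<tau>' (zs @ f s t) \<and>
      \<tau>' ''s'' = \<tau> ''s'' \<and> \<tau>' ''sb'' = \<tau> ''sb'' \<and> \<tau>' ''t'' = \<tau> ''t'')"
    if \<tau>: "agree E \<tau> \<sigma>" "written \<tau> zs" "\<tau> ''s'' 0 = s" "\<tau> ''sb'' 0 = s * B" "\<tau> ''t'' 0 = t" for \<tau> zs s t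
  proof (rule ok_SeqI[OF ok_Push[where E = E and v = n and \<rho> = \<sigma>, OF \<tau>(2) _ _ \<tau>(1)],
        where u = "2 + p * (4 + n * 5)"], goal_cases)
    case (3 \<tau>1)
    \<comment> \<open>Adding the loop counters to the preserved names makes
      \<open>ok_Arrange\<close> return them unchanged as well.\<close>
    define E' where "E' = E \<union> {''s'', ''sb'', ''t''}"
    have e: "agree E' \<tau>2 \<tau>1 \<Longrightarrow> agree E \<tau>2 \<sigma> \<and> \<tau>2 ''s'' = \<tau> ''s'' \<and> \<tau>2 ''sb'' = \<tau> ''sb'' \<and> \<tau>2 ''t'' = \<tau> ''t''" for \<tau>2
      using 3 by (auto simp: agree_def E'_def)
    have 1: "agree E \<tau>1 \<sigma>" "written \<tau>1 (zs @ [n])" "\<tau>1 ''s'' = \<tau> ''s''" "\<tau>1 ''sb'' = \<tau> ''sb''" "\<tau>1 ''t'' = \<tau> ''t''"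
      using 3 by simp_all
    have "ok Arrange \<tau>1 (2 + p * (4 + n * 5)) (\<lambda>\<tau>2. agree E' \<tau>2 \<tau>1 \<and>
      written \<tau>2 ((zs @ [n]) @ arrange n p (\<lambda>x. digit p (\<tau>1 ''G'' (\<tau>1 ''t'' 0)) (hash p B (\<tau>1 ''H'') (\<tau>1 ''s'' 0) x))))"
      by (rule ok_Arrange) (use ag[OF 1(1)] 1 \<tau> p in \<open>auto simp: E'_def E_def agree_def\<close>)
    then show ?case
      by (rule ok_mono) (use e 1 ag[OF 1(1)] \<tau> in \<open>auto simp: f_def\<close>)
  qed (use nE ag[OF \<tau>(1)] in \<open>simp_all add: T_def\<close>)
  define I where "I s \<tau> \<longleftrightarrow> agree E \<tau> \<sigma> \<and> written \<tau> ([S * S] @ concat (map g [0..<s]))" for s and \<tau> :: memory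
  have middle: "ok (Seq (Times ''sb'' (Var ''s'') (Var ''B''))
       (For ''t'' (Var ''S'') (Seq (Push (Var ''in'')) Arrange))) \<tau> (5 + 3 * B + S * (T + 2))
      (\<lambda>\<tau>. \<tau> ''s'' 0 = s \<and> I (Suc s) (\<tau>(''s'' := (\<tau> ''s'')(0 := Suc s))))"
    if "I s \<tau>" "\<tau> ''s'' 0 = s" for s \<tau>
  proof (rule ok_SeqI[OF ok_Times[where u = s and w = B and T = "3 + 3 * B"], where u = "2 + S * (T + 2)"], goal_cases)
    case (2 \<tau>')
    then have "\<tau>' ''B'' = \<tau> ''B''" "\<tau>' ''s'' = \<tau> ''s''" by simp_all
    then show ?case using that ag by (simp add: I_def)
  next
    case (4 \<tau>1)
    then have fr: "\<And>x. x \<noteq> ''sb'' \<Longrightarrow> x \<noteq> ''i'' \<Longrightarrow> \<tau>1 x = \<tau> x" "\<tau>1 ''sb'' 0 = s * B" by simp_all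
    have a1: "agree E \<tau>1 \<sigma>"
      unfolding agree_def
    proof
      fix x assume "x \<in> E"
      then have "x \<noteq> ''sb''" "x \<noteq> ''i''" using nE by auto
      then show "\<tau>1 x = \<sigma> x" using fr \<open>x \<in> E\<close> that(1) by (simp add: I_def agree_def)
    qed
    have w1: "written \<tau>1 ([S * S] @ concat (map g [0..<s]))"
      using that(1) fr by (simp add: I_def written_def)
    define J where "J t \<tau> \<longleftrightarrow> agree E \<tau> \<sigma> \<and> \<tau> ''s'' 0 = s \<and> \<tau> ''sb'' 0 = s * B \<and>
      written \<tau> (([S * S] @ concat (map g [0..<s])) @ concat (map (f s) [0..<t]))" for t and \<tau> :: memory
    show ?case
    proof (rule ok_For[where n = S and t = T and I = J], goal_cases)
      case 1
      show ?case using a1 w1 fr that(2) nE by (simp add: J_def)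
    next
      case (2 t \<tau>)
      then show ?case using ag by (simp add: J_def)
    next
      case (3 t \<tau>)
      then have J: "agree E \<tau> \<sigma>" "written \<tau> (([S * S] @ concat (map g [0..<s])) @ concat (map (f s) [0..<t]))"
        "\<tau> ''s'' 0 = s" "\<tau> ''sb'' 0 = s * B" "\<tau> ''t'' 0 = t" by (auto simp: J_def)
      show ?case
        by (rule ok_mono[OF inner[OF J]]) (use J nE in \<open>auto simp: J_def\<close>)
    next
      case (4 \<tau>)
      then show ?case using nE by (auto simp: J_def I_def g_def)
    qed simp
  qed simp_all
  have tail: "ok (Seq (Push (Var ''z'')) (For ''s'' (Var ''S'') (Seq (Times ''sb'' (Var ''s'') (Var ''B''))
       (For ''t'' (Var ''S'') (Seq (Push (Var ''in'')) Arrange))))) \<tau> (4 + S * (7 + 3 * B + S * (T + 2)))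
     (\<lambda>\<tau>. outputs \<tau> (orders n p B S (\<sigma> ''H'') (\<sigma> ''G'')))"
    if \<tau>: "agree E \<tau> \<sigma>" "written \<tau> []" "\<tau> ''z'' 0 = S * S" for \<tau>
  proof (rule ok_SeqI[OF ok_Push[where E = E and v = "S * S" and \<rho> = \<sigma>, OF \<tau>(2) _ _ \<tau>(1)],
        where u = "2 + S * (7 + 3 * B + S * (T + 2))"], goal_cases)
    case (3 \<tau>1)
    show ?case
    proof (rule ok_For[where n = S and t = "5 + 3 * B + S * (T + 2)" and I = I], goal_cases)
      case 1
      show ?case using 3 nE by (simp add: I_def)
    next
      case (2 t \<tau>)
      then show ?case using ag by (simp add: I_def)
    next
      case (3 t \<tau>)
      then show ?case by (intro middle)
    next
      case (4 \<tau>)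
      then show ?case by (intro outputs_written) (simp add: I_def enc)
    qed simp
  qed (use nE \<tau> in simp_all)
  show ?thesis
    unfolding Output_def ok_Seq_Assign
  proof (intro conjI, simp,
      rule ok_SeqI[OF ok_Times[where u = S and w = S and T = "3 + 3 * S"],
        where u = "4 + S * (7 + 3 * B + S * (T + 2))"], goal_cases)
    case (2 \<tau>)
    then have "\<tau> ''S'' = \<sigma> ''S''" by simp
    then show ?case using S by simp
  next
    case (4 \<tau>)
    then have fr: "\<And>x. x \<noteq> ''z'' \<Longrightarrow> x \<noteq> ''i'' \<Longrightarrow> \<tau> x = (\<sigma>(''ptr'' := (\<sigma> ''ptr'')(0 := 0))) x" "\<tau> ''z'' 0 = S * S"
      by simp_all
    have "agree E \<tau> \<sigma>"
      unfolding agree_def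
    proof
      fix x assume "x \<in> E"
      then have "x \<noteq> ''z''" "x \<noteq> ''i''" "x \<noteq> ''ptr''" using nE by auto
      then show "\<tau> x = \<sigma> x" using fr by simp
    qed
    moreover have "written \<tau> []" using fr(1)[of "''ptr''"] by (simp add: written_def)
    ultimately show ?case using tail fr(2) by blast
  qed (simp_all add: T_def)
qed

section \<open>The complete program\<close>

definition bits :: "nat \<Rightarrow> nat" where
  "bits n = floorlog 2 n"

definition buckets :: "nat \<Rightarrow> nat" where
  "buckets n = bits n div bits (bits n)"

text \<open>Each further rank comes before the maximum with frequency at least \<open>1 / 4\<close>
  among the orders still undecided. As \<open>(3 / 4) ^ 4 \<le> 1 / 2\<close>, the factor 4 leaves
  an undecided fraction of at most \<open>1 / bits n\<close>.\<close>

definition depth :: "nat \<Rightarrow> nat" where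
  "depth n = 4 * bits (bits n)"

definition blocks :: "nat \<Rightarrow> nat" where
  "blocks n = n div buckets n + 1"

text \<open>\<open>p (1 - 1 / p) ^ p\<close> approximates \<open>p / e\<close> up to a constant.\<close>

definition threshold :: "nat \<Rightarrow> nat" where
  "threshold n = (buckets n - 1) ^ buckets n div buckets n ^ (buckets n - 1)"

definition Powers :: com where
  "Powers = For ''x'' (Var ''p'') (Seq (Times ''z'' (Cell ''Pw'' (Var ''x'')) (Var ''p''))
            (Assign ''Pw'' (Add (Var ''x'') (Const 1)) (Var ''z'')))"

definition Last_power :: com where
  "Last_power = For ''x'' (Var ''p'') (Seq (Times ''z'' (Var ''q'') (Sub (Var ''p'') (Const 1))) (Put ''q'' (Var ''z'')))"

text \<open>\<open>m = threshold - 1\<close> and \<open>m2 = threshold + 3\<close> enclose the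
  checkpoint: buckets at positions below \<open>m\<close> are inspected entirely before it, those
  from \<open>m2\<close> on entirely after it. The margins absorb the rounding, see
  \<open>checkpoint_bounds\<close>. The variable \<open>k\<close> first holds
  \<open>bits (bits n)\<close> and is then quadrupled.\<close>

definition Setup :: com where
  "Setup = Seq (Bits ''l'' (Var ''in'')) (Seq (Bits ''k'' (Var ''l''))
    (Seq (Put ''p'' (Div (Var ''l'') (Var ''k'')))
    (Seq (Put ''k'' (Add (Add (Var ''k'') (Var ''k'')) (Add (Var ''k'') (Var ''k''))))
    (Seq (Put ''B'' (Add (Div (Var ''in'') (Var ''p'')) (Const 1)))
    (Seq (Put ''Pw'' (Const 1))
    (Seq Powers
    (Seq (Put ''q'' (Const 1))
    (Seq Last_power
    (Seq (Put ''m2'' (Add (Div (Var ''q'') (Cell ''Pw'' (Sub (Var ''p'') (Const 1)))) (Const 3)))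
    (Seq (Put ''m'' (Sub (Var ''m2'') (Const 4)))
    (Seq (Times ''z'' (Var ''l'') (Var ''l'')) (Times ''S'' (Var ''z'') (Var ''l'')))))))))))))"

definition base_vars :: "string set" where
  "base_vars = {''in'', ''l'', ''p'', ''k'', ''B'', ''Pw'', ''m'', ''m2'', ''S''}"

definition base :: "nat \<Rightarrow> memory \<Rightarrow> bool" where
  "base n \<sigma> \<longleftrightarrow> \<sigma> ''in'' 0 = n \<and> \<sigma> ''l'' 0 = bits n \<and> \<sigma> ''p'' 0 = buckets n \<and> \<sigma> ''k'' 0 = depth n \<and>
     \<sigma> ''B'' 0 = blocks n \<and> (\<forall>i\<le>buckets n. \<sigma> ''Pw'' i = buckets n ^ i) \<and>
     \<sigma> ''m'' 0 = threshold n - 1 \<and> \<sigma> ''m2'' 0 = threshold n + 3 \<and> \<sigma> ''S'' 0 = bits n ^ 3"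

lemma base_agree: "base n \<sigma> \<Longrightarrow> agree base_vars \<tau> \<sigma> \<Longrightarrow> base n \<tau>"
  by (simp add: base_def agree_def base_vars_def)

lemma base_frame:
  "base n \<sigma> \<Longrightarrow> \<forall>x. x \<notin> X \<longrightarrow> \<tau> x = \<sigma> x \<Longrightarrow> X \<inter> base_vars = {} \<Longrightarrow> base n \<tau>"
  by (rule base_agree) (auto simp: agree_def)

lemma base_upd: "x \<notin> base_vars \<Longrightarrow> base n \<sigma> \<Longrightarrow> base n (\<sigma>(x := v))"
  by (rule base_agree) (auto simp: agree_def)

lemma ok_Seq_Times:
  assumes "z \<noteq> ''i''"
    and "\<And>\<tau>. \<forall>x. x \<noteq> z \<and> x \<noteq> ''i'' \<longrightarrow> \<tau> x = \<sigma> x \<Longrightarrow> aval a \<tau> = u \<and> aval b \<tau> = w"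
    and "\<And>\<tau>. \<tau> z 0 = u * w \<Longrightarrow> (\<And>x. x \<noteq> z \<Longrightarrow> x \<noteq> ''i'' \<Longrightarrow> \<tau> x = \<sigma> x) \<Longrightarrow> ok d \<tau> t Q"
    and "3 + 3 * w + t \<le> T"
  shows "ok (Seq (Times z a b) d) \<sigma> T Q"
  by (rule ok_SeqI[OF ok_Times[OF assms(1,2) order.refl]]) (use assms(3,4) in auto)

lemma ok_Seq_Bits:
  assumes "z \<noteq> ''i''" "z \<noteq> ''y''"
    and "\<And>\<tau>. \<forall>x. x \<notin> {z, ''i'', ''y''} \<longrightarrow> \<tau> x = \<sigma> x \<Longrightarrow> aval a \<tau> = u"
    and "aval a \<sigma> = u"
    and "\<And>\<tau>. \<tau> z 0 = bits u \<Longrightarrow> (\<And>x. x \<noteq> z \<Longrightarrow> x \<noteq> ''i'' \<Longrightarrow> x \<noteq> ''y'' \<Longrightarrow> \<tau> x = \<sigma> x) \<Longrightarrow> ok d \<tau> t Q"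
    and "4 + 5 * u + t \<le> T"
  shows "ok (Seq (Bits z a) d) \<sigma> T Q"
  by (rule ok_SeqI[OF ok_Bits[OF assms(1-4) order.refl]]) (use assms(5,6) in \<open>auto simp: bits_def\<close>)

definition setup_time :: "nat \<Rightarrow> nat" where
  "setup_time n = 28 + 5 * n + 11 * bits n + 2 * buckets n * (6 + 3 * buckets n)"

lemma ok_Setup: "ok Setup (input_memory n) (setup_time n) (base n)"
proof -
  define p where "p = buckets n"
  define t3 where "t3 = 11 + 6 * bits n"
  define t2 where "t2 = t3 + (2 + p * (6 + 3 * p))"
  define t1 where "t1 = 5 + (2 + p * (6 + 3 * p)) + t2"
  define init where "init \<sigma> \<longleftrightarrow> \<sigma> ''in'' 0 = n \<and> \<sigma> ''l'' 0 = bits n \<and> \<sigma> ''p'' 0 = p \<and> \<sigma> ''k'' 0 = depth n \<and>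
     \<sigma> ''B'' 0 = blocks n" for \<sigma> :: memory
  have T: "setup_time n = 4 + 5 * n + (4 + 5 * bits n + t1)"
    by (simp add: setup_time_def t1_def t2_def t3_def p_def algebra_simps)
  show ?thesis
    unfolding Setup_def T
  proof (rule ok_Seq_Bits[where u = n and t = "4 + 5 * bits n + t1"], goal_cases)
    case (5 \<tau>)
    note outer = 5
    show ?case
    proof (rule ok_Seq_Bits[where u = "bits n" and t = t1], goal_cases)
      case (5 \<tau>')
      have in0: "\<tau>' ''in'' 0 = n" "\<tau>' ''l'' 0 = bits n" "\<tau>' ''k'' 0 = bits (bits n)"
        using 5 outer by (simp_all add: input_memory_def)
      define \<sigma> where "\<sigma> = \<tau>'(''p'' := (\<tau>' ''p'')(0 := p), ''k'' := (\<tau>' ''k'')(0 := depth n),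
         ''B'' := (\<tau>' ''B'')(0 := blocks n), ''Pw'' := (\<tau>' ''Pw'')(0 := 1))"
      have \<sigma>: "init \<sigma>" "\<sigma> ''Pw'' 0 = 1" using in0 by (simp_all add: \<sigma>_def init_def)
      define J where "J i \<tau> \<longleftrightarrow> init \<tau> \<and> (\<forall>i'\<le>i. \<tau> ''Pw'' i' = p ^ i')" for i and \<tau> :: memory
      have pow: "ok Powers \<sigma> (2 + p * (6 + 3 * p)) (J p)"
        unfolding Powers_def
      proof (rule ok_For[where n = p and t = "4 + 3 * p" and I = J], goal_cases)
        case 1
        show ?case using \<sigma> by (simp add: J_def init_def)
      next
        case (2 i \<tau>)
        then show ?case by (simp add: J_def init_def)
      next
        case (3 i \<tau>)
        show ?case
        proof (rule ok_Seq_Times[where u = "p ^ i" and w = p and t = 1], goal_cases)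
          case (2 \<tau>')
          then have "\<tau>' ''Pw'' = \<tau> ''Pw''" "\<tau>' ''x'' = \<tau> ''x''" "\<tau>' ''p'' = \<tau> ''p''" by simp_all
          then show ?case using 3 by (simp add: J_def init_def)
        next
          case (3 \<tau>')
          have *: "\<tau>' x = \<tau> x" if "x \<noteq> ''z''" "x \<noteq> ''i''" for x using 3 that by blast
          have "init \<tau>" "\<forall>i'\<le>i. \<tau> ''Pw'' i' = p ^ i'" "\<tau> ''x'' 0 = i"
            using \<open>J i \<tau>\<close> \<open>\<tau> ''x'' 0 = i\<close> by (simp_all add: J_def)
          then show ?case using 3(1) by (auto simp: J_def init_def * le_Suc_eq)
        qed simp_all
      qed simp_all
      have main: "ok (Seq Powers
    (Seq (Put ''q'' (Const 1))
    (Seq Last_power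
    (Seq (Put ''m2'' (Add (Div (Var ''q'') (Cell ''Pw'' (Sub (Var ''p'') (Const 1)))) (Const 3)))
    (Seq (Put ''m'' (Sub (Var ''m2'') (Const 4)))
    (Seq (Times ''z'' (Var ''l'') (Var ''l'')) (Times ''S'' (Var ''z'') (Var ''l'')))))))) \<sigma> (t1 - 4) (base n)"
      proof (rule ok_SeqI[OF pow, where u = "1 + t2"], goal_cases)
        case (1 \<tau>1)
        define I where "I i \<tau> \<longleftrightarrow> J p \<tau> \<and> \<tau> ''q'' 0 = (p - 1) ^ i" for i and \<tau> :: memory
        have J1: "J p (\<tau>1(''q'' := (\<tau>1 ''q'')(0 := 1)))" using 1 by (simp add: J_def init_def)
        have pow2: "ok Last_power
            (\<tau>1(''q'' := (\<tau>1 ''q'')(0 := 1))) (2 + p * (6 + 3 * p)) (I p)"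
          unfolding Last_power_def
        proof (rule ok_For[where n = p and t = "4 + 3 * p" and I = I], goal_cases)
          case 1
          show ?case using J1 by (simp add: I_def J_def init_def)
        next
          case (2 i \<tau>)
          then show ?case by (simp add: I_def J_def init_def)
        next
          case (3 i \<tau>)
          show ?case
          proof (rule ok_Seq_Times[where u = "(p - 1) ^ i" and w = "p - 1" and t = 1], goal_cases)
            case (2 \<tau>')
            then have "\<tau>' ''q'' = \<tau> ''q''" "\<tau>' ''p'' = \<tau> ''p''" by simp_all
            then show ?case using 3 by (simp add: I_def J_def init_def)
          next
            case (3 \<tau>')
            have *: "\<tau>' x = \<tau> x" if "x \<noteq> ''z''" "x \<noteq> ''i''" for x using 3 that by blast
            have "I i \<tau>" "\<tau> ''x'' 0 = i" by fact+
            then show ?case using 3(1) by (simp add: I_def J_def init_def * mult.commute)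
          qed simp_all
        qed simp_all
        have "ok (Seq Last_power
         (Seq (Put ''m2'' (Add (Div (Var ''q'') (Cell ''Pw'' (Sub (Var ''p'') (Const 1)))) (Const 3)))
         (Seq (Put ''m'' (Sub (Var ''m2'') (Const 4)))
         (Seq (Times ''z'' (Var ''l'') (Var ''l'')) (Times ''S'' (Var ''z'') (Var ''l''))))))
         (\<tau>1(''q'' := (\<tau>1 ''q'')(0 := 1))) t2 (base n)"
        proof (rule ok_SeqI[OF pow2, where u = t3], goal_cases)
          case (1 \<tau>2)
          define \<tau>3 where "\<tau>3 = \<tau>2(''m2'' := (\<tau>2 ''m2'')(0 := threshold n + 3), ''m'' := (\<tau>2 ''m'')(0 := threshold n - 1))"
          have J2: "J p \<tau>2" "\<tau>2 ''q'' 0 = (p - 1) ^ p" using 1 by (simp_all add: I_def)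
          then have J3: "J p \<tau>3" "\<tau>3 ''m2'' 0 = threshold n + 3" "\<tau>3 ''m'' 0 = threshold n - 1"
            by (simp_all add: J_def init_def \<tau>3_def)
          have "ok (Seq (Times ''z'' (Var ''l'') (Var ''l'')) (Times ''S'' (Var ''z'') (Var ''l''))) \<tau>3 (t3 - 2) (base n)"
          proof (rule ok_Seq_Times[where u = "bits n" and w = "bits n" and t = "3 + 3 * bits n"], goal_cases)
            case (2 \<tau>)
            then have "\<tau> ''l'' = \<tau>3 ''l''" by simp
            then show ?case using J3 by (simp add: J_def init_def)
          next
            case (3 \<tau>)
            have *: "\<tau> x = \<tau>3 x" if "x \<noteq> ''z''" "x \<noteq> ''i''" for x using 3 that by blast
            show ?case
            proof (rule ok_mono[OF ok_Times[where u = "bits n * bits n" and w = "bits n" and T = "3 + 3 * bits n"]], goal_cases)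
              case (2 \<tau>')
              then have "\<tau>' ''l'' = \<tau> ''l''" "\<tau>' ''z'' = \<tau> ''z''" by simp_all
              then show ?case using J3 3(1) by (simp add: J_def init_def *)
            next
              case (5 \<tau>')
              then show ?case using J3
                by (simp add: base_def J_def init_def * p_def power3_eq_cube)
            qed simp_all
          qed (simp_all add: t3_def)
          then show ?case
            using J2 unfolding \<tau>3_def J_def init_def
            by (simp add: t3_def threshold_def p_def)
        qed (simp add: t2_def)
        then show ?case by simp
      qed (simp add: t1_def)
      have "bits n div bits (bits n) = p" "Suc (n div p) = blocks n"
        "bits (bits n) + bits (bits n) + (bits (bits n) + bits (bits n)) = depth n"
        by (simp_all add: p_def buckets_def blocks_def depth_def)
      then show ?case
        using main in0 unfolding \<sigma>_def by (simp add: t1_def)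
    qed (use outer in simp_all)
  qed (simp_all add: input_memory_def)
qed

definition Stage1 :: com where
  "Stage1 = Seq (Times ''R'' (Var ''S'') (Var ''B'')) (Seq (Times ''z'' (Var ''B'') (Var ''B''))
    (Seq (Times ''M'' (Var ''z'') (Var ''p'')) (Seq (Put ''C'' (Var ''p'')) (Seq (Put ''N'' (Var ''l''))
      (Greedy ''H'' Hash_test)))))"

definition Stage2 :: com where
  "Stage2 = Seq (Put ''R'' (Var ''S'')) (Seq (Put ''C'' (Cell ''Pw'' (Var ''p'')))
    (Seq (Put ''M'' (Cell ''Pw'' (Add (Var ''k'') (Const 1)))) (Seq (Put ''N'' (Var ''l''))
      (Greedy ''G'' Perm_test))))"

definition Program :: com where
  "Program = Seq Setup (Seq Stage1 (Seq Stage2 Output))"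

text \<open>With \<open>N = bits n\<close> the greedy algorithm loses a factor
  \<open>1 + 1 / N\<close> and an additive frequency
  \<open>(N + 1) * ln (number of tests) / rounds\<close>. The logarithm is at most
  \<open>3 * bits n\<close>, so a cubic number of rounds makes both losses
  \<open>O(1 / bits n)\<close>. The family then has \<open>bits n ^ 6\<close> members.\<close>

definition rounds :: "nat \<Rightarrow> nat" where
  "rounds n = bits n ^ 3"

definition good_hash :: "nat \<Rightarrow> (nat \<Rightarrow> nat) \<Rightarrow> bool" where
  "good_hash n H \<longleftrightarrow> (\<forall>r < rounds n * blocks n.
     greedy_choice (blocks n * blocks n * buckets n) (buckets n) (bits n) (hash_bad (blocks n) (buckets n)) H r)"

definition good_perms :: "nat \<Rightarrow> (nat \<Rightarrow> nat) \<Rightarrow> bool" where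
  "good_perms n G \<longleftrightarrow> (\<forall>r < rounds n.
     greedy_choice (buckets n ^ Suc (depth n)) (buckets n ^ buckets n) (bits n)
       (perm_bad (buckets n) (depth n) (threshold n - 1) (threshold n + 3)) G r)"

definition greedy_time :: "nat \<Rightarrow> nat \<Rightarrow> nat \<Rightarrow> nat \<Rightarrow> nat \<Rightarrow> nat" where
  "greedy_time tb M C N R = 5 + M * 3 + R * (8 + C * (8 + M * (tb + 4)) + M * (tb + 3 * N + 8))"

definition stage1_time :: "nat \<Rightarrow> nat" where
  "stage1_time n = 11 + 6 * blocks n + 3 * buckets n +
     greedy_time 2 (blocks n * blocks n * buckets n) (buckets n) (bits n) (rounds n * blocks n)"

definition stage2_time :: "nat \<Rightarrow> nat" where
  "stage2_time n = 4 + greedy_time (12 + buckets n * (14 + buckets n * 8))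
     (buckets n ^ Suc (depth n)) (buckets n ^ buckets n) (bits n) (rounds n)"

definition output_time :: "nat \<Rightarrow> nat" where
  "output_time n = 8 + 3 * rounds n +
     rounds n * (7 + 3 * blocks n + rounds n * (6 + buckets n * (4 + n * 5)))"

lemma ok_Stage1:
  assumes "base n \<sigma>" "0 < buckets n"
  shows "ok Stage1 \<sigma> (stage1_time n) (\<lambda>\<tau>. base n \<tau> \<and> good_hash n (\<tau> ''H''))"
proof -
  define M where "M = blocks n * blocks n * buckets n"
  define gt where "gt = greedy_time 2 M (buckets n) (bits n) (rounds n * blocks n)"
  define E where "E = base_vars \<union> {''R'', ''C'', ''M'', ''N''}"
  have T: "stage1_time n = 3 + 3 * blocks n + (3 + 3 * blocks n + (3 + 3 * buckets n + (2 + gt)))"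
    by (simp add: stage1_time_def gt_def M_def)
  have greedy: "ok (Greedy ''H'' Hash_test) \<rho> gt (\<lambda>\<tau>. base n \<tau> \<and> good_hash n (\<tau> ''H''))"
    if \<rho>: "base n \<rho>" "\<rho> ''R'' 0 = rounds n * blocks n" "\<rho> ''C'' 0 = buckets n" "\<rho> ''M'' 0 = M" "\<rho> ''N'' 0 = bits n"
    for \<rho>
  proof -
    interpret greedy "''H''" Hash_test "hash_bad (blocks n) (buckets n)" E \<rho> 2 M "buckets n" "bits n" "rounds n * blocks n"
    proof (unfold_locales, goal_cases)
      case (14 \<sigma>)
      then have "\<sigma> ''B'' 0 = blocks n" "\<sigma> ''p'' 0 = buckets n"
        using \<rho>(1) by (simp_all add: agree_def E_def base_vars_def base_def)
      then show ?case by (rule ok_Hash_test)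
    qed (simp_all add: E_def base_vars_def greedy_vars_def \<rho> local_hash_bad)
    have "agree E \<rho> \<rho>" by (simp add: agree_def)
    from ok_frame[OF ok_Greedy[OF this assms(2)]] show ?thesis
    proof (rule ok_mono, goal_cases)
      case 1
      show ?case by (simp add: gt_def greedy_time_def)
    next
      case (2 \<tau>)
      have "base n \<tau>"
        by (rule base_frame[OF \<rho>(1), of "writes (Greedy ''H'' Hash_test)"])
           (use 2 in \<open>auto simp: greedy_vars_def base_vars_def\<close>)
      then show ?case using 2 by (simp add: good_hash_def M_def)
    qed
  qed
  show ?thesis
    unfolding Stage1_def T
  proof (rule ok_Seq_Times[where u = "rounds n" and w = "blocks n" and t = "3 + 3 * blocks n + (3 + 3 * buckets n + (2 + gt))"], goal_cases)
    case (2 \<tau>)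
    then have "\<tau> ''S'' = \<sigma> ''S''" "\<tau> ''B'' = \<sigma> ''B''" by simp_all
    then show ?case using assms by (simp add: base_def rounds_def)
  next
    case (3 \<tau>1)
    have 1: "base n \<tau>1"
      by (rule base_frame[OF assms(1), of "{''R'', ''i''}"]) (use 3 in \<open>auto simp: base_vars_def\<close>)
    show ?case
    proof (rule ok_Seq_Times[where u = "blocks n" and w = "blocks n" and t = "3 + 3 * buckets n + (2 + gt)"], goal_cases)
      case (2 \<tau>)
      then have "\<tau> ''B'' = \<tau>1 ''B''" by simp_all
      then show ?case using 1 by (simp add: base_def)
    next
      case (3 \<tau>2)
      have 2: "base n \<tau>2"
        by (rule base_frame[OF 1, of "{''z'', ''i''}"]) (use 3 in \<open>auto simp: base_vars_def\<close>)
      have R2: "\<tau>2 ''R'' 0 = rounds n * blocks n" using 3 \<open>\<tau>1 ''R'' 0 = _\<close> by simp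
      show ?case
      proof (rule ok_Seq_Times[where u = "blocks n * blocks n" and w = "buckets n" and t = "2 + gt"], goal_cases)
        case (2 \<tau>)
        then have "\<tau> ''z'' = \<tau>2 ''z''" "\<tau> ''p'' = \<tau>2 ''p''" by simp_all
        then show ?case using 3(1) \<open>base n \<tau>2\<close> by (simp add: base_def)
      next
        case (3 \<tau>3)
        have b: "base n \<tau>3"
          by (rule base_frame[OF 2, of "{''M'', ''i''}"]) (use 3 in \<open>auto simp: base_vars_def\<close>)
        have R3: "\<tau>3 ''R'' 0 = rounds n * blocks n" using 3 R2 by simp
        have "base n (\<tau>3(''C'' := (\<tau>3 ''C'')(0 := buckets n), ''N'' := (\<tau>3 ''N'')(0 := bits n)))"
          using b by (intro base_upd) (auto simp: base_vars_def)
        from greedy[OF this] show ?case using b R3 3(1) by (simp add: base_def M_def)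
      qed simp_all
    qed simp_all
  qed simp_all
qed

lemma ok_Stage2:
  assumes "base n \<sigma>" "good_hash n (\<sigma> ''H'')" "depth n < buckets n"
  shows "ok Stage2 \<sigma> (stage2_time n) (\<lambda>\<tau>. base n \<tau> \<and> good_hash n (\<tau> ''H'') \<and> good_perms n (\<tau> ''G''))"
proof -
  define M where "M = buckets n ^ Suc (depth n)"
  define C where "C = buckets n ^ buckets n"
  define tb where "tb = 12 + buckets n * (14 + buckets n * 8)"
  define E where "E = base_vars \<union> {''R'', ''C'', ''M'', ''N''}"
  define \<rho> where "\<rho> = \<sigma>(''R'' := (\<sigma> ''R'')(0 := rounds n), ''C'' := (\<sigma> ''C'')(0 := C),
     ''M'' := (\<sigma> ''M'')(0 := M), ''N'' := (\<sigma> ''N'')(0 := bits n))"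
  have \<rho>: "base n \<rho>" "\<rho> ''R'' 0 = rounds n" "\<rho> ''C'' 0 = C" "\<rho> ''M'' 0 = M" "\<rho> ''N'' 0 = bits n" "\<rho> ''H'' = \<sigma> ''H''"
  proof -
    show "base n \<rho>" unfolding \<rho>_def using assms(1) by (intro base_upd) (auto simp: base_vars_def)
  qed (simp_all add: \<rho>_def)
  interpret greedy "''G''" Perm_test "perm_bad (buckets n) (depth n) (threshold n - 1) (threshold n + 3)" E \<rho> tb M C "bits n" "rounds n"
  proof (unfold_locales, goal_cases)
    case (14 \<sigma>)
    then have "\<sigma> x = \<rho> x" if "x \<in> base_vars" for x using that by (simp add: agree_def E_def)
    then have "base n \<sigma>" using base_agree[OF \<rho>(1)] by (simp add: agree_def)
    then show ?case unfolding tb_def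
      by (intro ok_Perm_test) (use assms(3) in \<open>simp_all add: base_def\<close>)
  qed (simp_all add: E_def base_vars_def greedy_vars_def \<rho> local_perm_bad)
  have "agree E \<rho> \<rho>" by (simp add: agree_def)
  moreover have "0 < C" using assms(3) by (simp add: C_def)
  ultimately have "ok (Greedy ''G'' Perm_test) \<rho> (greedy_time tb M C (bits n) (rounds n))
     (\<lambda>\<tau>. base n \<tau> \<and> good_hash n (\<tau> ''H'') \<and> good_perms n (\<tau> ''G''))"
  proof (intro ok_mono[OF ok_frame[OF ok_Greedy]], goal_cases)
    case 3
    show ?case by (simp add: greedy_time_def)
  next
    case (4 \<tau>)
    have "base n \<tau>"
      by (rule base_frame[OF \<rho>(1), of "writes (Greedy ''G'' Perm_test)"])
         (use 4 in \<open>auto simp: greedy_vars_def base_vars_def\<close>)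
    moreover have "\<tau> ''H'' = \<sigma> ''H''" using 4 \<rho>(6) by (simp add: greedy_vars_def)
    ultimately show ?case using 4 assms(2) by (simp add: good_perms_def M_def C_def)
  qed
  \<comment> \<open>Since \<open>depth n < buckets n\<close>, the index \<open>depth n + 1\<close>
    still lies in the table of powers.\<close>
  moreover have "\<rho> = \<sigma>(''R'' := (\<sigma> ''R'')(0 := \<sigma> ''S'' 0), ''C'' := (\<sigma> ''C'')(0 := \<sigma> ''Pw'' (\<sigma> ''p'' 0)),
     ''M'' := (\<sigma> ''M'')(0 := \<sigma> ''Pw'' (\<sigma> ''k'' 0 + 1)), ''N'' := (\<sigma> ''N'')(0 := \<sigma> ''l'' 0))"
    using assms(1,3) by (simp add: \<rho>_def base_def C_def M_def rounds_def Suc_le_eq)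
  ultimately show ?thesis
    unfolding Stage2_def by (simp add: stage2_time_def tb_def M_def C_def)
qed

lemma ok_Program:
  assumes "depth n < buckets n"
  shows "ok Program (input_memory n) (setup_time n + (stage1_time n + (stage2_time n + output_time n)))
    (\<lambda>\<tau>. \<exists>H G. good_hash n H \<and> good_perms n G \<and>
       outputs \<tau> (orders n (buckets n) (blocks n) (rounds n) H G))"
  unfolding Program_def
proof (rule ok_SeqI[OF ok_Setup _ order.refl], rule ok_SeqI[OF ok_Stage1 _ order.refl],
    assumption, goal_cases)
  case (2 \<tau> \<tau>')
  show ?case
  proof (rule ok_SeqI[OF ok_Stage2 _ order.refl], goal_cases)
    case (4 \<tau>'')
    show ?case
      unfolding output_time_def
      by (rule ok_mono[OF ok_Output[where p = "buckets n" and n = n and B = "blocks n" and S = "rounds n"]])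
         (use 4 assms in \<open>auto simp: base_def rounds_def\<close>)
  qed (use 2 assms in auto)
qed (use assms in auto)

section \<open>Polynomial running time\<close>

lemma bits_bounds: "n < 2 ^ bits n" "0 < n \<Longrightarrow> 2 ^ (bits n - 1) \<le> n"
proof -
  show "n < 2 ^ bits n"
    using floorlog_leD[of 2 n "bits n"] by (simp add: bits_def)
  show "2 ^ (bits n - 1) \<le> n" if "0 < n"
    using floorlog_bounds[of n 2] that by (simp add: bits_def)
qed

lemma bits_le: "bits n \<le> n"
  unfolding bits_def by (rule floorlog_leI) (auto simp: less_exp)

lemma buckets_le: "buckets n \<le> bits n"
  by (simp add: buckets_def)

text \<open>The base is at most \<open>2 ^ bits (bits n)\<close>, and
  \<open>bits (bits n) * buckets n \<le> bits n\<close> because \<open>buckets n\<close> is the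
  integer quotient. This is what fixes the number of buckets.\<close>

lemma buckets_power_le: "buckets n ^ buckets n \<le> 2 ^ bits n"
proof -
  have "buckets n \<le> 2 ^ bits (bits n)"
    using buckets_le[of n] bits_bounds(1)[of "bits n"] by simp
  then have "buckets n ^ buckets n \<le> (2 ^ bits (bits n)) ^ buckets n"
    by (rule power_mono) simp
  also have "\<dots> = 2 ^ (bits (bits n) * buckets n)" by (simp add: power_mult)
  also have "\<dots> \<le> 2 ^ bits n"
    by (rule power_increasing) (simp_all add: buckets_def)
  finally show ?thesis .
qed

text \<open>Zero is left out because \<open>buckets 0 ^ buckets 0\<close> is
  \<open>0 ^ 0 = 1\<close>, which exceeds the bound \<open>2 * n\<close> there.\<close>

definition poly_bounded :: "(nat \<Rightarrow> nat) \<Rightarrow> bool" where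
  "poly_bounded f \<longleftrightarrow> (\<exists>q. \<forall>n>0. f n \<le> poly q n)"

lemma poly_bounded_const: "poly_bounded (\<lambda>_. c)"
  unfolding poly_bounded_def by (intro exI[of _ "[:c:]"]) simp

lemma poly_bounded_id: "poly_bounded (\<lambda>n. n)"
  unfolding poly_bounded_def by (intro exI[of _ "[:0, 1:]"]) simp

lemma poly_bounded_add: "poly_bounded f \<Longrightarrow> poly_bounded g \<Longrightarrow> poly_bounded (\<lambda>n. f n + g n)"
  unfolding poly_bounded_def by (metis add_mono poly_add)

lemma poly_bounded_mult: "poly_bounded f \<Longrightarrow> poly_bounded g \<Longrightarrow> poly_bounded (\<lambda>n. f n * g n)"
  unfolding poly_bounded_def by (metis mult_le_mono poly_mult)

lemma poly_bounded_power: "poly_bounded f \<Longrightarrow> poly_bounded (\<lambda>n. f n ^ k)"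
  by (induction k) (auto intro: poly_bounded_mult poly_bounded_const)

lemma poly_bounded_mono: "poly_bounded g \<Longrightarrow> (\<And>n. 0 < n \<Longrightarrow> f n \<le> g n) \<Longrightarrow> poly_bounded f"
  unfolding poly_bounded_def by (meson order_trans)

lemma poly_bounded_parameters:
  "poly_bounded bits" "poly_bounded buckets" "poly_bounded blocks" "poly_bounded rounds"
  "poly_bounded (\<lambda>n. buckets n ^ buckets n)"
proof -
  show b: "poly_bounded bits"
    by (rule poly_bounded_mono[OF poly_bounded_id bits_le])
  show "poly_bounded buckets"
    by (rule poly_bounded_mono[OF b buckets_le])
  show "poly_bounded blocks"
    by (rule poly_bounded_mono[OF poly_bounded_add[OF poly_bounded_id poly_bounded_const[of 1]]])
       (simp add: blocks_def)
  show "poly_bounded rounds"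
    unfolding rounds_def[abs_def] by (rule poly_bounded_power[OF b])
  show "poly_bounded (\<lambda>n. buckets n ^ buckets n)"
  proof (rule poly_bounded_mono[OF poly_bounded_mult[OF poly_bounded_const[of 2] poly_bounded_id]])
    fix n :: nat assume n: "0 < n"
    have "bits n \<noteq> 0" using n bits_bounds(1)[of n] by (intro notI) simp
    then have "(2::nat) ^ bits n = 2 * 2 ^ (bits n - 1)" by (cases "bits n") auto
    then show "buckets n ^ buckets n \<le> 2 * n"
      using buckets_power_le[of n] bits_bounds(2)[OF n] by linarith
  qed
qed

definition program_time :: "nat \<Rightarrow> nat" where
  "program_time n = setup_time n + (stage1_time n + (stage2_time n + output_time n))"

text \<open>\<open>program_time\<close> with \<open>buckets n ^ Suc (depth n)\<close> replaced by
  \<open>buckets n ^ buckets n\<close>, so that the closure rules for \<open>poly_bounded\<close>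
  apply directly.\<close>

definition time_bound :: "nat \<Rightarrow> nat" where
  "time_bound n = setup_time n + (stage1_time n +
     ((4 + greedy_time (12 + buckets n * (14 + buckets n * 8))
       (buckets n ^ buckets n) (buckets n ^ buckets n) (bits n) (rounds n)) + output_time n))"

lemma program_time_le:
  assumes "depth n < buckets n"
  shows "program_time n \<le> time_bound n"
proof -
  have "buckets n ^ Suc (depth n) \<le> buckets n ^ buckets n"
    using assms by (intro power_increasing) auto
  then show ?thesis
    unfolding program_time_def time_bound_def stage2_time_def greedy_time_def
    by (intro add_mono mult_le_mono order.refl)
qed

lemma poly_bounded_time: "poly_bounded time_bound"
  unfolding time_bound_def[abs_def] setup_time_def stage1_time_def output_time_def greedy_time_def
  by (intro poly_bounded_add poly_bounded_mult poly_bounded_const poly_bounded_id poly_bounded_parameters)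

lemma ok_constant_output:
  "\<exists>c. \<forall>\<sigma>. ok c \<sigma> (Suc (length zs)) (\<lambda>\<tau>. \<forall>i<length zs. \<tau> ''out'' i = zs ! i)"
proof (induction zs rule: rev_induct)
  case Nil
  show ?case by (rule exI[of _ Skip]) simp
next
  case (snoc z zs)
  then obtain c where c: "\<And>\<sigma>. ok c \<sigma> (Suc (length zs)) (\<lambda>\<tau>. \<forall>i<length zs. \<tau> ''out'' i = zs ! i)"
    by blast
  show ?case
  proof (intro exI[of _ "Seq c (Assign ''out'' (Const (length zs)) (Const z))"] allI)
    fix \<sigma>
    show "ok (Seq c (Assign ''out'' (Const (length zs)) (Const z))) \<sigma> (Suc (length (zs @ [z])))
        (\<lambda>\<tau>. \<forall>i<length (zs @ [z]). \<tau> ''out'' i = (zs @ [z]) ! i)"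
      by (rule ok_SeqI[OF c, where u = 1]) (auto simp: nth_append less_Suc_eq)
  qed
qed

text \<open>Each induction step puts one comparison of the input with \<open>m\<close> in front of
  the program and hard-wires the answer for \<open>m\<close>. Program and polynomial both change,
  hence the generalisation over them.\<close>

lemma finite_patch:
  assumes "\<And>n. n0 \<le> n \<Longrightarrow> ok c (input_memory n) (poly q n) (\<lambda>\<tau>. outputs \<tau> (xs n))"
  shows "\<exists>c q. \<forall>n. ok c (input_memory n) (poly q n) (\<lambda>\<tau>. outputs \<tau> (xs n))"
  using assms
proof (induction n0 arbitrary: c q)
  case 0
  then show ?case by blast
next
  case (Suc m)
  obtain d where d: "\<And>\<sigma>. ok d \<sigma> (Suc (length (encode_lists (xs m)))) (\<lambda>\<tau>. outputs \<tau> (xs m))"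
    using ok_constant_output[of "encode_lists (xs m)"] unfolding outputs_def by blast
  define q' where "q' = q + [:length (encode_lists (xs m)) + 2:]"
  show ?case
  proof (rule Suc.IH[of "Cond (Eq (Var ''in'') (Const m)) d c" q'])
    fix n assume n: "m \<le> n"
    show "ok (Cond (Eq (Var ''in'') (Const m)) d c) (input_memory n) (poly q' n) (\<lambda>\<tau>. outputs \<tau> (xs n))"
    proof (cases "n = m")
      case True
      then show ?thesis
        using ok_mono[OF d, of "poly q' n - 1" "\<lambda>\<tau>. outputs \<tau> (xs m)" "input_memory n"]
        by (simp add: input_memory_def q'_def)
    next
      case False
      then have "ok c (input_memory n) (poly q n) (\<lambda>\<tau>. outputs \<tau> (xs n))"
        using n by (intro Suc.prems) simp
      then have "ok c (input_memory n) (poly q' n - 1) (\<lambda>\<tau>. outputs \<tau> (xs n))"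
        by (rule ok_mono) (simp_all add: q'_def)
      then show ?thesis using False by (simp add: input_memory_def q'_def)
    qed
  qed
qed

lemma polytime_computableI:
  assumes "\<And>n. n0 \<le> n \<Longrightarrow> ok c (input_memory n) (poly q n) (\<lambda>\<tau>. outputs \<tau> (xs n))"
  shows "polytime_computable (\<lambda>n. mset (xs n))"
proof -
  obtain c q where *: "\<And>n. ok c (input_memory n) (poly q n) (\<lambda>\<tau>. outputs \<tau> (xs n))"
    using finite_patch[OF assms] by blast
  show ?thesis
    unfolding polytime_computable_def
  proof (intro exI[of _ c] exI[of _ q] allI)
    fix n
    obtain t \<tau> where "exec c (input_memory n) t \<tau>" "t \<le> poly q n" "outputs \<tau> (xs n)"
      using *[of n] unfolding ok_def by blast
    then show "\<exists>t \<tau> xss. exec c (input_memory n) t \<tau> \<and> t \<le> poly q n \<and> outputs \<tau> xss \<and> mset xss = mset (xs n)"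
      by blast
  qed
qed

section \<open>Analysis of the greedy algorithm\<close>

lemma weight_count:
  assumes "0 < N"
  shows "real (weight N bad A R j) = real N ^ R * (1 + 1 / real N) ^ card {r. r < R \<and> bad A r (A r) j}"
proof (induction R)
  case (Suc R)
  have "{r. r < Suc R \<and> bad A r (A r) j} =
      (if bad A R (A R) j then insert R {r. r < R \<and> bad A r (A r) j} else {r. r < R \<and> bad A r (A r) j})"
    by (auto simp: less_Suc_eq)
  then have "card {r. r < Suc R \<and> bad A r (A r) j} =
      card {r. r < R \<and> bad A r (A r) j} + of_bool (bad A R (A R) j)"
    by simp
  then show ?case using Suc assms by (simp add: weight_Suc field_simps)
qed simp

text \<open>The potential is the total weight of the tests in \<open>J\<close>. Round
  \<open>r\<close> multiplies it by at most \<open>N + \<rho> r\<close>, hence by at most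
  \<open>N * exp (\<rho> r / N)\<close>, while the single weight of \<open>j\<close> has become
  \<open>N ^ R * (1 + 1 / N) ^ F\<close> after \<open>F\<close> violations. Comparing logarithms
  bounds \<open>F\<close>.\<close>

lemma greedy_bound:
  fixes \<rho> :: "nat \<Rightarrow> real"
  assumes N: "0 < N" and J: "finite J" "j \<in> J"
    and step: "\<And>r. r < R \<Longrightarrow> (\<Sum>j\<in>J. real (weight N bad A r j) * of_bool (bad A r (A r) j))
       \<le> \<rho> r * (\<Sum>j\<in>J. real (weight N bad A r j))"
  shows "real (card {r. r < R \<and> bad A r (A r) j}) \<le>
    (1 + 1 / real N) * (\<Sum>r<R. \<rho> r) + (real N + 1) * ln (real (card J))"
proof -
  define F where "F = card {r. r < R \<and> bad A r (A r) j}"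
  define \<Phi> where "\<Phi> r = (\<Sum>j\<in>J. real (weight N bad A r j))" for r
  have "r \<le> R \<Longrightarrow> \<Phi> r \<le> real N ^ r * exp ((\<Sum>i<r. \<rho> i) / N) * card J" for r
  proof (induction r)
    case 0
    show ?case by (simp add: \<Phi>_def)
  next
    case (Suc r)
    have pos: "0 \<le> \<Phi> r" by (simp add: \<Phi>_def sum_nonneg)
    have "\<Phi> (Suc r) = N * \<Phi> r + (\<Sum>j\<in>J. real (weight N bad A r j) * of_bool (bad A r (A r) j))"
      by (simp add: \<Phi>_def weight_Suc sum_distrib_left sum.distrib[symmetric] algebra_simps)
    also have "\<dots> \<le> N * \<Phi> r + \<rho> r * \<Phi> r"
      using step[of r] Suc.prems by (simp add: \<Phi>_def)
    also have "\<dots> = N * (1 + \<rho> r / N) * \<Phi> r"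
      using N by (simp add: field_simps)
    also have "\<dots> \<le> N * exp (\<rho> r / N) * \<Phi> r"
      using pos by (intro mult_right_mono mult_left_mono exp_ge_add_one_self) auto
    also have "\<dots> \<le> N * exp (\<rho> r / N) * (real N ^ r * exp ((\<Sum>i<r. \<rho> i) / N) * card J)"
      using Suc by (intro mult_left_mono) auto
    also have "\<dots> = real N ^ Suc r * exp ((\<Sum>i<Suc r. \<rho> i) / N) * card J"
      by (simp add: add_divide_distrib exp_add)
    finally show ?case .
  qed
  then have \<Phi>: "\<Phi> R \<le> real N ^ R * exp ((\<Sum>i<R. \<rho> i) / N) * card J" by simp
  have "real N ^ R * (1 + 1 / N) ^ F = weight N bad A R j"
    using weight_count[OF N] by (simp add: F_def)
  also have "\<dots> \<le> \<Phi> R"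
    unfolding \<Phi>_def using J by (intro member_le_sum) auto
  also note \<Phi>
  finally have "(1 + 1 / N) ^ F \<le> exp ((\<Sum>i<R. \<rho> i) / N) * card J"
    using N by simp
  moreover have pos: "0 < (1 + 1 / real N) ^ F" by (simp add: add_pos_nonneg)
  moreover have cJ: "0 < real (card J)" using J by (simp add: card_gt_0_iff) blast
  ultimately have "ln ((1 + 1 / N) ^ F) \<le> ln (exp ((\<Sum>i<R. \<rho> i) / N) * card J)"
    by (subst ln_le_cancel_iff) auto
  then have le: "F * ln (1 + 1 / N) \<le> (\<Sum>i<R. \<rho> i) / N + ln (card J)"
    using N cJ by (simp add: ln_mult ln_realpow add_pos_nonneg)
  \<comment> \<open>The inequality \<open>ln x \<le> x - 1\<close> at \<open>x = N / (N + 1)\<close>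
    gives \<open>ln (1 + 1 / N) \<ge> 1 / (N + 1)\<close>, which explains the factors
    \<open>1 + 1 / N\<close> and \<open>N + 1\<close> of the bound.\<close>
  have "ln (real N / (real N + 1)) \<le> real N / (real N + 1) - 1"
    using N by (intro ln_le_minus_one) auto
  also have "ln (real N / (real N + 1)) = - ln (1 + 1 / N)"
  proof -
    have "1 + 1 / real N = (real N + 1) / real N" using N by (simp add: field_simps)
    then show ?thesis using N by (simp add: ln_div)
  qed
  finally have "1 / (real N + 1) \<le> ln (1 + 1 / N)"
    using N by (simp add: field_simps)
  then have "F * (1 / (real N + 1)) \<le> F * ln (1 + 1 / N)" by (intro mult_left_mono) auto
  with le have "F * (1 / (real N + 1)) \<le> (\<Sum>i<R. \<rho> i) / N + ln (card J)" by linarith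
  then have "F \<le> (real N + 1) * ((\<Sum>i<R. \<rho> i) / N + ln (card J))"
    by (simp add: pos_divide_le_eq mult.commute)
  also have "\<dots> = (1 + 1 / real N) * (\<Sum>r<R. \<rho> r) + (real N + 1) * ln (real (card J))"
    using N by (simp add: field_simps)
  finally show ?thesis unfolding F_def .
qed

text \<open>The minimiser costs no more than the average over any nonempty set \<open>V\<close> of
  candidates, and exchanging the sums turns a bound for each test into a bound on that average. The
  minimum is taken over all \<open>M\<close> tests, but those outside \<open>J\<close> contribute
  nothing in this round.\<close>

lemma greedy_choice_average:
  fixes \<rho> :: real
  assumes g: "greedy_choice M C N bad A r" and J: "J \<subseteq> {..<M}"
    and out: "\<And>j c. j < M \<Longrightarrow> j \<notin> J \<Longrightarrow> \<not> bad A r c j"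
    and V: "finite V" "V \<noteq> {}" "\<And>v. v \<in> V \<Longrightarrow> enc v < C"
    and avg: "\<And>j. j \<in> J \<Longrightarrow> real (card {v \<in> V. bad A r (enc v) j}) \<le> \<rho> * card V"
  shows "(\<Sum>j\<in>J. real (weight N bad A r j) * of_bool (bad A r (A r) j))
    \<le> \<rho> * (\<Sum>j\<in>J. real (weight N bad A r j))"
proof -
  define w where "w j = real (weight N bad A r j)" for j
  define S where "S c = (\<Sum>j\<in>J. w j * of_bool (bad A r c j))" for c
  have fin: "finite J" using J finite_subset by blast
  have S: "S c = real (\<Sum>j<M. weight N bad A r j * of_bool (bad A r c j))" for c
    unfolding S_def w_def of_nat_sum
    by (rule sum.mono_neutral_cong_left) (use J out in auto)
  have min: "(\<Sum>j<M. weight N bad A r j * of_bool (bad A r (A r) j))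
      \<le> (\<Sum>j<M. weight N bad A r j * of_bool (bad A r (enc v) j))" if "v \<in> V" for v
    using g V(3)[OF that] unfolding greedy_choice_def by blast
  have "card V * S (A r) = (\<Sum>v\<in>V. S (A r))" by simp
  also have "\<dots> \<le> (\<Sum>v\<in>V. S (enc v))"
    unfolding S by (intro sum_mono) (simp only: of_nat_le_iff min)
  also have "\<dots> = (\<Sum>j\<in>J. w j * card {v \<in> V. bad A r (enc v) j})"
    unfolding S_def using V(1)
    by (subst sum.swap) (simp add: sum_distrib_left[symmetric] of_bool_def sum.If_cases Int_def)
  also have "\<dots> \<le> (\<Sum>j\<in>J. w j * (\<rho> * card V))"
    using avg by (intro sum_mono mult_left_mono) (auto simp: w_def)
  also have "\<dots> = card V * (\<rho> * (\<Sum>j\<in>J. w j))"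
    by (simp add: sum_distrib_left algebra_simps)
  finally show ?thesis
    using V(1,2) by (simp add: S_def w_def card_gt_0_iff)
qed

lemma sum_mod_eq:
  fixes S B :: nat and c :: real
  assumes "\<beta> < B"
  shows "(\<Sum>r < S * B. if r mod B = \<beta> then c else 0) = S * c"
proof (induction S)
  case (Suc S)
  have "(\<Sum>r < Suc S * B. if r mod B = \<beta> then c else 0) =
     (\<Sum>r < S * B. if r mod B = \<beta> then c else 0) + (\<Sum>r = S * B..<S * B + B. if r mod B = \<beta> then c else 0)"
    by (subst sum.union_disjoint[symmetric]) (auto intro!: sum.cong)
  also have "(\<Sum>r = S * B..<S * B + B. if r mod B = \<beta> then c else 0) =
      (\<Sum>r = 0..<B. if (r + S * B) mod B = \<beta> then c else 0)"
    using sum.shift_bounds_nat_ivl[of "\<lambda>r. if r mod B = \<beta> then c else 0" 0 "S * B" B] by (simp add: add.commute)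
  also have "\<dots> = (\<Sum>r = 0..<B. if r = \<beta> then c else 0)"
    by (intro sum.cong) auto
  also have "\<dots> = c" using assms by (simp add: sum.delta)
  finally show ?case using Suc by (simp add: algebra_simps)
qed simp

lemma mod_add_cancel:
  fixes a b h p :: nat
  assumes "(a + h) mod p = (b + h) mod p" "a < p" "b < p"
  shows "a = b"
proof -
  have "a \<le> b" if "(a + h) mod p = (b + h) mod p" "a < p" for a b :: nat
  proof (rule ccontr)
    assume "\<not> a \<le> b"
    then have "p dvd (a + h) - (b + h)" using that(1) by (subst mod_eq_dvd_iff_nat[symmetric]) auto
    then have "p dvd a - b" by simp
    then show False using \<open>\<not> a \<le> b\<close> that(2) by (auto dest: dvd_imp_le)
  qed
  from this[of a b] this[of b a] show ?thesis using assms by simp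
qed

lemma digits_bound: "a < A \<Longrightarrow> b < B \<Longrightarrow> a * B + b < A * B" for a b A B :: nat
  using mult_le_mono1[of "Suc a" A B] by simp

text \<open>Two elements of different blocks collide exactly as one fixed test is violated, so
  \<open>greedy_bound\<close> applies to that test. It is active in only \<open>S\<close> of the
  \<open>S * B\<close> rounds, which yields the main term \<open>S / p\<close>.\<close>

lemma hash_collisions:
  fixes p N S B x y :: nat
  assumes p: "0 < p" and N: "0 < N"
    and g: "\<And>r. r < S * B \<Longrightarrow> greedy_choice (B * B * p) p N (hash_bad B p) H r"
    and x: "x div p < B" and y: "y div p < B" and "x \<noteq> y"
  shows "real (card {s. s < S \<and> hash p B H s x = hash p B H s y})
     \<le> (1 + 1 / real N) * (S / p) + (real N + 1) * ln (B * B * p)"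
proof -
  have gen: "real (card {s. s < S \<and> hash p B H s x = hash p B H s y})
     \<le> (1 + 1 / real N) * (S / p) + (real N + 1) * ln (B * B * p)" if x: "x div p < B" and lt: "y div p < x div p" for x y
  proof -
    define \<beta> where "\<beta> = x div p"
    define \<beta>' where "\<beta>' = y div p"
    \<comment> \<open>Adding \<open>p\<close> keeps the truncated subtraction exact. A collision
      means that the shift of the block of \<open>x\<close> exceeds that of the block of
      \<open>y\<close> by \<open>d\<close> modulo \<open>p\<close>.\<close>
    define d where "d = (y mod p + p - x mod p) mod p"
    define j where "j = (\<beta> * B + \<beta>') * p + d"
    \<comment> \<open>The potential is restricted to the tests of block \<open>\<beta>\<close>. In
      the rounds of \<open>\<beta>\<close> only these can be violated and one of the
      \<open>p\<close> shifts is bad for each; in all other rounds none of them is violated.\<close>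
    define J where "J = {j. j < B * B * p \<and> j div p div B = \<beta>}"
    have \<beta>: "\<beta> < B" "\<beta>' < \<beta>" using x lt by (simp_all add: \<beta>_def \<beta>'_def)
    have d: "d < p" using p by (simp add: d_def)
    have jp: "j div p = \<beta> * B + \<beta>'" "j mod p = d" using d by (simp_all add: j_def)
    have jB: "j div p div B = \<beta>" "j div p mod B = \<beta>'" using \<beta> by (simp_all add: jp)
    have "\<beta> * B + \<beta>' < B * B" using \<beta> by (intro digits_bound) auto
    then have "j < B * B * p" using d unfolding j_def by (rule digits_bound)
    then have jJ: "j \<in> J" using jB by (simp add: J_def)
    have step: "(\<Sum>j\<in>J. real (weight N (hash_bad B p) H r j) * of_bool (hash_bad B p H r (H r) j))
       \<le> (if r mod B = \<beta> then 1 / p else 0) * (\<Sum>j\<in>J. real (weight N (hash_bad B p) H r j))"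
      if r: "r < S * B" for r
    proof (cases "r mod B = \<beta>")
      case True
      show ?thesis
      proof (rule greedy_choice_average[OF g[OF r], where V = "{..<p}" and enc = id], goal_cases)
        case (6 j)
        have "card {v \<in> {..<p}. hash_bad B p H r (id v) j} \<le> card {(H (r - r mod B + j div p mod B) + j mod p) mod p}"
          by (rule card_mono) (auto simp: hash_bad_def)
        then show ?case using True p by simp
      qed (use True p in \<open>auto simp: J_def hash_bad_def\<close>)
    next
      case False
      then have "hash_bad B p H r (H r) j = False" if "j \<in> J" for j
        using that by (auto simp: J_def hash_bad_def)
      then show ?thesis using False by simp
    qed
    have coll: "hash_bad B p H (s * B + \<beta>) (H (s * B + \<beta>)) j"
      if s: "s < S" "hash p B H s x = hash p B H s y" for s
    proof -
      have r: "(s * B + \<beta>) mod B = \<beta>" using \<beta> by simp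
      have "s * B + \<beta> < S * B" using s \<beta> by (intro digits_bound)
      then have c: "H (s * B + \<beta>) < p" using g by (simp add: greedy_choice_def)
      have eq: "(x mod p + H (s * B + \<beta>)) mod p = (y mod p + H (s * B + \<beta>')) mod p"
        using s(2) by (simp add: hash_def \<beta>_def \<beta>'_def)
      have "(x mod p + (H (s * B + \<beta>') + d)) mod p = (H (s * B + \<beta>') + (x mod p + (y mod p + p - x mod p))) mod p"
        by (metis (no_types, lifting) ab_semigroup_add_class.add_ac(1) add.commute d_def mod_add_right_eq)
      also have "x mod p + (y mod p + p - x mod p) = y mod p + p"
        using p by (simp add: less_imp_le trans_le_add2)
      also have "(H (s * B + \<beta>') + (y mod p + p)) mod p = (y mod p + H (s * B + \<beta>')) mod p"
        by (metis add.assoc add.commute mod_add_self2)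
      finally have "(H (s * B + \<beta>) + x mod p) mod p = ((H (s * B + \<beta>') + d) mod p + x mod p) mod p"
        using eq by (simp add: add.commute mod_add_left_eq mod_add_right_eq)
      then have "H (s * B + \<beta>) = (H (s * B + \<beta>') + d) mod p"
        by (rule mod_add_cancel) (use c p in auto)
      then show ?thesis unfolding hash_bad_def r jB jp using \<beta> by simp
    qed
    have "card {s. s < S \<and> hash p B H s x = hash p B H s y}
        = card ((\<lambda>s. s * B + \<beta>) ` {s. s < S \<and> hash p B H s x = hash p B H s y})"
      using \<beta> by (intro card_image[symmetric] inj_onI) auto
    also have "\<dots> \<le> card {r. r < S * B \<and> hash_bad B p H r (H r) j}"
      by (intro card_mono) (use coll \<beta>(1) in \<open>auto intro: digits_bound\<close>)
    finally have "real (card {s. s < S \<and> hash p B H s x = hash p B H s y})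
        \<le> real (card {r. r < S * B \<and> hash_bad B p H r (H r) j})" by simp
    also have "\<dots> \<le> (1 + 1 / real N) * (\<Sum>r < S * B. if r mod B = \<beta> then 1 / p else 0)
        + (real N + 1) * ln (card J)"
      by (rule greedy_bound[OF N _ jJ step]) (simp_all add: J_def)
    also have "(\<Sum>r < S * B. if r mod B = \<beta> then 1 / p else 0) = S / real p"
      using sum_mod_eq[OF \<beta>(1), where S = S and c = "1 / real p"] by simp
    also have "ln (card J) \<le> ln (B * B * p)"
    proof -
      have "card J \<le> card {..<B * B * p}" by (intro card_mono) (auto simp: J_def)
      moreover have "0 < card J" using jJ by (auto simp: card_gt_0_iff J_def)
      ultimately show ?thesis by (subst ln_le_cancel_iff) (use p \<beta> in \<open>auto simp flip: of_nat_mult\<close>)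
    qed
    finally show ?thesis by (simp add: mult_left_mono)
  qed
  consider "x div p < y div p" | "y div p < x div p" | "x div p = y div p" by linarith
  then show ?thesis
  proof cases
    case 1
    then show ?thesis using gen[OF y 1] by (simp add: eq_commute)
  next
    case 2
    then show ?thesis using gen[OF x 2] by simp
  next
    case 3
    \<comment> \<open>Elements of one block share their shift and have different residues, so they
      never collide.\<close>
    have "hash p B H s x \<noteq> hash p B H s y" for s
    proof
      assume "hash p B H s x = hash p B H s y"
      then have "x mod p = y mod p" using 3 p by (auto simp: hash_def dest: mod_add_cancel)
      then show False using 3 \<open>x \<noteq> y\<close> by (metis div_mult_mod_eq)
    qed
    moreover have "0 \<le> ln (real (B * B * p))" using p x by (intro ln_ge_zero) (auto simp: Suc_le_eq simp flip: of_nat_mult)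
    ultimately show ?thesis by simp
  qed
qed

section \<open>Counting permutations\<close>

locale permutation_count =
  fixes p k :: nat and b :: "nat \<Rightarrow> nat"
  assumes b: "inj_on b {..k}" "\<And>i. i \<le> k \<Longrightarrow> b i < p"
begin

definition "P = {g. g permutes {..<p}}"

text \<open>The bucket of the maximum is at position \<open>t\<close>, and none of the buckets of
  the next \<open>i\<close> ranks precedes it: the permutations still undecided after
  \<open>i\<close> ranks.\<close>

definition "X t i = {g \<in> P. g (b 0) = t \<and> (\<forall>j<i. t < g (b (Suc j)))}"

lemma finite_P [simp]: "finite P"
  by (simp add: P_def finite_permutations)

lemma card_P: "card P = fact p"
  by (simp add: P_def card_permutations)

lemma finite_X [simp]: "finite (X t i)"
  by (simp add: X_def)

lemma P_lt: "g \<in> P \<Longrightarrow> i < p \<Longrightarrow> g i < p"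
  using permutes_in_image[of g "{..<p}" i] by (simp add: P_def)

lemma P_inj: "g \<in> P \<Longrightarrow> g i = g j \<longleftrightarrow> i = j"
  by (auto simp: P_def dest: permutes_inj injD)

lemma transpose_comp_P: "g \<in> P \<Longrightarrow> u < p \<Longrightarrow> w < p \<Longrightarrow> Transposition.transpose u w \<circ> g \<in> P"
  unfolding P_def by (auto intro: permutes_compose permutes_swap_id)

lemma comp_transpose_P: "g \<in> P \<Longrightarrow> u < p \<Longrightarrow> w < p \<Longrightarrow> g \<circ> Transposition.transpose u w \<in> P"
  unfolding P_def by (auto intro: permutes_compose permutes_swap_id)

lemma card_le_involution:
  assumes "finite B" "\<And>x. x \<in> A \<Longrightarrow> f x \<in> B" "\<And>x. f (f x) = x"
  shows "card A \<le> card B"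
proof (rule card_inj_on_le[OF _ _ assms(1), of f])
  show "inj_on f A" using assms(3) by (intro inj_onI) metis
qed (use assms(2) in auto)

lemma card_fiber:
  assumes "t < p"
  shows "p * card {g \<in> P. g (b 0) = t} = fact p"
proof -
  have le: "card {g \<in> P. g (b 0) = u} \<le> card {g \<in> P. g (b 0) = w}" if "u < p" "w < p" for u w
    by (rule card_le_involution[of _ _ "\<lambda>g. Transposition.transpose u w \<circ> g"])
       (use that transpose_comp_P in \<open>auto simp: fun_eq_iff\<close>)
  have "fact p = card (\<Union>u<p. {g \<in> P. g (b 0) = u})"
    unfolding card_P[symmetric] by (rule arg_cong[of _ _ card]) (use P_lt b(2)[of 0] in auto)
  also have "\<dots> = (\<Sum>u<p. card {g \<in> P. g (b 0) = u})"
    by (rule card_UN_disjoint) auto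
  also have "\<dots> = (\<Sum>u<p. card {g \<in> P. g (b 0) = t})"
    by (intro sum.cong refl antisym le) (use assms in auto)
  finally show ?thesis by simp
qed

lemma X_0: "X t 0 = {g \<in> P. g (b 0) = t}"
  by (simp add: X_def)

lemma b_neq: "i \<le> k \<Longrightarrow> j \<le> k \<Longrightarrow> i \<noteq> j \<Longrightarrow> b i \<noteq> b j"
  using b(1) by (auto dest: inj_onD)

text \<open>Exchanging the values \<open>u\<close> and \<open>w\<close>, both below
  \<open>t\<close>, maps \<open>X t i\<close> to itself. So a rank known to come before position
  \<open>t\<close> is uniformly distributed over the positions before \<open>t\<close>.\<close>

lemma card_value:
  assumes "i < k" "t < p" "u < t" "w < t"
  shows "card {g \<in> X t i. g (b (Suc i)) = u} = card {g \<in> X t i. g (b (Suc i)) = w}"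
proof -
  have "card {g \<in> X t i. g (b (Suc i)) = u} \<le> card {g \<in> X t i. g (b (Suc i)) = w}"
    if "u < t" "w < t" for u w
  proof (rule card_le_involution[of _ _ "\<lambda>g. Transposition.transpose u w \<circ> g"])
    fix g assume g: "g \<in> {g \<in> X t i. g (b (Suc i)) = u}"
    have "Transposition.transpose u w x = x" if "t \<le> x" for x
      using that \<open>u < t\<close> \<open>w < t\<close> by (simp add: Transposition.transpose_def)
    then show "Transposition.transpose u w \<circ> g \<in> {g \<in> X t i. g (b (Suc i)) = w}"
      using g transpose_comp_P[of g u w] that assms by (auto simp: X_def)
  qed (auto simp: fun_eq_iff)
  then show ?thesis using assms by (simp add: antisym)
qed

lemma card_below:
  assumes "i < k" "t < p" "m \<le> t"
  shows "t * card {g \<in> X t i. g (b (Suc i)) < m} = m * card {g \<in> X t i. g (b (Suc i)) < t}"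
proof -
  define c where "c = card {g \<in> X t i. g (b (Suc i)) = 0}"
  have "card {g \<in> X t i. g (b (Suc i)) < m} = m * c" if "m \<le> t" for m
  proof -
    have "card {g \<in> X t i. g (b (Suc i)) < m} = card (\<Union>u<m. {g \<in> X t i. g (b (Suc i)) = u})"
      by (rule arg_cong[of _ _ card]) auto
    also have "\<dots> = (\<Sum>u<m. card {g \<in> X t i. g (b (Suc i)) = u})"
      by (rule card_UN_disjoint) auto
    also have "\<dots> = (\<Sum>u<m. c)"
      unfolding c_def by (intro sum.cong refl card_value) (use assms that in auto)
    finally show ?thesis by simp
  qed
  from this[of m] this[of t] show ?thesis using assms by simp
qed

lemma card_X_Suc:
  assumes "i < k"
  shows "card (X t (Suc i)) + card {g \<in> X t i. g (b (Suc i)) < t} = card (X t i)"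
proof -
  have "X t i = X t (Suc i) \<union> {g \<in> X t i. g (b (Suc i)) < t}"
  proof -
    have "g (b (Suc i)) \<noteq> t" if "g \<in> X t i" for g
      using that P_inj[of g "b (Suc i)" "b 0"] b_neq[of "Suc i" 0] assms by (auto simp: X_def)
    then show ?thesis by (fastforce simp: X_def less_Suc_eq)
  qed
  moreover have "X t (Suc i) \<inter> {g \<in> X t i. g (b (Suc i)) < t} = {}"
    by (auto simp: X_def dest: less_asym)
  ultimately show ?thesis
    using card_Un_disjoint[of "X t (Suc i)" "{g \<in> X t i. g (b (Suc i)) < t}"] by simp
qed

text \<open>Double counting of the pairs of \<open>g\<close> in \<open>X t i\<close> and a bucket
  \<open>u\<close> outside the first \<open>i + 1\<close> ranks with \<open>g u < t\<close>. Every
  \<open>g\<close> has exactly \<open>t\<close> such buckets, since the excluded ones have values at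
  least \<open>t\<close>; exchanging arguments shows that no such \<open>u\<close> occurs more often
  than \<open>b (Suc i)\<close>.\<close>

lemma card_drop:
  assumes i: "i < k" and t: "t < p"
  shows "t * card (X t i) \<le> p * card {g \<in> X t i. g (b (Suc i)) < t}"
proof -
  define U where "U = {..<p} - b ` {..i}"
  have eq: "card {g \<in> X t i. g u < t} \<le> card {g \<in> X t i. g (b (Suc i)) < t}" if u: "u \<in> U" for u
  proof (rule card_le_involution[of _ _ "\<lambda>g. g \<circ> Transposition.transpose u (b (Suc i))"])
    fix g assume g: "g \<in> {g \<in> X t i. g u < t}"
    have tr: "Transposition.transpose u (b (Suc i)) (b j) = b j" if "j \<le> i" for j
    proof (rule transpose_apply_other)
      show "b j \<noteq> u" using u that by (auto simp: U_def)
      show "b j \<noteq> b (Suc i)" using that i by (intro b_neq) auto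
    qed
    have g': "g \<in> P" "g (b 0) = t" "g u < t" "\<And>j. j < i \<Longrightarrow> t < g (b (Suc j))"
      using g by (auto simp: X_def)
    have "u < p" "b (Suc i) < p" using u b(2)[of "Suc i"] i by (auto simp: U_def)
    then show "g \<circ> Transposition.transpose u (b (Suc i)) \<in> {g \<in> X t i. g (b (Suc i)) < t}"
      using comp_transpose_P[OF g'(1)] g' by (simp add: X_def tr)
  qed (auto simp: fun_eq_iff)
  have count: "card {u \<in> U. g u < t} = t" if g: "g \<in> X t i" for g
  proof -
    have gP: "g permutes {..<p}" using g by (simp add: X_def P_def)
    have ge: "t \<le> g (b j)" if "j \<le> i" for j
      using g that by (cases j) (auto simp: X_def Suc_le_eq)
    have "g ` {u \<in> U. g u < t} = {..<t}"
    proof (rule set_eqI, rule iffI)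
      fix y assume "y \<in> {..<t}"
      then have "y \<in> g ` {..<p}" using t permutes_image[OF gP] by auto
      then obtain u where "u < p" "g u = y" by auto
      moreover have "u \<notin> b ` {..i}" 
      proof
        assume "u \<in> b ` {..i}"
        then obtain j where "j \<le> i" "u = b j" by auto
        then show False using ge[of j] \<open>g u = y\<close> \<open>y \<in> {..<t}\<close> by simp
      qed
      ultimately show "y \<in> g ` {u \<in> U. g u < t}" using \<open>y \<in> {..<t}\<close> by (auto simp: U_def)
    qed auto
    moreover have "inj_on g {u \<in> U. g u < t}"
      using permutes_inj[OF gP] by (auto intro: inj_on_subset)
    ultimately show ?thesis by (metis card_image card_lessThan)
  qed
  have "t * card (X t i) = (\<Sum>g\<in>X t i. card {u \<in> U. g u < t})"
    using count by simp
  also have "\<dots> = (\<Sum>u\<in>U. card {g \<in> X t i. g u < t})"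
    using sum_multicount_gen[of "X t i" U "\<lambda>g u. g u < t"
        "\<lambda>u. card {g \<in> X t i. g u < t}"] by (simp add: U_def)
  also have "\<dots> \<le> (\<Sum>u\<in>U. card {g \<in> X t i. g (b (Suc i)) < t})"
    by (intro sum_mono eq)
  also have "\<dots> \<le> p * card {g \<in> X t i. g (b (Suc i)) < t}"
    using card_mono[of "{..<p}" U] by (simp add: U_def)
  finally show ?thesis .
qed

lemma card_X_le:
  assumes t: "t < p" "m \<le> t"
  shows "i \<le> k \<Longrightarrow> real (card (X t i)) \<le> (1 - m / p) ^ i * card (X t 0)"
proof (induction i)
  case (Suc i)
  have p: "0 < real p" using t by simp
  have "real (t * card (X t i)) \<le> real (p * card {g \<in> X t i. g (b (Suc i)) < t})"
    using card_drop[of i t] Suc.prems t by (intro of_nat_mono) simp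
  then have "t / p * card (X t i) \<le> card {g \<in> X t i. g (b (Suc i)) < t}"
    using p by (simp add: field_simps)
  moreover have "m / p * card (X t i) \<le> t / p * card (X t i)"
    using p t by (intro mult_right_mono divide_right_mono) auto
  moreover have "real (card (X t (Suc i))) = card (X t i) - real (card {g \<in> X t i. g (b (Suc i)) < t})"
    using card_X_Suc[of i t] Suc.prems by linarith
  ultimately have "card (X t (Suc i)) \<le> (1 - m / p) * card (X t i)"
    by (simp add: algebra_simps)
  also have "\<dots> \<le> (1 - m / p) * ((1 - m / p) ^ i * card (X t 0))"
    using Suc p t by (intro mult_left_mono) (auto simp: field_simps)
  finally show ?case by simp
qed simp

text \<open>The events for different \<open>i\<close> are disjoint, as the first rank to precede the
  maximum is unique. By \<open>card_below\<close> each has the fraction \<open>m / t\<close> of the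
  permutations leaving \<open>X t i\<close> for \<open>X t (Suc i)\<close>, and these losses
  telescope.\<close>

lemma
  assumes t: "t < p" "m \<le> t"
  shows card_top_event_at: "t * card {g \<in> P. g (b 0) = t \<and> (\<exists>i<k. g (b (Suc i)) < m \<and> (\<forall>j<i. g (b 0) < g (b (Suc j))))}
    = m * (card (X t 0) - card (X t k))"
    and card_X_mono: "card (X t k) \<le> card (X t 0)"
proof -
  have tel: "(\<Sum>i<n. card {g \<in> X t i. g (b (Suc i)) < t}) + card (X t n) = card (X t 0)" if "n \<le> k" for n
    using that
  proof (induction n)
    case (Suc n)
    then show ?case using card_X_Suc[of n t] by simp
  qed simp
  from tel[of k] show "card (X t k) \<le> card (X t 0)" by linarith
  have "{g \<in> P. g (b 0) = t \<and> (\<exists>i<k. g (b (Suc i)) < m \<and> (\<forall>j<i. g (b 0) < g (b (Suc j))))}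
      = (\<Union>i<k. {g \<in> X t i. g (b (Suc i)) < m})"
    by (auto simp: X_def)
  also have "card \<dots> = (\<Sum>i<k. card {g \<in> X t i. g (b (Suc i)) < m})"
  proof (rule card_UN_disjoint)
    have "False" if "i < j" "g \<in> X t j" "g (b (Suc i)) < m" for i j g
      using that t(2) by (auto simp: X_def)
    then show "\<forall>i\<in>{..<k}. \<forall>j\<in>{..<k}. i \<noteq> j \<longrightarrow>
        {g \<in> X t i. g (b (Suc i)) < m} \<inter> {g \<in> X t j. g (b (Suc j)) < m} = {}"
      by (auto simp: linorder_neq_iff)
  qed auto
  also have "t * \<dots> = m * (\<Sum>i<k. card {g \<in> X t i. g (b (Suc i)) < t})"
    unfolding sum_distrib_left by (intro sum.cong refl card_below) (use t in auto)
  also have "(\<Sum>i<k. card {g \<in> X t i. g (b (Suc i)) < t}) = card (X t 0) - card (X t k)"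
    using tel[of k] by simp
  finally show "t * card {g \<in> P. g (b 0) = t \<and> (\<exists>i<k. g (b (Suc i)) < m \<and> (\<forall>j<i. g (b 0) < g (b (Suc j))))}
    = m * (card (X t 0) - card (X t k))" .
qed

text \<open>Position \<open>t\<close> is taken by the bucket of the maximum with frequency
  \<open>1 / p\<close>; given that, the event has frequency at least \<open>m / t * (1 - q)\<close>,
  where \<open>q\<close> bounds the undecided fraction. Summing over \<open>t\<close> gives the
  classical secretary sum.\<close>

lemma card_top_event:
  fixes q :: real
  assumes m: "0 < m" "m \<le> m'" and q: "\<And>t. m' \<le> t \<Longrightarrow> t < p \<Longrightarrow> real (card (X t k)) \<le> q * card (X t 0)"
  shows "real (card {g \<in> P. top_event k m m' g b}) \<ge> fact p * (m / p * (1 - q) * (\<Sum>t=m'..<p. 1 / t))"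
proof (cases "p = 0")
  case False
  define Y where "Y t = {g \<in> P. g (b 0) = t \<and> (\<exists>i<k. g (b (Suc i)) < m \<and> (\<forall>j<i. g (b 0) < g (b (Suc j))))}" for t
  have "{g \<in> P. top_event k m m' g b} = (\<Union>t\<in>{m'..<p}. Y t)"
    using P_lt b(2)[of 0] by (auto simp: Y_def top_event_def)
  also have "card \<dots> = (\<Sum>t=m'..<p. card (Y t))"
    by (rule card_UN_disjoint) (auto simp: Y_def)
  finally have "real (card {g \<in> P. top_event k m m' g b}) = (\<Sum>t=m'..<p. real (card (Y t)))"
    by simp
  also have "\<dots> \<ge> (\<Sum>t=m'..<p. fact p * (m / p * (1 - q) * (1 / t)))"
  proof (rule sum_mono)
    fix t assume "t \<in> {m'..<p}"
    then have t: "m' \<le> t" "t < p" "m \<le> t" "0 < t" using m by auto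
    have X0: "real (card (X t 0)) = fact p / p"
      using arg_cong[OF card_fiber[OF t(2)], of real] False by (simp add: X_0 field_simps)
    have "real t * card (Y t) = m * (real (card (X t 0)) - card (X t k))"
      using arg_cong[OF card_top_event_at[OF t(2,3)], of real] card_X_mono[OF t(2,3)]
      by (simp add: Y_def of_nat_diff)
    also have "\<dots> \<ge> m * (real (card (X t 0)) - q * card (X t 0))"
      using q[OF t(1,2)] by (intro mult_left_mono diff_left_mono) auto
    also have "m * (real (card (X t 0)) - q * card (X t 0)) = fact p * (m / p * (1 - q))"
      by (simp add: X0 right_diff_distrib diff_divide_distrib mult_ac)
    finally have "fact p * (m / p * (1 - q)) / t \<le> real (card (Y t))"
      using t(4) by (subst pos_divide_le_eq) (simp_all add: mult.commute)
    then show "fact p * (m / p * (1 - q) * (1 / t)) \<le> real (card (Y t))" by simp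
  qed
  finally show ?thesis by (simp add: sum_distrib_left)
qed simp

end

section \<open>Success of wait-and-pick on bucketed orders\<close>

text \<open>The element at \<open>ti\<close> is seen before the checkpoint and is at least as large
  as everything before the maximum, so nothing between the checkpoint and \<open>ta\<close> can be
  accepted.\<close>

lemma picks_maxI:
  assumes ord: "distinct ord" "set ord = {1..n}" and v: "inj_on v {1..n}"
    and ta: "ta < n" "m \<le> ta" "\<And>y. y \<in> {1..n} \<Longrightarrow> v y \<le> v (ord ! ta)"
    and ti: "ti < m" "\<And>s. s < ta \<Longrightarrow> v (ord ! s) \<le> v (ord ! ti)"
  shows "picks_max n m v ord"
proof -
  let ?P = "\<lambda>t. m \<le> t \<and> (\<forall>s<t. v (ord ! s) < v (ord ! t))"
  have len: "length ord = n" using distinct_card[OF ord(1)] ord(2) by simp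
  have mem: "ord ! s \<in> {1..n}" if "s < n" for s using that len ord(2) nth_mem by metis
  have less: "v (ord ! s) < v (ord ! ta)" if "s < ta" for s
  proof -
    have "ord ! s \<noteq> ord ! ta" using that ta len ord(1) by (simp add: nth_eq_iff_index_eq)
    then have "v (ord ! s) \<noteq> v (ord ! ta)" using v mem[of s] mem[of ta] that ta by (auto dest: inj_onD)
    moreover have "v (ord ! s) \<le> v (ord ! ta)" using mem[of s] that ta by (intro ta(3)) auto
    ultimately show ?thesis by simp
  qed
  have no: "\<not> ?P j" if "j < ta" for j
  proof
    assume P: "?P j"
    then have "v (ord ! ti) < v (ord ! j)" using ti(1) by auto
    then show False using ti(2)[OF that] by simp
  qed
  have "find ?P [0..<length ord] = Some ta"
    unfolding find_Some_iff using ta less no len by (intro exI[of _ ta]) auto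
  then have "wait_and_pick m v ord = ord ! ta" by (simp add: wait_and_pick_def)
  moreover have "Max (v ` {1..n}) = v (ord ! ta)"
    using ta mem[OF ta(1)] by (intro Max_eqI) auto
  ultimately show ?thesis by (simp add: picks_max_def)
qed

lemma arrange_props:
  assumes "\<And>x. x < n \<Longrightarrow> h x < p"
  shows "distinct (arrange n p h)" "set (arrange n p h) = {1..n}" "length (arrange n p h) = n"
    "\<And>s t. s \<le> t \<Longrightarrow> t < n \<Longrightarrow> h (arrange n p h ! s - 1) \<le> h (arrange n p h ! t - 1)"
proof -
  have m: "mset (arrange n p h) = mset (map Suc [0..<n])" by (rule mset_arrange) (rule assms)
  have "distinct (map Suc [0..<n])" by (simp add: distinct_map)
  then show "distinct (arrange n p h)" using m mset_eq_imp_distinct_iff by blast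
  show "set (arrange n p h) = {1..n}"
    using arg_cong[OF m, of set_mset] by (simp add: image_Suc_atLeastLessThan atLeastLessThanSuc_atLeastAtMost)
  show len: "length (arrange n p h) = n" by (rule length_arrange) (rule assms)
  have "sorted (map (\<lambda>y. h (y - 1)) (arrange n p h)) \<and> (\<forall>y\<in>set (arrange n p h). h (y - 1) < p)"
    unfolding arrange_def
  proof (induction p)
    case (Suc p)
    have "sorted (map h (filter (\<lambda>x. h x = p) xs))" for xs by (induction xs) auto
    then show ?case using Suc
      by (auto simp: sorted_append comp_def less_imp_le intro: less_SucI)
  qed simp
  then show "h (arrange n p h ! s - 1) \<le> h (arrange n p h ! t - 1)" if "s \<le> t" "t < n" for s t
    using that len by (auto simp: sorted_iff_nth_mono)
qed

lemma arrange_permutation: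
  "(\<And>x. x < n \<Longrightarrow> h x < p) \<Longrightarrow> arrange n p h \<in> permutations_of_set {1..n}"
  by (simp add: permutations_of_set_def arrange_props)

definition ranking :: "nat \<Rightarrow> (nat \<Rightarrow> real) \<Rightarrow> nat \<Rightarrow> (nat \<Rightarrow> nat) \<Rightarrow> bool" where
  "ranking n v k a \<longleftrightarrow> (\<forall>i\<le>k. a i < n) \<and> inj_on a {..k} \<and>
     (\<forall>i j. i \<le> j \<and> j \<le> k \<longrightarrow> v (Suc (a j)) \<le> v (Suc (a i))) \<and>
     (\<forall>x<n. x \<notin> a ` {..k} \<longrightarrow> v (Suc x) \<le> v (Suc (a k)))"

lemma ranking_exists:
  assumes "k < n"
  shows "\<exists>a. ranking n v k a"
proof -
  define xs where "xs = sort_key (\<lambda>x. - v (Suc x)) [0..<n]"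
  have xs: "distinct xs" "set xs = {..<n}" "length xs = n" "sorted (map (\<lambda>x. - v (Suc x)) xs)"
    unfolding xs_def by auto
  have ord: "v (Suc (xs ! j)) \<le> v (Suc (xs ! i))" if "i \<le> j" "j < n" for i j
    using xs(3,4) that unfolding sorted_iff_nth_mono by (force simp: less_le_trans)
  have "ranking n v k (\<lambda>i. xs ! i)"
    unfolding ranking_def
  proof (intro conjI allI impI)
    show "xs ! i < n" if "i \<le> k" for i using that assms xs nth_mem[of i xs] by auto
    show "inj_on (\<lambda>i. xs ! i) {..k}" using xs assms by (auto simp: inj_on_def nth_eq_iff_index_eq)
    show "v (Suc (xs ! j)) \<le> v (Suc (xs ! i))" if "i \<le> j \<and> j \<le> k" for i j
      using that assms by (intro ord) auto
    show "v (Suc x) \<le> v (Suc (xs ! k))" if x: "x < n" "x \<notin> (\<lambda>i. xs ! i) ` {..k}" for x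
    proof -
      obtain j where "j < n" "x = xs ! j" using x(1) xs by (metis in_set_conv_nth lessThan_iff)
      moreover from this have "k \<le> j" using x(2) by (metis atMost_iff imageI linear)
      ultimately show ?thesis using ord by simp
    qed
  qed
  then show ?thesis by blast
qed

text \<open>\<open>top_event\<close> supplies the hypotheses of \<open>picks_maxI\<close>: the
  maximum comes after the checkpoint, and rank \<open>Suc i\<close>, inspected before the
  checkpoint, is the best element in front of the maximum.\<close>

lemma success:
  assumes h: "\<And>x. x < n \<Longrightarrow> h x < p" and v: "inj_on v {1..n}" and a: "ranking n v k a"
    and m: "card {x. x < n \<and> h x < m1} \<le> m" "m \<le> card {x. x < n \<and> h x < m2}" "m1 \<le> m2"
    and ev: "top_event k m1 m2 h a"
  shows "picks_max n m v (arrange n p h)"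
proof -
  define ord where "ord = arrange n p h"
  have o: "distinct ord" "set ord = {1..n}" "length ord = n"
    "\<And>s t. s \<le> t \<Longrightarrow> t < n \<Longrightarrow> h (ord ! s - 1) \<le> h (ord ! t - 1)"
    unfolding ord_def using arrange_props[of n h p] h by auto
  have mem: "ord ! s \<in> {1..n}" if "s < n" for s using that o nth_mem by metis
  obtain i where i: "i < k" "h (a (Suc i)) < m1" "\<And>j. j < i \<Longrightarrow> h (a 0) < h (a (Suc j))"
    and a0: "m2 \<le> h (a 0)"
    using ev unfolding top_event_def by auto
  have an: "a j < n" if "j \<le> k" for j using a that by (simp add: ranking_def)
  have av: "v (Suc (a j)) \<le> v (Suc (a l))" if "l \<le> j" "j \<le> k" for j l
    using a that by (simp add: ranking_def)
  have out: "v (Suc x) \<le> v (Suc (a k))" if "x < n" "x \<notin> a ` {..k}" for x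
    using a that by (simp add: ranking_def)
  have "Suc (a 0) \<in> set ord" "Suc (a (Suc i)) \<in> set ord"
    using an[of 0] an[of "Suc i"] i(1) o(2) by auto
  then obtain ta ti where ta: "ta < n" "ord ! ta = Suc (a 0)" and ti: "ti < n" "ord ! ti = Suc (a (Suc i))"
    using o(3) by (metis in_set_conv_nth)
  \<comment> \<open>Everything inspected up to \<open>ti\<close> lies at a bucket position below
    \<open>m1\<close>, and at most \<open>m\<close> elements do.\<close>
  have "Suc ti = card ((\<lambda>s. ord ! s - 1) ` {..ti})"
  proof -
    have "inj_on (\<lambda>s. ord ! s - 1) {..ti}"
    proof (rule inj_onI)
      fix s t assume st: "s \<in> {..ti}" "t \<in> {..ti}" "ord ! s - 1 = ord ! t - 1"
      then have "s < n" "t < n" using ti(1) by auto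
      then have "ord ! s = ord ! t" using st(3) mem[of s] mem[of t] by auto
      then show "s = t" using o(1,3) \<open>s < n\<close> \<open>t < n\<close> by (simp add: nth_eq_iff_index_eq)
    qed
    then show ?thesis by (simp add: card_image)
  qed
  also have "\<dots> \<le> card {x. x < n \<and> h x < m1}"
  proof (rule card_mono)
    show "(\<lambda>s. ord ! s - 1) ` {..ti} \<subseteq> {x. x < n \<and> h x < m1}"
    proof (rule image_subsetI)
      fix s assume s: "s \<in> {..ti}"
      then have "h (ord ! s - 1) < m1" using o(4)[of s ti] ti i(2) by simp
      moreover have "ord ! s - 1 < n" using mem[of s] s ti(1) by auto
      ultimately show "ord ! s - 1 \<in> {x. x < n \<and> h x < m1}" by simp
    qed
  qed auto
  finally have ti_m: "ti < m" using m(1) by simp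
  \<comment> \<open>All elements at bucket positions below \<open>m2\<close> are inspected before
    the maximum, and there are at least \<open>m\<close> of them.\<close>
  have "m \<le> card {x. x < n \<and> h x < m2}" by (rule m(2))
  also have "\<dots> = card (Suc ` {x. x < n \<and> h x < m2})" by (simp add: card_image)
  also have "\<dots> \<le> card ((\<lambda>s. ord ! s) ` {..<ta})"
  proof (rule card_mono)
    show "Suc ` {x. x < n \<and> h x < m2} \<subseteq> (\<lambda>s. ord ! s) ` {..<ta}"
    proof (rule image_subsetI)
      fix x assume x: "x \<in> {x. x < n \<and> h x < m2}"
      then have "Suc x \<in> set ord" using o(2) by auto
      then obtain s where s: "s < n" "ord ! s = Suc x" using o(3) by (metis in_set_conv_nth)
      have "s < ta"
      proof (rule ccontr)
        assume "\<not> s < ta"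
        then have "h (a 0) \<le> h x" using o(4)[of ta s] s ta by simp
        then show False using x a0 by simp
      qed
      then show "Suc x \<in> (\<lambda>s. ord ! s) ` {..<ta}" using s by force
    qed
  qed auto
  also have "\<dots> \<le> ta" using card_image_le[of "{..<ta}"] by simp
  finally have m_ta: "m \<le> ta" .
  have max: "v y \<le> v (ord ! ta)" if y: "y \<in> {1..n}" for y
  proof -
    obtain x where x: "y = Suc x" "x < n" using y by (cases y) auto
    show ?thesis
    proof (cases "x \<in> a ` {..k}")
      case True
      then show ?thesis using av[of 0] x ta by auto
    next
      case False
      then show ?thesis using out[of x] av[of 0 k] x ta by simp
    qed
  qed
  have below: "v (ord ! s) \<le> v (ord ! ti)" if s: "s < ta" for s
  proof -
    obtain x where x: "ord ! s = Suc x" "x < n" using mem[of s] s ta(1) by (cases "ord ! s") auto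
    have "h x \<le> h (a 0)" using o(4)[of s ta] s ta x by simp
    have "x \<noteq> a 0"
    proof
      assume "x = a 0"
      then have "ord ! s = ord ! ta" using x ta by simp
      then show False using o(1,3) s ta(1) by (simp add: nth_eq_iff_index_eq)
    qed
    show ?thesis
    proof (cases "x \<in> a ` {..k}")
      case True
      then obtain j where j: "j \<le> k" "x = a j" by auto
      \<comment> \<open>The ranks from 1 to \<open>i\<close> lie strictly after the bucket of the
        maximum, so none of them is found before \<open>ta\<close>.\<close>
      have "Suc i \<le> j"
      proof (rule ccontr)
        assume "\<not> Suc i \<le> j"
        moreover have "j \<noteq> 0" using j \<open>x \<noteq> a 0\<close> by (intro notI) simp
        ultimately obtain j' where "j = Suc j'" "j' < i" by (cases j) auto
        then show False using i(3)[of j'] j \<open>h x \<le> h (a 0)\<close> by simp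
      qed
      then show ?thesis using av[of "Suc i" j] j x ti by simp
    next
      case False
      then have "v (Suc x) \<le> v (Suc (a k))" using out x by blast
      also have "\<dots> \<le> v (Suc (a (Suc i)))" using av[of "Suc i" k] i(1) by simp
      finally show ?thesis using x ti by simp
    qed
  qed
  show ?thesis unfolding ord_def[symmetric]
    by (rule picks_maxI[OF o(1,2) v ta(1) m_ta max ti_m below])
qed

section \<open>Balance of the buckets\<close>

lemma card_split:
  "card {x. x < a + r \<and> Q x} = card {x. x < a \<and> Q x} + card {x \<in> {a..<a + r}. Q x}" for a r :: nat
proof -
  have "{x. x < a + r \<and> Q x} = {x. x < a \<and> Q x} \<union> {x \<in> {a..<a + r}. Q x}" by auto
  also have "card \<dots> = card {x. x < a \<and> Q x} + card {x \<in> {a..<a + r}. Q x}"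
    by (rule card_Un_disjoint) auto
  finally show ?thesis .
qed

text \<open>Each of the \<open>n div p\<close> complete blocks meets bucket \<open>b\<close> exactly
  once and the incomplete one at most once.\<close>

lemma card_bucket:
  assumes "b < p"
  shows "card {x. x < n \<and> (x mod p + c (x div p)) mod p = b} \<in> {n div p, n div p + 1}"
proof -
  have block: "card {x \<in> {q * p..<q * p + r}. (x mod p + c (x div p)) mod p = b} \<le> 1"
    "r = p \<Longrightarrow> card {x \<in> {q * p..<q * p + r}. (x mod p + c (x div p)) mod p = b} = 1"
    if r: "r \<le> p" for q r
  proof -
    let ?A = "{x \<in> {q * p..<q * p + r}. (x mod p + c (x div p)) mod p = b}"
    have p: "0 < p" using assms by simp
    have d: "x div p = q \<and> x mod p = x - q * p" if x: "x \<in> {q * p..<q * p + r}" for x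
    proof -
      define y where "y = x - q * p"
      have "x = q * p + y" "y < p" using x r by (auto simp: y_def)
      then show ?thesis by simp
    qed
    have "x = y" if "x \<in> ?A" "y \<in> ?A" for x y
    proof -
      have "x div p = q" "y div p = q" using d that by auto
      then have "(x mod p + c q) mod p = (y mod p + c q) mod p" using that by simp
      then have "x mod p = y mod p" by (rule mod_add_cancel) (use p in auto)
      then have "x - q * p = y - q * p" using d that by simp
      moreover have "q * p \<le> x" "q * p \<le> y" using that by auto
      ultimately show ?thesis by linarith
    qed
    then have sub: "?A \<subseteq> {x}" if "x \<in> ?A" for x using that by blast
    show le: "card ?A \<le> 1"
    proof (cases "?A = {}")
      case True
      show ?thesis unfolding True by simp
    next
      case False
      then obtain x where "x \<in> ?A" by blast
      then show ?thesis using card_mono[OF _ sub, of x] by simp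
    qed
    show "card ?A = 1" if "r = p"
    proof -
      \<comment> \<open>The element of block \<open>q\<close> whose residue is
        \<open>b - c q\<close> modulo \<open>p\<close>; adding \<open>p\<close> avoids
        truncation.\<close>
      define z where "z = q * p + (b + p - c q mod p) mod p"
      define y where "y = (b + p - c q mod p) mod p"
      have "y < p" using p by (simp add: y_def)
      have z: "z = q * p + y" by (simp add: z_def y_def)
      have "(y + c q) mod p = ((b + p - c q mod p) + c q mod p) mod p"
        unfolding y_def by (simp only: mod_add_left_eq mod_add_right_eq)
      also have "(b + p - c q mod p) + c q mod p = b + p"
        using p by (simp add: less_imp_le trans_le_add2)
      finally have "(y + c q) mod p = b" using assms by simp
      moreover have "z div p = q" "z mod p = y" using \<open>y < p\<close> by (simp_all add: z)
      ultimately have "z \<in> ?A" using \<open>y < p\<close> that by (simp add: z)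
      then have "0 < card ?A" by (subst card_gt_0_iff) auto
      then show ?thesis using le by simp
    qed
  qed
  define Q where "Q x \<longleftrightarrow> (x mod p + c (x div p)) mod p = b" for x
  have full: "card {x. x < q * p \<and> Q x} = q" for q
  proof (induction q)
    case (Suc q)
    have "card {x. x < q * p + p \<and> Q x} = q + 1"
      unfolding card_split Suc.IH using block(2)[of p q] by (simp add: Q_def)
    then show ?case by (simp add: add.commute)
  qed simp
  have "card {x. x < n div p * p + n mod p \<and> Q x} =
      n div p + card {x \<in> {n div p * p..<n div p * p + n mod p}. Q x}"
    unfolding card_split full ..
  moreover have "card {x \<in> {n div p * p..<n div p * p + n mod p}. Q x} \<le> 1"
    unfolding Q_def using assms by (intro block(1) less_imp_le mod_less_divisor) simp
  ultimately have "card {x. x < n \<and> Q x} = n div p \<or> card {x. x < n \<and> Q x} = n div p + 1"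
    unfolding div_mult_mod_eq by linarith
  then show ?thesis unfolding Q_def by simp
qed

lemma card_positions:
  fixes n m p :: nat and c g :: "nat \<Rightarrow> nat"
  assumes g: "bij_betw g {..<p} {..<p}" and "m \<le> p"
  defines "N \<equiv> card {x. x < n \<and> g ((x mod p + c (x div p)) mod p) < m}"
  shows "m * (n div p) \<le> N" "N \<le> m * (n div p + 1)"
proof (atomize(full), cases "p = 0")
  case True
  then show "m * (n div p) \<le> N \<and> N \<le> m * (n div p + 1)" using assms by simp
next
  case False
  define f where "f x = (x mod p + c (x div p)) mod p" for x
  define D where "D = {b. b < p \<and> g b < m}"
  have "g ` D = {..<m}"
  proof
    show "{..<m} \<subseteq> g ` D"
    proof
      fix y assume y: "y \<in> {..<m}"
      then have "y \<in> g ` {..<p}" using g \<open>m \<le> p\<close> by (simp add: bij_betw_def)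
      then show "y \<in> g ` D" using y by (auto simp: D_def)
    qed
  qed (auto simp: D_def)
  moreover have "inj_on g D" using g by (auto simp: bij_betw_def D_def intro: inj_on_subset)
  ultimately have cD: "card D = m" by (metis card_image card_lessThan)
  have "{x. x < n \<and> g (f x) < m} = (\<Union>b\<in>D. {x. x < n \<and> f x = b})"
    using False by (auto simp: D_def f_def)
  moreover have "card (\<Union>b\<in>D. {x. x < n \<and> f x = b}) = (\<Sum>b\<in>D. card {x. x < n \<and> f x = b})"
    by (rule card_UN_disjoint) (auto simp: D_def)
  ultimately have "N = (\<Sum>b\<in>D. card {x. x < n \<and> f x = b})"
    unfolding N_def f_def[symmetric] by simp
  moreover have "card {x. x < n \<and> f x = b} \<in> {n div p, n div p + 1}" if "b \<in> D" for b
    unfolding f_def using that by (intro card_bucket) (simp add: D_def)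
  then have "(\<Sum>b\<in>D. n div p) \<le> (\<Sum>b\<in>D. card {x. x < n \<and> f x = b})"
    "(\<Sum>b\<in>D. card {x. x < n \<and> f x = b}) \<le> (\<Sum>b\<in>D. n div p + 1)"
    by (intro sum_mono; force)+
  ultimately show "m * (n div p) \<le> N \<and> N \<le> m * (n div p + 1)" by (simp add: cD)
qed

section \<open>Success rate of the computed family\<close>

lemma code_exists:
  assumes "0 < p"
  shows "(\<And>i. i < L \<Longrightarrow> d i < p) \<Longrightarrow> \<exists>c<p ^ L. \<forall>i<L. digit p c i = d i"
proof (induction L arbitrary: d)
  case (Suc L)
  obtain c where c: "c < p ^ L" "\<And>i. i < L \<Longrightarrow> digit p c i = d (Suc i)"
    using Suc.IH[of "\<lambda>i. d (Suc i)"] Suc.prems by auto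
  have d0: "d 0 < p" using Suc.prems by simp
  have "c * p + d 0 < p ^ L * p" using c(1) d0 by (rule digits_bound)
  moreover have "digit p (c * p + d 0) i = d i" if "i < Suc L" for i
    using that d0 c(2) assms by (cases i) (simp_all add: digit_def div_mult2_eq)
  ultimately show ?case by (intro exI[of _ "c * p + d 0"]) (simp add: mult.commute)
qed simp

text \<open>Supplies the averaging set for \<open>greedy_choice_average\<close>: the codes of the
  true permutations among the \<open>p ^ p\<close> candidates. One encoding serves all tests at
  once.\<close>

lemma perm_bad_average:
  fixes p k m m' :: nat and q :: real
  assumes p: "0 < p" and k: "k < p" and m: "0 < m" "m \<le> m'"
  defines "q \<equiv> m / p * (1 - (1 - m / p) ^ k) * (\<Sum>t=m'..<p. 1 / t)"
  shows "\<exists>enc. (\<forall>g\<in>{g. g permutes {..<p}}. enc g < p ^ p) \<and>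
     (\<forall>A r j. real (card {g \<in> {g. g permutes {..<p}}. perm_bad p k m m' A r (enc g) j}) \<le> (1 - q) * fact p)"
proof -
  have top: "fact p * q \<le> real (card {g. g permutes {..<p} \<and> top_event k m m' g b})"
    if "inj_on b {..k}" "\<And>i. i \<le> k \<Longrightarrow> b i < p" for b
  proof -
    interpret permutation_count p k b using that by unfold_locales
    have "real (card (X t k)) \<le> (1 - m / p) ^ k * card (X t 0)" if "m' \<le> t" "t < p" for t
      using that m by (intro card_X_le) auto
    from card_top_event[OF m this] show ?thesis by (simp add: q_def P_def)
  qed
  have cP: "card {g. g permutes {..<p}} = fact p" by (simp add: card_permutations)
  have fP: "finite {g. g permutes {..<p}}" by (simp add: finite_permutations)
  \<comment> \<open>The bound applied to some tuple, here the identity, shows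
    \<open>q \<le> 1\<close>. This makes the right-hand side nonnegative for tests with repeated
    digits, which no candidate violates.\<close>
  have "fact p * q \<le> real (card {g. g permutes {..<p} \<and> top_event k m m' g id})"
    using k by (intro top) auto
  also have "\<dots> \<le> real (card {g. g permutes {..<p}})"
    by (intro of_nat_mono card_mono fP) auto
  finally have q1: "q \<le> 1" by (simp add: cP)
  have "\<forall>g\<in>{g. g permutes {..<p}}. \<exists>c. c < p ^ p \<and> (\<forall>i<p. digit p c i = g i)"
  proof
    fix g assume "g \<in> {g. g permutes {..<p}}"
    then have "g i < p" if "i < p" for i using that permutes_in_image[of g "{..<p}" i] by simp
    from code_exists[OF p this, of p] show "\<exists>c. c < p ^ p \<and> (\<forall>i<p. digit p c i = g i)" by simp
  qed
  from bchoice[OF this]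
  obtain enc where encs: "\<forall>g\<in>{g. g permutes {..<p}}. enc g < p ^ p \<and> (\<forall>i<p. digit p (enc g) i = g i)"
    by (rule exE)
  have enc: "digit p (enc g) i = g i" if "g permutes {..<p}" "i < p" for g i
    using encs that by simp
  have "real (card {g \<in> {g. g permutes {..<p}}. perm_bad p k m m' A r (enc g) j}) \<le> (1 - q) * fact p" for A r j
  proof (cases "inj_on (digit p j) {..<Suc k}")
    case False
    then show ?thesis using q1 by (simp add: perm_bad_def)
  next
    case True
    let ?E = "{g. g permutes {..<p} \<and> top_event k m m' g (digit p j)}"
    have inj: "inj_on (digit p (enc g)) {..<p}" if "g permutes {..<p}" for g
      using inj_on_subset[OF permutes_inj[OF that], of "{..<p}"] enc[OF that]
      by (simp add: inj_on_def)
    have ev: "top_event k m m' (digit p (enc g)) (digit p j) = top_event k m m' g (digit p j)"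
      if "g permutes {..<p}" for g
      by (simp add: top_event_def enc[OF that] digit_less[OF p])
    have E: "{g \<in> {g. g permutes {..<p}}. perm_bad p k m m' A r (enc g) j} = {g. g permutes {..<p}} - ?E"
      using True inj ev by (auto simp: perm_bad_def)
    have sub: "?E \<subseteq> {g. g permutes {..<p}}" by auto
    have "card ({g. g permutes {..<p}} - ?E) = fact p - card ?E"
      unfolding cP[symmetric] by (rule card_Diff_subset[OF finite_subset[OF sub fP] sub])
    moreover have "card ?E \<le> fact p"
      unfolding cP[symmetric] by (rule card_mono[OF fP sub])
    ultimately have "real (card ({g. g permutes {..<p}} - ?E)) = fact p - real (card ?E)"
      by (simp only: of_nat_diff of_nat_fact)
    moreover have "fact p * q \<le> real (card ?E)"
      by (rule top) (use True digit_less[OF p] in \<open>simp_all only: lessThan_Suc_atMost\<close>)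
    moreover have "(1 - q) * fact p = fact p - fact p * q" by (simp add: algebra_simps)
    ultimately show ?thesis unfolding E by linarith
  qed
  then show ?thesis using encs by (intro exI[of _ enc] conjI allI ballI) simp_all
qed

lemma perm_failures:
  fixes p k m m' N R :: nat and q :: real
  assumes p: "0 < p" and k: "k < p" and m: "0 < m" "m \<le> m'" and N: "0 < N"
    and g: "\<And>r. r < R \<Longrightarrow> greedy_choice (p ^ Suc k) (p ^ p) N (perm_bad p k m m') G r"
    and j: "j < p ^ Suc k"
  defines "q \<equiv> m / p * (1 - (1 - m / p) ^ k) * (\<Sum>t=m'..<p. 1 / t)"
  shows "real (card {r. r < R \<and> perm_bad p k m m' G r (G r) j})
     \<le> (1 + 1 / real N) * (R * (1 - q)) + (real N + 1) * ln (p ^ Suc k)"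
proof -
  let ?P = "{g. g permutes {..<p}}"
  obtain enc where "(\<forall>g\<in>?P. enc g < p ^ p) \<and>
    (\<forall>A r j. real (card {g \<in> ?P. perm_bad p k m m' A r (enc g) j}) \<le> (1 - q) * fact p)"
    using perm_bad_average[OF p k m, folded q_def] by (rule exE)
  then have enc: "\<forall>g\<in>?P. enc g < p ^ p"
    "\<forall>A r j. real (card {g \<in> ?P. perm_bad p k m m' A r (enc g) j}) \<le> (1 - q) * fact p"
    by (rule conjunct1, rule conjunct2)
  have "real (card {r. r < R \<and> perm_bad p k m m' G r (G r) j})
     \<le> (1 + 1 / real N) * (\<Sum>r<R. 1 - q) + (real N + 1) * ln (card {..<p ^ Suc k})"
  proof (rule greedy_bound[where bad = "perm_bad p k m m'" and A = G and \<rho> = "\<lambda>_. 1 - q", OF N])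
    fix r assume "r < R"
    show "(\<Sum>j<p ^ Suc k. real (weight N (perm_bad p k m m') G r j) * of_bool (perm_bad p k m m' G r (G r) j))
      \<le> (1 - q) * (\<Sum>j<p ^ Suc k. real (weight N (perm_bad p k m m') G r j))"
    proof (rule greedy_choice_average[OF g[OF \<open>r < R\<close>], where V = ?P and enc = enc])
      show "?P \<noteq> {}" using permutes_id by blast
      show "finite ?P" by (simp add: finite_permutations)
      show "real (card {v \<in> ?P. perm_bad p k m m' G r (enc v) j}) \<le> (1 - q) * card ?P" for j
        unfolding card_permutations[OF card_lessThan finite_lessThan] of_nat_fact by (rule enc(2)[rule_format])
      show "enc v < p ^ p" if "v \<in> ?P" for v
        using enc(1) that by (rule bspec)
      show "{..<p ^ Suc k} \<subseteq> {..<p ^ Suc k}" by (rule order.refl)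
      show "\<not> perm_bad p k m m' G r c i" if "i < p ^ Suc k" "i \<notin> {..<p ^ Suc k}" for i c
        using that unfolding lessThan_iff by blast
    qed
  next
    show "finite {..<p ^ Suc k}" by (rule finite_lessThan)
    show "j \<in> {..<p ^ Suc k}" using j by (simp only: lessThan_iff)
  qed
  then show ?thesis by (simp only: card_lessThan sum_constant of_nat_mult)
qed

text \<open>\<open>\<kappa>\<close> bounds the frequency with which a given pair of top elements
  collides, \<open>\<eta>\<close> the frequency with which a permutation fails a given tuple of
  distinct buckets. The union bound runs over ordered pairs of the \<open>k + 1\<close> top
  elements.\<close>

lemma orders_success:
  fixes n p k B R N m m1 m2 :: nat and q \<kappa> \<eta> :: real
  assumes p: "0 < p" "k < p" "p \<le> n" and N: "0 < N" and R: "0 < R" and B: "B = n div p + 1"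
    and H: "\<And>r. r < R * B \<Longrightarrow> greedy_choice (B * B * p) p N (hash_bad B p) H r"
    and G: "\<And>r. r < R \<Longrightarrow> greedy_choice (p ^ Suc k) (p ^ p) N (perm_bad p k m1 m2) G r"
    and m: "0 < m1" "m1 \<le> m2" "m2 \<le> p" "m1 * (n div p + 1) \<le> m" "m \<le> m2 * (n div p)"
    and v: "inj_on v {1..n}"
  defines "q \<equiv> m1 / p * (1 - (1 - m1 / p) ^ k) * (\<Sum>t=m2..<p. 1 / t)"
    and "\<kappa> \<equiv> (1 + 1 / real N) / p + (real N + 1) * ln (B * B * p) / R"
    and "\<eta> \<equiv> (1 + 1 / real N) * (1 - q) + (real N + 1) * ln (p ^ Suc k) / R"
  assumes \<eta>: "\<eta> \<le> 1"
  shows "real (\<Sum>s<R. card {t. t < R \<and> picks_max n m v (arrange n p (\<lambda>x. digit p (G t) (hash p B H s x)))})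
     \<ge> R * R * ((1 - real (Suc k) ^ 2 * \<kappa>) * (1 - \<eta>))"
proof -
  obtain a where a: "ranking n v k a" using ranking_exists[of k n v] p by auto
  have an: "a i < n" "a i div p < B" if "i \<le> k" for i
  proof -
    show "a i < n" using a that by (simp add: ranking_def)
    then show "a i div p < B" unfolding B by (simp add: div_le_mono less_Suc_eq_le)
  qed
  define h where "h s i = hash p B H s (a i)" for s i
  define Sg where "Sg = {s. s < R \<and> inj_on (h s) {..k}}"
  have "{..<R} - Sg \<subseteq> (\<Union>i\<in>{..k}. \<Union>j\<in>{..k} - {i}. {s. s < R \<and> h s i = h s j})"
    by (auto simp: Sg_def inj_on_def)
  then have "card ({..<R} - Sg) \<le> card (\<Union>i\<in>{..k}. \<Union>j\<in>{..k} - {i}. {s. s < R \<and> h s i = h s j})"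
    by (intro card_mono) auto
  also have "\<dots> \<le> (\<Sum>i\<in>{..k}. card (\<Union>j\<in>{..k} - {i}. {s. s < R \<and> h s i = h s j}))"
    by (intro card_UN_le) auto
  also have "\<dots> \<le> (\<Sum>i\<in>{..k}. \<Sum>j\<in>{..k} - {i}. card {s. s < R \<and> h s i = h s j})"
    by (intro sum_mono card_UN_le) auto
  finally have "real (card ({..<R} - Sg)) \<le> real (\<Sum>i\<in>{..k}. \<Sum>j\<in>{..k} - {i}. card {s. s < R \<and> h s i = h s j})"
    by (simp only: of_nat_le_iff)
  also have "\<dots> = (\<Sum>i\<in>{..k}. \<Sum>j\<in>{..k} - {i}. real (card {s. s < R \<and> h s i = h s j}))" by simp
  also have "\<dots> \<le> (\<Sum>i\<in>{..k}. \<Sum>j\<in>{..k} - {i}. R * \<kappa>)"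
  proof (intro sum_mono)
    fix i j assume ij: "i \<in> {..k}" "j \<in> {..k} - {i}"
    then have "a i \<noteq> a j" using a unfolding ranking_def by (auto dest: inj_onD)
    then have "real (card {s. s < R \<and> h s i = h s j}) \<le> (1 + 1 / real N) * (R / p) + (real N + 1) * ln (B * B * p)"
      unfolding h_def using ij an H p N by (intro hash_collisions) auto
    also have "\<dots> = R * \<kappa>" using R by (simp add: \<kappa>_def field_simps)
    finally show "real (card {s. s < R \<and> h s i = h s j}) \<le> R * \<kappa>" .
  qed
  also have "\<dots> = real (Suc k) * (real k * (R * \<kappa>))"
    by (simp add: card_Diff_subset)
  also have "\<dots> \<le> real (Suc k) * (real (Suc k) * (R * \<kappa>))"
  proof -
    have "0 \<le> \<kappa>" unfolding \<kappa>_def using p B by (auto intro!: add_nonneg_nonneg divide_nonneg_nonneg mult_nonneg_nonneg ln_ge_zero simp flip: of_nat_mult of_nat_add)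
    then show ?thesis by (intro mult_left_mono mult_right_mono) auto
  qed
  finally have "real (card ({..<R} - Sg)) \<le> R * (real (Suc k) ^ 2 * \<kappa>)"
    by (simp add: power2_eq_square algebra_simps)
  moreover have "Sg \<subseteq> {..<R}" by (auto simp: Sg_def)
  then have "real (card ({..<R} - Sg)) = R - card Sg"
    using card_mono[of "{..<R}" Sg] by (subst card_Diff_subset) (auto intro: finite_subset simp: of_nat_diff)
  ultimately have Sg: "R * (1 - real (Suc k) ^ 2 * \<kappa>) \<le> card Sg" by (simp add: algebra_simps)
  have each: "R * (1 - \<eta>) \<le> card {t. t < R \<and> picks_max n m v (arrange n p (\<lambda>x. digit p (G t) (hash p B H s x)))}"
    (is "_ \<le> real (card ?T)") if s: "s \<in> Sg" for s
  proof -
    have hp: "h s i < p" for i using p by (simp add: h_def hash_def)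
    \<comment> \<open>The test that codes the buckets which hash function \<open>s\<close> actually
      gives to the top elements.\<close>
    obtain j where j: "j < p ^ Suc k" "\<And>i. i < Suc k \<Longrightarrow> digit p j i = h s i"
      using code_exists[OF p(1), of "Suc k" "h s"] hp by blast
    have injj: "inj_on (digit p j) {..<Suc k}"
    proof -
      have "inj_on (h s) {..<Suc k}" using s by (simp add: Sg_def lessThan_Suc_atMost)
      then show ?thesis using j(2) by (simp add: inj_on_def)
    qed
    let ?F = "{t. t < R \<and> perm_bad p k m1 m2 G t (G t) j}"
    have "{..<R} - ?F \<subseteq> ?T"
    proof
      fix t assume t: "t \<in> {..<R} - ?F"
      define g where "g = digit p (G t)"
      have inj: "inj_on g {..<p}" and ev: "top_event k m1 m2 g (digit p j)"
        using t injj by (auto simp: perm_bad_def g_def)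
      have g: "bij_betw g {..<p} {..<p}"
        using inj digit_less[OF p(1)] by (intro bij_betw_imageI endo_inj_surj) (auto simp: g_def)
      have "top_event k m1 m2 (\<lambda>x. g (hash p B H s x)) a"
        using ev j(2) by (auto simp: top_event_def h_def)
      moreover have "card {x. x < n \<and> g (hash p B H s x) < m1} \<le> m"
        using card_positions(2)[OF g, of m1 n "\<lambda>q. H (s * B + q)"] m by (simp add: hash_def)
      moreover have "m \<le> card {x. x < n \<and> g (hash p B H s x) < m2}"
        using card_positions(1)[OF g, of m2 n "\<lambda>q. H (s * B + q)"] m by (simp add: hash_def)
      ultimately have "picks_max n m v (arrange n p (\<lambda>x. g (hash p B H s x)))"
        using digit_less[OF p(1)] m v a by (intro success) (auto simp: g_def)
      then show "t \<in> ?T" using t by (simp add: g_def)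
    qed
    then have "card ({..<R} - ?F) \<le> card ?T" by (intro card_mono) auto
    moreover have "?F \<subseteq> {..<R}" by auto
    then have "real (card ({..<R} - ?F)) = R - card ?F"
      using card_mono[of "{..<R}" ?F] by (subst card_Diff_subset) (auto simp: of_nat_diff)
    moreover have "real (card ?F) \<le> (1 + 1 / real N) * (R * (1 - q)) + (real N + 1) * ln (p ^ Suc k)"
      unfolding q_def using p N m G j(1) by (intro perm_failures) auto
    moreover have "\<dots> = R * \<eta>" using R by (simp add: \<eta>_def distrib_left mult.left_commute[of "real R" "1 + 1 / real N"])
    ultimately show ?thesis by (simp add: algebra_simps)
  qed
  have "R * R * ((1 - real (Suc k) ^ 2 * \<kappa>) * (1 - \<eta>)) = (R * (1 - real (Suc k) ^ 2 * \<kappa>)) * (R * (1 - \<eta>))"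
    by simp
  also have "\<dots> \<le> card Sg * (R * (1 - \<eta>))"
    using \<eta> by (intro mult_right_mono Sg) auto
  also have "\<dots> = (\<Sum>s\<in>Sg. R * (1 - \<eta>))" by simp
  also have "\<dots> \<le> (\<Sum>s\<in>Sg. real (card {t. t < R \<and> picks_max n m v (arrange n p (\<lambda>x. digit p (G t) (hash p B H s x)))}))"
    by (intro sum_mono each)
  also have "\<dots> \<le> (\<Sum>s<R. real (card {t. t < R \<and> picks_max n m v (arrange n p (\<lambda>x. digit p (G t) (hash p B H s x)))}))"
    by (intro sum_mono2) (auto simp: Sg_def)
  finally show ?thesis by simp
qed

section \<open>Uniform distributions on multisets\<close>

lemma prob_pmf_of_multiset:
  assumes "M \<noteq> {#}"
  shows "measure_pmf.prob (pmf_of_multiset M) {x. Q x} = size (filter_mset Q M) / size M"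
proof -
  have "measure_pmf.prob (pmf_of_multiset M) {x. Q x} =
      measure_pmf.prob (pmf_of_multiset M) ({x. Q x} \<inter> set_mset M)"
    using measure_Int_set_pmf[of "pmf_of_multiset M" "{x. Q x}"] assms by simp
  also have "\<dots> = (\<Sum>x\<in>{x. Q x} \<inter> set_mset M. count M x / size M)"
    using assms by (subst measure_measure_pmf_finite) auto
  also have "\<dots> = (\<Sum>x\<in>set_mset (filter_mset Q M). count (filter_mset Q M) x) / size M"
    by (simp add: sum_divide_distrib Int_commute Int_def conj_commute)
  finally show ?thesis by (simp add: size_multiset_overloaded_eq[of "filter_mset Q M"])
qed

lemma shannon_entropy_bounds:
  assumes "M \<noteq> {#}"
  shows "0 \<le> shannon_entropy (pmf_of_multiset M)" "shannon_entropy (pmf_of_multiset M) \<le> ln (size M)"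
proof -
  let ?p = "\<lambda>x. pmf (pmf_of_multiset M) x"
  have s: "0 < real (size M)" using assms by (simp add: nonempty_has_size)
  have p: "1 / size M \<le> ?p x" "?p x \<le> 1" if "x \<in># M" for x
  proof -
    show "1 / size M \<le> ?p x" using that assms by (simp add: divide_right_mono Suc_le_eq count_greater_zero_iff)
    show "?p x \<le> 1" by (rule pmf_le_1)
  qed
  have eq: "shannon_entropy (pmf_of_multiset M) = (\<Sum>x\<in>set_mset M. ?p x * (- ln (?p x)))"
    using assms by (simp add: shannon_entropy_def sum_negf[symmetric] del: pmf_of_multiset)
  have pos: "0 < ?p x" if "x \<in># M" for x using p(1)[OF that] s by (meson less_le_trans zero_less_divide_1_iff)
  show "0 \<le> shannon_entropy (pmf_of_multiset M)"
    unfolding eq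
  proof (rule sum_nonneg)
    fix x assume "x \<in># M"
    then have "ln (?p x) \<le> 0" using p(2) pos by (simp add: ln_le_zero_iff del: pmf_of_multiset)
    then show "0 \<le> ?p x * (- ln (?p x))" by (intro mult_nonneg_nonneg) auto
  qed
  have "(\<Sum>x\<in>set_mset M. ?p x * (- ln (?p x))) \<le> (\<Sum>x\<in>set_mset M. ?p x * ln (size M))"
  proof (rule sum_mono)
    fix x assume x: "x \<in># M"
    have "ln (1 / size M) \<le> ln (?p x)" using p(1)[OF x] pos[OF x] s by (subst ln_le_cancel_iff) auto
    moreover have "ln (1 / real (size M)) = - ln (size M)" using assms by (simp add: ln_div)
    ultimately have "- ln (?p x) \<le> ln (size M)" by linarith
    then show "?p x * (- ln (?p x)) \<le> ?p x * ln (size M)" by (intro mult_left_mono) auto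
  qed
  also have "\<dots> = (\<Sum>x\<in>set_mset M. ?p x) * ln (size M)" by (simp add: sum_distrib_right del: pmf_of_multiset)
  also have "(\<Sum>x\<in>set_mset M. ?p x) = 1"
    using assms by (intro sum_pmf_eq_1) auto
  finally show "shannon_entropy (pmf_of_multiset M) \<le> ln (size M)" by (simp add: eq)
qed

section \<open>The classical bound for all permutations\<close>

lemma harmonic_sum_ge_ln:
  "0 < m \<Longrightarrow> m \<le> p \<Longrightarrow> ln (real p / real m) \<le> (\<Sum>t=m..<p. 1 / real t)"
proof (induction p rule: nat_induct)
  case (Suc p)
  show ?case
  proof (cases "m \<le> p")
    case True
    have "ln (real (Suc p) / m) = ln (real p / m) + ln (1 + 1 / p)"
      using True Suc.prems by (simp add: ln_mult[symmetric] ln_div field_simps flip: ln_mult)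
    also have "\<dots> \<le> (\<Sum>t=m..<p. 1 / real t) + 1 / p"
      using True Suc by (intro add_mono ln_add_one_self_le_self) auto
    finally show ?thesis using True by simp
  next
    case False
    then show ?thesis using Suc.prems by (simp add: le_Suc_eq)
  qed
qed simp

text \<open>The case of \<open>n\<close> singleton buckets with all ranks scanned,
  \<open>k = n - 1\<close>. Both cuts are \<open>m\<close> and nothing remains undecided, so only
  the secretary sum is left.\<close>

lemma symmetric_family:
  assumes n: "0 < n" and m: "0 < m" "m < n"
  defines "M \<equiv> image_mset (arrange n n) (mset_set {g. g permutes {..<n}})"
  shows "M \<noteq> {#}" "set_mset M \<subseteq> permutations_of_set {1..n}"
    "\<And>v. inj_on v {1..n} \<Longrightarrow>
       real m / n * (\<Sum>t=m..<n. 1 / real t) \<le> measure_pmf.prob (pmf_of_multiset M) {ord. picks_max n m v ord}"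
proof -
  let ?P = "{g. g permutes {..<n}}"
  have fin: "finite ?P" by (simp add: finite_permutations)
  have size: "size M = fact n" by (simp add: M_def card_permutations)
  then show ne: "M \<noteq> {#}" by auto
  have lt: "g x < n" if "g \<in> ?P" "x < n" for g x
    using that permutes_in_image[of g "{..<n}" x] by simp
  then show "set_mset M \<subseteq> permutations_of_set {1..n}"
    using fin arrange_permutation[of n _ n] by (force simp: M_def)
  fix v :: "nat \<Rightarrow> real" assume v: "inj_on v {1..n}"
  define k where "k = n - 1"
  have k: "k < n" "{..k} = {..<n}" using n by (auto simp: k_def)
  obtain a where a: "ranking n v k a" using ranking_exists[OF k(1)] by blast
  then have a': "inj_on a {..k}" "\<And>i. i \<le> k \<Longrightarrow> a i < n" by (simp_all add: ranking_def)
  have surj: "a ` {..k} = {..<n}"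
    unfolding k(2)
  proof (rule endo_inj_surj)
    show "inj_on a {..<n}" using a'(1) by (simp only: k(2))
    show "a ` {..<n} \<subseteq> {..<n}" using a'(2) k(2) by auto
  qed simp
  interpret permutation_count n k a using a' by unfold_locales
  have sub: "{g \<in> ?P. top_event k m m g a} \<subseteq> {g \<in> ?P. picks_max n m v (arrange n n g)}"
    proof
      fix g assume g: "g \<in> {g \<in> ?P. top_event k m m g a}"
      then have gP: "g permutes {..<n}" by simp
      have "{x. x < n \<and> g x < m} = inv g ` {..<m}"
      proof -
        have "g (inv g y) = y" "inv g (g y) = y" for y using permutes_inverses[OF gP] by auto
        moreover have "inv g y < n" if "y < m" for y
          using permutes_in_image[OF permutes_inv[OF gP], of y] that m by simp
        ultimately show ?thesis by (auto intro!: image_eqI[of _ "inv g" "g _"])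
      qed
      then have "card {x. x < n \<and> g x < m} = m"
        using permutes_inj[OF permutes_inv[OF gP]] by (simp add: card_image inj_on_subset)
      then have "picks_max n m v (arrange n n g)"
        using lt[of g] g by (intro success[of n g n v k a m m m, OF _ v a]) auto
      then show "g \<in> {g \<in> ?P. picks_max n m v (arrange n n g)}" using g by simp
    qed
  \<comment> \<open>All elements are ranked and one of them has position 0, which precedes
    \<open>t\<close> since \<open>0 < m \<le> t\<close>.\<close>
  have "X t k = {}" if "m \<le> t" "t < n" for t
  proof -
    have False if g: "g \<in> X t k" for g
    proof -
      have gP: "g permutes {..<n}" using g by (simp add: X_def P_def)
      then obtain x where "x < n" "g x = 0" using permutes_image[OF gP] n by (metis imageE lessThan_iff)
      then obtain i where "i \<le> k" "g (a i) = 0" using surj by (metis imageE atMost_iff lessThan_iff)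
      then show False using g \<open>m \<le> t\<close> m by (cases i) (auto simp: X_def Suc_le_eq)
    qed
    then show ?thesis by blast
  qed
  then have "real (card (X t k)) \<le> (0::real) * card (X t 0)" if "m \<le> t" "t < n" for t using that by simp
  from card_top_event[OF m(1) order.refl this]
  have "fact n * (real m / n * (\<Sum>t=m..<n. 1 / real t)) \<le> real (card {g \<in> ?P. top_event k m m g a})"
    by (simp add: P_def)
  also have "\<dots> \<le> real (card {g \<in> ?P. picks_max n m v (arrange n n g)})"
    using card_mono[OF _ sub] fin by simp
  also have "card {g \<in> ?P. picks_max n m v (arrange n n g)} = size (filter_mset (picks_max n m v) M)"
    using fin by (simp add: M_def filter_mset_image_mset)
  finally have "real m / n * (\<Sum>t=m..<n. 1 / real t) \<le> size (filter_mset (picks_max n m v) M) / fact n"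
    by (simp add: field_simps)
  then show "real m / n * (\<Sum>t=m..<n. 1 / real t) \<le> measure_pmf.prob (pmf_of_multiset M) {ord. picks_max n m v ord}"
    unfolding prob_pmf_of_multiset[OF ne] size by simp
qed

section \<open>Estimates for the parameters\<close>

lemma exp_1_bounds: "(27/10::real) \<le> exp 1" "exp 1 \<le> (28/10::real)"
proof -
  have "\<bar>exp 1 - 5837465777 / 2147483648\<bar> \<le> (1 / 100 :: real)"
    using e_approx_32 by (rule order_trans) (simp add: field_simps)
  then show "(27/10::real) \<le> exp 1" "exp 1 \<le> (28/10::real)"
    unfolding abs_le_iff by linarith+
qed

lemma real_div_bounds: "real (a div b) \<le> a / b" "a / b - 1 \<le> real (a div b)"
proof -
  have "real (a div b) = real_of_int \<lfloor>real a / real b\<rfloor>" by (simp add: floor_divide_of_nat_eq)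
  then show "real (a div b) \<le> a / b" "a / b - 1 \<le> real (a div b)" by linarith+
qed

lemma threshold_bounds:
  assumes "2 \<le> buckets n"
  shows "real (threshold n) \<le> buckets n / exp 1" "(real (buckets n) - 1) / exp 1 - 1 \<le> real (threshold n)"
proof -
  define p where "p = buckets n"
  have p: "2 \<le> p" using assms by (simp add: p_def)
  define x where "x = real ((p - 1) ^ p) / real (p ^ (p - 1))"
  have c: "real (threshold n) \<le> x" "x - 1 \<le> real (threshold n)"
    unfolding threshold_def p_def[symmetric] x_def
    by (rule real_div_bounds)+
  have pp: "real p ^ p = real p * real p ^ (p - 1)" "(real p - 1) ^ p = (real p - 1) * (real p - 1) ^ (p - 1)"
    using p by (simp_all add: power_eq_if)
  \<comment> \<open>The two forms of the quotient serve opposite bounds: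
    \<open>(1 - 1 / p) ^ p\<close> is at most \<open>1 / e\<close>, while
    \<open>(1 - 1 / p) ^ (p - 1)\<close> is at least \<open>1 / e\<close>.\<close>
  have x1: "x = p * (1 - 1 / p) ^ p"
    using p by (simp add: x_def of_nat_diff pp(1) power_divide diff_divide_distrib[symmetric]
        flip: power_divide) (simp add: field_simps pp power_divide)
  have x2: "x = (real p - 1) * (1 - 1 / p) ^ (p - 1)"
    using p unfolding x_def by (simp add: of_nat_diff pp(2) power_divide field_simps)
  have "(1 - 1 / p) ^ p \<le> exp (- 1 / p) ^ p"
    using p exp_ge_add_one_self[of "- 1 / real p"] by (intro power_mono) auto
  also have "\<dots> = exp (- 1)" using p by (simp flip: exp_of_nat_mult)
  finally have "x \<le> p * exp (- 1)" unfolding x1 by (intro mult_left_mono) auto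
  then have "x \<le> p / exp 1" by (simp add: exp_minus field_simps)
  then show "real (threshold n) \<le> buckets n / exp 1"
    using c(1) unfolding p_def by linarith
  have "exp (- 1 / (real p - 1)) \<le> 1 - 1 / p"
  proof -
    have "1 + 1 / (real p - 1) \<le> exp (1 / (real p - 1))" by (rule exp_ge_add_one_self)
    moreover have "1 + 1 / (real p - 1) = p / (real p - 1)" using p by (simp add: field_simps)
    ultimately have "inverse (exp (1 / (real p - 1))) \<le> inverse (p / (real p - 1))"
      using p by (intro le_imp_inverse_le) auto
    then show ?thesis using p by (simp add: exp_minus field_simps)
  qed
  then have le: "exp (- 1 / (real p - 1)) ^ (p - 1) \<le> (1 - 1 / p) ^ (p - 1)"
    by (intro power_mono) auto
  have eq: "exp (- 1 / (real p - 1)) ^ (p - 1) = exp (- 1)"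
    using p by (simp add: of_nat_diff flip: exp_of_nat_mult)
  have "(real p - 1) * exp (- 1) \<le> x"
    unfolding x2 using p le[unfolded eq] by (intro mult_left_mono) simp_all
  then have "(real p - 1) / exp 1 \<le> x" by (simp add: exp_minus field_simps)
  then show "(real (buckets n) - 1) / exp 1 - 1 \<le> real (threshold n)"
    using c(2) unfolding p_def by linarith
qed

text \<open>Up to rounding, the products to compare with \<open>n / e\<close> are
  \<open>(p / e - 1) * (n / p + 1)\<close> and \<open>(p / e + 1) * (n / p - 1)\<close>. They differ
  from it by \<open>n / p - p / e\<close> and a constant, whose sign is right because
  \<open>n / p \<ge> p + 1\<close>. The margin 3 covers the rounding in \<open>threshold\<close>,
  which exceeds \<open>p / e - 2\<close>.\<close>

lemma checkpoint_bounds: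
  assumes p: "2 \<le> buckets n" "buckets n * (buckets n + 1) \<le> n"
  defines "m \<equiv> nat \<lfloor>real n / exp 1\<rfloor>"
  shows "(threshold n - 1) * (n div buckets n + 1) \<le> m" "m \<le> (threshold n + 3) * (n div buckets n)"
proof -
  define p where "p = buckets n"
  have p2: "2 \<le> real p" "0 < p" using p(1) by (simp_all add: p_def)
  have e: "(27/10::real) \<le> exp 1" by (rule exp_1_bounds)
  have c: "real (threshold n) \<le> p / exp 1" "(real p - 1) / exp 1 - 1 \<le> real (threshold n)"
    using threshold_bounds[OF p(1)] by (simp_all add: p_def)
  have pe: "p / exp 1 \<le> real p" using e p2 by (simp add: divide_le_eq)
  have "real p * (real p + 1) \<le> n" using p(2) unfolding p_def[symmetric] by (metis of_nat_le_iff of_nat_mult of_nat_1 of_nat_add)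
  then have np: "real p + 1 \<le> n / p" using p2 by (simp add: field_simps)
  have d: "real (n div p) \<le> n / p" "n / p - 1 \<le> real (n div p)"
    by (rule real_div_bounds)+
  have m: "real m \<le> n / exp 1" "n / exp 1 - 1 < real m"
  proof -
    have "real m = real_of_int \<lfloor>real n / exp 1\<rfloor>" unfolding m_def by (simp add: of_nat_nat)
    then show "real m \<le> n / exp 1" "n / exp 1 - 1 < real m" by linarith+
  qed
  show "(threshold n - 1) * (n div buckets n + 1) \<le> m"
  proof (cases "threshold n = 0")
    case False
    have "real ((threshold n - 1) * (n div p + 1)) = (real (threshold n) - 1) * (real (n div p) + 1)"
    proof -
      obtain c' where "threshold n = Suc c'" using False not0_implies_Suc by blast
      then show ?thesis by (simp add: algebra_simps)
    qed
    also have "\<dots> \<le> (p / exp 1 - 1) * (n / p + 1)"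
    proof -
      have "1 \<le> real (threshold n)" using False by simp
      then have "0 \<le> p / exp 1 - 1" using c(1) by linarith
      then show ?thesis using c(1) d by (intro mult_mono) linarith+
    qed
    also have "\<dots> = n / exp 1 - n / p + p / exp 1 - 1"
      using p2 by (simp add: algebra_simps)
    also have "\<dots> \<le> n / exp 1 - 1" using np pe by simp
    also have "\<dots> < real m" by (rule m(2))
    finally show ?thesis by (simp only: of_nat_less_iff p_def less_imp_le)
  qed simp
  have "(p / exp 1 + 1) * (n / p - 1) = n / exp 1 + (n / p - p / exp 1 - 1)"
    using p2 by (simp add: algebra_simps)
  then have "n / exp 1 \<le> (p / exp 1 + 1) * (n / p - 1)" using np pe by linarith
  also have "\<dots> \<le> (real (threshold n) + 3) * real (n div p)"
  proof (rule mult_mono)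
    have "1 / exp 1 \<le> (1::real)" by simp
    then show "p / exp 1 + 1 \<le> real (threshold n) + 3"
      using c(2) unfolding diff_divide_distrib by linarith
    show "n / p - 1 \<le> real (n div p)" by (rule d)
    show "0 \<le> real n / p - 1" using np p2 by linarith
  qed simp
  finally have "real m \<le> (real (threshold n) + 3) * real (n div p)" using m(1) by linarith
  then have "real m \<le> real ((threshold n + 3) * (n div p))" by simp
  then show "m \<le> (threshold n + 3) * (n div buckets n)" by (simp only: of_nat_le_iff p_def)
qed

lemma mult_ge_minus:
  fixes x a :: real
  assumes "0 \<le> x" "x \<le> 1" "0 \<le> a"
  shows "x - a \<le> x * (1 - a)"
proof -
  have "x * a \<le> 1 * a" using assms by (intro mult_right_mono) auto
  then show ?thesis by (simp add: algebra_simps)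
qed

text \<open>Composition of the constants, in units of \<open>1 / p\<close>: \<open>q\<close> loses 3
  by the lower cut, 1 by undecided permutations and 9 by the harmonic sum, and \<open>\<eta>\<close>
  adds 3, which makes 16. \<open>\<kappa>\<close> has 2 from the collision frequency and 6 from the
  logarithm of the number of hash tests, which makes 8.\<close>

lemma success_rate:
  fixes n :: nat and q \<kappa> \<eta> :: real
  assumes p: "200 \<le> buckets n" and K: "8 * Suc (depth n) ^ 2 \<le> buckets n" and n: "buckets n * (buckets n + 1) \<le> n"
  defines "m1 \<equiv> threshold n - 1" and "m2 \<equiv> threshold n + 3"
  defines "q \<equiv> m1 / buckets n * (1 - (1 - m1 / buckets n) ^ depth n) * (\<Sum>t=m2..<buckets n. 1 / t)"
    and "\<kappa> \<equiv> (1 + 1 / real (bits n)) / buckets n + (real (bits n) + 1) * ln (blocks n * blocks n * buckets n) / rounds n"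
    and "\<eta> \<equiv> (1 + 1 / real (bits n)) * (1 - q) + (real (bits n) + 1) * ln (buckets n ^ Suc (depth n)) / rounds n"
  shows "0 < m1" "m2 \<le> buckets n" "\<eta> \<le> 1"
    "1 / exp 1 - (16 + 8 * real (Suc (depth n)) ^ 2) / buckets n \<le> (1 - real (Suc (depth n)) ^ 2 * \<kappa>) * (1 - \<eta>)"
proof -
  define p where "p = buckets n"
  define l where "l = bits n"
  define lam where "lam = bits l"
  define k where "k = depth n"
  have p200: "200 \<le> real p" using p by (simp add: p_def)
  then have p0: "0 < real p" by simp
  have pl: "real p \<le> l" using buckets_le[of n] by (simp add: p_def l_def)
  then have l200: "200 \<le> real l" using p200 by simp
  have R: "real (rounds n) = real l ^ 3" by (simp add: rounds_def l_def)
  have k: "k = 4 * lam" by (simp add: k_def depth_def lam_def l_def)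
  have kp: "Suc k \<le> p"
  proof -
    have "Suc k \<le> Suc k ^ 2" by (simp add: power2_eq_square)
    also have "\<dots> \<le> 8 * Suc k ^ 2" by simp
    finally show ?thesis using K unfolding k_def p_def by simp
  qed
  have n2: "blocks n \<le> n" "0 < n" and pn: "p \<le> n"
  proof -
    have "2 * p \<le> p * (p + 1)" using p by (simp add: p_def)
    also have "\<dots> \<le> n" using n by (simp only: p_def)
    finally have pn: "2 * p \<le> n" .
    then show "0 < n" "p \<le> n" using p by (auto simp: p_def)
    have "n div p * 2 \<le> n div p * p" using p by (intro mult_le_mono2) (simp add: p_def)
    also have "\<dots> \<le> n" by (rule div_times_less_eq_dividend)
    finally show "blocks n \<le> n" using pn p unfolding blocks_def p_def[symmetric] by simp
  qed
  have e: "(27/10::real) \<le> exp 1" "exp 1 \<le> (28/10::real)" by (rule exp_1_bounds)+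
  have ei: "(35/100::real) \<le> 1 / exp 1" "1 / exp 1 \<le> (1/2::real)"
    using e by (simp_all add: field_simps)
  have c: "real (threshold n) \<le> p / exp 1" "(real p - 1) / exp 1 - 1 \<le> real (threshold n)"
    using threshold_bounds[of n] p by (simp_all add: p_def)
  have pe: "p / exp 1 \<le> p / 2" "(35/100) * p \<le> p / exp 1"
    using mult_left_mono[OF ei(2), of p] mult_left_mono[OF ei(1), of p] p0 by simp_all
  have c3: "p / exp 1 - 3 / 2 \<le> real (threshold n)" using c(2) ei(2) unfolding diff_divide_distrib by linarith
  then have threshold: "2 \<le> real (threshold n)" using pe(2) p200 by linarith
  then have m1: "real m1 = real (threshold n) - 1" by (simp add: m1_def of_nat_diff)
  then have m1_0: "0 < real m1" using threshold by linarith
  then show "0 < m1" by simp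
  have m2: "real m2 = real (threshold n) + 3" by (simp add: m2_def)
  have m2p: "real m2 \<le> p" using c(1) pe(1) p200 m2 by linarith
  then show "m2 \<le> buckets n" by (simp add: p_def)
  have x: "1 / exp 1 - 3 / p \<le> m1 / p" "m1 / p \<le> 1 / 2" "1 / 4 \<le> m1 / p"
  proof -
    have "(p / exp 1 - 3) / p \<le> m1 / p" using c3 m1 p0 by (intro divide_right_mono) auto
    then show 1: "1 / exp 1 - 3 / p \<le> m1 / p" using p0 by (simp add: diff_divide_distrib)
    have "real m1 \<le> p / 2" using c(1) pe(1) m1 by linarith
    then show "m1 / p \<le> 1 / 2" using p0 by (simp add: field_simps)
    have "3 / real p \<le> 3 / 200" using p200 by (intro divide_left_mono) auto
    then show "1 / 4 \<le> m1 / p" using 1 ei(1) by linarith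
  qed
  have x01: "0 \<le> m1 / p" "m1 / p \<le> 1" using x by linarith+
  have tail: "(1 - m1 / p) ^ k \<le> 1 / l"
  proof -
    have "(1 - m1 / p) ^ k \<le> (3 / 4) ^ k" using x x01 by (intro power_mono) linarith+
    also have "\<dots> = ((3 / 4) ^ 4) ^ lam" unfolding k by (rule power_mult)
    also have "\<dots> \<le> (1 / 2) ^ lam" by (intro power_mono) (auto simp: power_divide)
    also have "\<dots> = 1 / 2 ^ lam" by (simp add: power_one_over)
    also have "\<dots> \<le> 1 / l"
    proof -
      have "real l \<le> real (2 ^ lam)" using bits_bounds(1)[of l] unfolding lam_def of_nat_le_iff by simp
      then show ?thesis using l200 by (intro divide_left_mono) auto
    qed
    finally show ?thesis .
  qed
  have tail0: "0 \<le> (1 - m1 / p) ^ k" using x01 by (intro zero_le_power) linarith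
  \<comment> \<open>The sum is at least \<open>ln (p / m2)\<close>, and
    \<open>m2 \<le> p / e * (1 + 3 * e / p)\<close> costs at most \<open>3 * e / p\<close>, where
    \<open>3 * e \<le> 9\<close>.\<close>
  have harm: "1 - 9 / p \<le> (\<Sum>t=m2..<p. 1 / real t)"
  proof -
    have "real m2 \<le> p / exp 1 + 3" using m2 c(1) by simp
    also have "\<dots> = p / exp 1 * (1 + 3 * exp 1 / p)" using p0 by (simp add: field_simps)
    finally have le: "real m2 \<le> p / exp 1 * (1 + 3 * exp 1 / p)" .
    have m20: "0 < real m2" using m2 by simp
    have "ln (real m2) \<le> ln (p / exp 1 * (1 + 3 * exp 1 / p))"
      using le m20 p0 by (subst ln_le_cancel_iff) (auto intro!: mult_pos_pos add_pos_pos)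
    also have "\<dots> = ln (p / exp 1) + ln (1 + 3 * exp 1 / p)"
      using p0 by (intro ln_mult_pos) (auto intro!: add_pos_pos)
    also have "\<dots> \<le> ln (real p) - 1 + 3 * exp 1 / p"
      using p0 ln_add_one_self_le_self[of "3 * exp 1 / real p"] by (simp add: ln_div)
    also have "3 * exp 1 / p \<le> 9 / p" using e p0 by (intro divide_right_mono) auto
    finally have "1 - 9 / p \<le> ln (real p) - ln (real m2)" by simp
    also have "\<dots> = ln (real p / real m2)" using p0 m20 by (simp add: ln_div)
    also have "\<dots> \<le> (\<Sum>t=m2..<p. 1 / real t)"
      using m20 m2p by (intro harmonic_sum_ge_ln) auto
    finally show ?thesis .
  qed
  have lp: "1 / real l \<le> 1 / p" using pl p0 by (intro divide_left_mono) auto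
  have p9: "0 \<le> 1 - 9 / real p" "9 / real p \<le> 1" using p200 by (simp_all add: field_simps)
  have q: "1 / exp 1 - 13 / p \<le> q"
  proof -
    let ?x = "m1 / p"
    define y where "y = ?x * (1 - (1 - ?x) ^ k)"
    have y: "?x - 1 / l \<le> y"
      using mult_ge_minus[OF x01 tail0] tail by (simp add: y_def)
    have "(1 - ?x) ^ k \<le> 1" using x01 by (intro power_le_one) linarith+
    then have t: "0 \<le> 1 - (1 - ?x) ^ k" "1 - (1 - ?x) ^ k \<le> 1" using tail0 by linarith+
    have y01: "0 \<le> y" "y \<le> 1"
      unfolding y_def by (rule mult_nonneg_nonneg[OF x01(1) t(1)], rule mult_le_one[OF x01(2) t])
    have "y - 9 / p \<le> y * (1 - 9 / p)" using y01 by (intro mult_ge_minus) auto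
    also have "\<dots> \<le> y * (\<Sum>t=m2..<p. 1 / real t)" using harm y01 by (intro mult_left_mono)
    also have "\<dots> = q" unfolding q_def y_def p_def k_def by simp
    finally have "1 / exp 1 - 3 / p - 1 / p - 9 / p \<le> q" using y x(1) lp by linarith
    then show ?thesis by (simp add: diff_divide_distrib[symmetric] add_divide_distrib[symmetric] diff_diff_eq)
  qed
  have q0: "0 \<le> q"
  proof -
    have "13 / real p \<le> 13 / 200" using p200 by (intro divide_left_mono) auto
    then show ?thesis using q ei by linarith
  qed
  have lnp: "0 \<le> ln (real (p ^ Suc k))" "ln (real (p ^ Suc k)) \<le> l"
  proof -
    have p1: "1 \<le> p ^ Suc k" using p by (simp add: p_def)
    then show "0 \<le> ln (real (p ^ Suc k))" by (intro ln_ge_zero) (metis of_nat_1 of_nat_le_iff)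
    have "p ^ Suc k \<le> p ^ p" using kp p by (intro power_increasing) (auto simp: p_def)
    also have "\<dots> \<le> 2 ^ l" using buckets_power_le by (simp add: p_def l_def)
    finally have "real (p ^ Suc k) \<le> 2 ^ l" by (metis of_nat_le_iff of_nat_numeral of_nat_power)
    then have "ln (real (p ^ Suc k)) \<le> ln (2 ^ l)" using p1 by (subst ln_le_cancel_iff) auto
    also have "\<dots> = l * ln 2" by (simp add: ln_realpow)
    also have "\<dots> \<le> real l * 1" using ln_le_minus_one[of "2::real"] by (intro mult_left_mono) auto
    finally show "ln (real (p ^ Suc k)) \<le> l" by simp
  qed
  have lnB: "ln (real (blocks n * blocks n * p)) \<le> 3 * l"
  proof -
    have "n \<le> 2 ^ l" using bits_bounds(1)[of n] by (simp add: l_def)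
    then have "blocks n * blocks n * p \<le> 2 ^ l * 2 ^ l * 2 ^ l"
      using n2 pn by (intro mult_le_mono) auto
    also have "\<dots> = 2 ^ (3 * l)" by (simp add: power_add[symmetric])
    finally have le: "real (blocks n * blocks n * p) \<le> 2 ^ (3 * l)"
      by (metis of_nat_le_iff of_nat_numeral of_nat_power)
    have "0 < blocks n * blocks n * p" using p by (simp add: p_def blocks_def)
    then have "ln (real (blocks n * blocks n * p)) \<le> ln (2 ^ (3 * l))"
      using le by (subst ln_le_cancel_iff) (auto simp del: of_nat_mult)
    also have "\<dots> = (3 * l) * ln 2" by (simp add: ln_realpow)
    also have "\<dots> \<le> real (3 * l) * 1" using ln_le_minus_one[of "2::real"] by (intro mult_left_mono) auto
    finally show ?thesis by simp
  qed
  \<comment> \<open>The additive greedy error: logarithms linear in \<open>l\<close> over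
    \<open>l ^ 3\<close> rounds leave \<open>O(1 / l)\<close>; the 2 comes from
    \<open>l + 1 \<le> 2 * l\<close>.\<close>
  have frac: "(real l + 1) * X / real l ^ 3 \<le> 2 * c / l" if X: "X \<le> c * l" "0 \<le> c" for X c :: real
  proof -
    have "(real l + 1) * X \<le> (real l + 1) * (c * l)"
      using X(1) by (intro mult_left_mono) auto
    also have "\<dots> \<le> (2 * real l) * (c * l)"
      using X(2) l200 by (intro mult_right_mono) auto
    finally have "(real l + 1) * X \<le> (2 * real l) * (c * l)" .
    then have "(real l + 1) * X / real l ^ 3 \<le> (2 * real l) * (c * l) / real l ^ 3"
      by (intro divide_right_mono) auto
    also have "\<dots> = 2 * c / l" using l200 by (simp add: power3_eq_cube field_simps)
    finally show ?thesis .
  qed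
  have kappa: "\<kappa> \<le> 8 / p"
  proof -
    have "(1 + 1 / real l) / p \<le> 2 / p" using l200 p0 by (intro divide_right_mono) auto
    moreover have "(real l + 1) * ln (real (blocks n * blocks n * p)) / real l ^ 3 \<le> 2 * 3 / l"
      using lnB by (intro frac) auto
    moreover have "2 * 3 / real l \<le> 6 / p" using pl p0 by (simp add: frac_le)
    ultimately show ?thesis unfolding \<kappa>_def R l_def[symmetric] p_def[symmetric]
      by linarith
  qed
  have eta: "q - 3 / p \<le> 1 - \<eta>"
  proof -
    have "(real l + 1) * ln (real (p ^ Suc k)) / real l ^ 3 \<le> 2 * 1 / l"
      using lnp by (intro frac) auto
    moreover have "(1 + 1 / real l) * (1 - q) \<le> 1 - q + 1 / l"
      using q0 l200 by (simp add: algebra_simps divide_right_mono)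
    ultimately have "\<eta> \<le> 1 - q + 3 / l"
      unfolding \<eta>_def R l_def[symmetric] p_def[symmetric] k_def[symmetric] by linarith
    moreover have "3 / real l \<le> 3 / p" using pl p0 by (intro divide_left_mono) auto
    ultimately show ?thesis by linarith
  qed
  have y: "1 / exp 1 - 16 / p \<le> 1 - \<eta>" using eta q by linarith
  have "16 / real p \<le> 16 / 200" using p200 by (intro divide_left_mono) auto
  then have y0: "0 \<le> 1 / exp 1 - 16 / real p" using ei by linarith
  then show "\<eta> \<le> 1" using y by linarith
  define a where "a = 8 * real (Suc k) ^ 2 / p"
  have K': "8 * real (Suc k) ^ 2 \<le> p"
    using K unfolding k_def[symmetric] p_def[symmetric]
    by (metis of_nat_le_iff of_nat_mult of_nat_numeral of_nat_power)
  then have a: "a \<le> 1" "0 \<le> a" using p0 by (simp_all add: a_def field_simps)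
  have "real (Suc k) ^ 2 * \<kappa> \<le> real (Suc k) ^ 2 * (8 / p)"
    using kappa by (intro mult_left_mono) auto
  then have ka: "1 - a \<le> 1 - real (Suc k) ^ 2 * \<kappa>" by (simp add: a_def field_simps)
  have "1 / exp 1 - 16 / p - a \<le> (1 / exp 1 - 16 / p) * (1 - a)"
    using y0 a ei p0 by (intro mult_ge_minus) (auto intro: order_trans[of _ "1 / exp 1"])
  also have "\<dots> = (1 - a) * (1 / exp 1 - 16 / p)" by (simp only: mult.commute)
  also have "\<dots> \<le> (1 - real (Suc k) ^ 2 * \<kappa>) * (1 - \<eta>)"
    using ka y y0 a by (intro mult_mono) auto
  finally show "1 / exp 1 - (16 + 8 * real (Suc (depth n)) ^ 2) / buckets n
      \<le> (1 - real (Suc (depth n)) ^ 2 * \<kappa>) * (1 - \<eta>)"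
    by (simp add: a_def add_divide_distrib p_def k_def)
qed

section \<open>Asymptotics of the parameters\<close>

lemma parameter_bounds:
  fixes n :: nat and L \<Lambda> :: real
  assumes n: "0 < n"
  defines "L \<equiv> log 2 (real n)" and "\<Lambda> \<equiv> log 2 (log 2 (real n) + 1) + 1"
  shows "L \<le> bits n" "bits n \<le> L + 1" "bits (bits n) \<le> \<Lambda>" "1 \<le> \<Lambda>" "L / \<Lambda> - 1 \<le> buckets n"
proof -
  have bits: "log 2 m \<le> bits m" "bits m \<le> log 2 m + 1" if "0 < m" for m
  proof -
    show "log 2 m \<le> bits m"
      using log2_of_power_less[OF bits_bounds(1)[of m] that] by simp
    show "bits m \<le> log 2 m + 1"
      using le_log2_of_power[OF bits_bounds(2)[OF that]] by linarith
  qed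
  show 1: "L \<le> bits n" "bits n \<le> L + 1" using bits[OF n] by (simp_all add: L_def)
  have b0: "0 < bits n" using bits_bounds(1)[of n] n by (intro gr0I) simp
  then have bb0: "0 < bits (bits n)" using bits_bounds(1)[of "bits n"] by (intro gr0I) simp
  have "bits (bits n) \<le> log 2 (bits n) + 1" by (rule bits[OF b0])
  also have "log 2 (bits n) \<le> log 2 (L + 1)" using 1 b0 by (intro log_mono) auto
  finally show 2: "bits (bits n) \<le> \<Lambda>" by (simp add: \<Lambda>_def L_def)
  then show \<Lambda>1: "1 \<le> \<Lambda>" using bb0 by linarith
  have L0: "0 \<le> L" using n by (simp add: L_def)
  have "L / \<Lambda> \<le> bits n / bits (bits n)"
    using 1 2 L0 bb0 by (intro frac_le) auto
  then show "L / \<Lambda> - 1 \<le> buckets n"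
    using real_div_bounds(2)[where a = "bits n" and b = "bits (bits n)"] by (simp add: buckets_def)
qed

definition error_term :: "nat \<Rightarrow> real" where
  "error_term n = 3 * (ln (ln (real n)))\<^sup>2 / (exp 1 * sqrt (ln (real n)))"

text \<open>\<open>\<Lambda> n\<close> bounds \<open>bits (bits n)\<close> from above and
  \<open>P n\<close> bounds \<open>buckets n\<close> from below, both in smooth form for
  \<open>real_asymp\<close>. As \<open>Suc (depth n) \<le> 5 * \<Lambda> n\<close>, the constants
  are \<open>8 * 25 = 200\<close> and \<open>16 + 200 = 216\<close>.\<close>

lemma eventually_parameters:
  "\<forall>\<^sub>F n in sequentially. 200 \<le> buckets n \<and> 8 * Suc (depth n) ^ 2 \<le> buckets n \<and>
     buckets n * (buckets n + 1) \<le> n \<and>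
     (16 + 8 * real (Suc (depth n)) ^ 2) / buckets n \<le> error_term n"
proof -
  define \<Lambda> where "\<Lambda> n = log 2 (log 2 (real n) + 1) + 1" for n :: nat
  define P where "P n = log 2 (real n) / \<Lambda> n - 1" for n :: nat
  have "\<forall>\<^sub>F n in sequentially. (200::real) \<le> P n" unfolding P_def \<Lambda>_def by real_asymp
  moreover have "\<forall>\<^sub>F n in sequentially. 200 * \<Lambda> n ^ 2 \<le> P n" unfolding P_def \<Lambda>_def by real_asymp
  moreover have "\<forall>\<^sub>F n in sequentially. (log 2 (real n) + 1) * (log 2 (real n) + 2) \<le> real n" by real_asymp
  moreover have "\<forall>\<^sub>F n in sequentially. 216 * \<Lambda> n ^ 2 / P n \<le> error_term n"
    unfolding P_def \<Lambda>_def error_term_def by real_asymp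
  ultimately show ?thesis using eventually_gt_at_top[of 0]
  proof eventually_elim
    case (elim n)
    have b: "log 2 (real n) \<le> bits n" "bits n \<le> log 2 (real n) + 1" "bits (bits n) \<le> \<Lambda> n" "1 \<le> \<Lambda> n"
      "P n \<le> buckets n"
      using parameter_bounds[OF elim(5)] by (simp_all add: \<Lambda>_def P_def)
    have p: "200 \<le> real (buckets n)" using b(5) elim(1) by linarith
    have K: "real (Suc (depth n)) \<le> 5 * \<Lambda> n" using b(3,4) by (simp add: depth_def)
    have K2: "real (Suc (depth n)) ^ 2 \<le> 25 * \<Lambda> n ^ 2"
      using power_mono[OF K, of 2] by (simp add: power_mult_distrib)
    then have "8 * real (Suc (depth n)) ^ 2 \<le> buckets n" using elim(2) b(5) by linarith
    then have c2: "8 * Suc (depth n) ^ 2 \<le> buckets n"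
      by (metis of_nat_le_iff of_nat_mult of_nat_numeral of_nat_power)
    have pb: "real (buckets n) \<le> log 2 (real n) + 1" using b(2) buckets_le[of n] by linarith
    have "real (buckets n) * (real (buckets n) + 1) \<le> (log 2 (real n) + 1) * (log 2 (real n) + 2)"
      using pb p by (intro mult_mono) auto
    also note elim(3)
    finally have "real (buckets n * (buckets n + 1)) \<le> real n" by (simp add: algebra_simps)
    then have c3: "buckets n * (buckets n + 1) \<le> n" by (simp only: of_nat_le_iff)
    have "1 \<le> \<Lambda> n ^ 2" using b(4) by (rule one_le_power)
    then have "(16 + 8 * real (Suc (depth n)) ^ 2) / buckets n \<le> 216 * \<Lambda> n ^ 2 / P n"
      using K2 b(5) elim(1) by (intro frac_le) auto
    then show ?case using p c2 c3 elim(4) by auto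
  qed
qed

section \<open>The family for large and for small \<open>n\<close>\<close>

definition good_family :: "nat \<Rightarrow> nat list multiset \<Rightarrow> bool" where
  "good_family n M \<longleftrightarrow> M \<noteq> {#} \<and> set_mset M \<subseteq> permutations_of_set {1..n} \<and>
     (\<forall>v :: nat \<Rightarrow> real. inj_on v {1..n} \<longrightarrow>
        measure_pmf.prob (pmf_of_multiset M) {ord. picks_max n (nat \<lfloor>real n / exp 1\<rfloor>) v ord}
          \<ge> 1 / exp 1 - error_term n)"

lemma length_filter_orders:
  "length (filter Q (orders n p B S H G)) =
     (\<Sum>s<S. card {t. t < S \<and> Q (arrange n p (\<lambda>x. digit p (G t) (hash p B H s x)))})"
proof -
  have "length (filter Q (map f [0..<S])) = card {t. t < S \<and> Q (f t)}" for f :: "nat \<Rightarrow> nat list"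
    by (simp add: filter_map comp_def length_filter_conv_card cong: conj_cong)
  then show ?thesis
    unfolding orders_def filter_concat length_concat map_map comp_def
    by (simp add: interv_sum_list_conv_sum_set_nat atLeast0LessThan)
qed

lemma length_orders: "length (orders n p B S H G) = S * S"
  using length_filter_orders[of "\<lambda>_. True" n p B S H G] by simp

lemma good_family_orders:
  assumes par: "200 \<le> buckets n" "8 * Suc (depth n) ^ 2 \<le> buckets n" "buckets n * (buckets n + 1) \<le> n"
      "(16 + 8 * real (Suc (depth n)) ^ 2) / buckets n \<le> error_term n"
    and H: "good_hash n H" and G: "good_perms n G"
  shows "good_family n (mset (orders n (buckets n) (blocks n) (rounds n) H G))"
proof -
  define p where "p = buckets n"
  define R where "R = rounds n"
  define xs where "xs = orders n p (blocks n) R H G"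
  have p0: "0 < p" using par(1) by (simp add: p_def)
  have R0: "0 < R" and bits0: "0 < bits n"
    using par(1) buckets_le[of n] by (simp_all add: R_def rounds_def)
  have len: "length xs = R * R" by (simp add: xs_def length_orders)
  then have ne: "mset xs \<noteq> {#}" using R0 by auto
  have sub: "set xs \<subseteq> permutations_of_set {1..n}"
  proof
    fix ord assume "ord \<in> set xs"
    then obtain s t where "ord = arrange n p (\<lambda>x. digit p (G t) (hash p (blocks n) H s x))"
      by (auto simp: xs_def orders_def)
    then show "ord \<in> permutations_of_set {1..n}"
      using digit_less[OF p0] by (simp only: arrange_permutation)
  qed
  have "Suc (depth n) ^ 2 \<le> 8 * Suc (depth n) ^ 2" by simp
  then have "Suc (depth n) ^ 2 \<le> p" using par(2) unfolding p_def by (rule order_trans)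
  moreover have "Suc (depth n) \<le> Suc (depth n) ^ 2" by (simp add: power2_eq_square)
  ultimately have k: "depth n < p" by linarith
  have pn: "p \<le> n" using par(3) p0 unfolding p_def[symmetric] by (metis add_gr_0 le_trans mult_le_mono2 mult_1_right One_nat_def Suc_leI)
  have prob: "1 / exp 1 - error_term n \<le>
      measure_pmf.prob (pmf_of_multiset (mset xs)) {ord. picks_max n (nat \<lfloor>real n / exp 1\<rfloor>) v ord}"
    if v: "inj_on v {1..n}" for v :: "nat \<Rightarrow> real"
  proof -
    let ?m = "nat \<lfloor>real n / exp 1\<rfloor>"
    note rate = success_rate[OF par(1-3)]
    have p2: "2 \<le> buckets n" using par(1) by simp
    define rt where "rt = 1 / exp 1 - (16 + 8 * real (Suc (depth n)) ^ 2) / p"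
    define c where "c = (\<Sum>s<R. card {t. t < R \<and> picks_max n ?m v (arrange n p (\<lambda>x. digit p (G t) (hash p (blocks n) H s x)))})"
    define q where "q = real (threshold n - 1) / p * (1 - (1 - real (threshold n - 1) / p) ^ depth n) * (\<Sum>t=threshold n + 3..<p. 1 / real t)"
    define \<kappa> where "\<kappa> = (1 + 1 / real (bits n)) / p + (real (bits n) + 1) * ln (real (blocks n * blocks n * p)) / R"
    define \<eta> where "\<eta> = (1 + 1 / real (bits n)) * (1 - q) + (real (bits n) + 1) * ln (real (p ^ Suc (depth n))) / R"
    have \<eta>1: "\<eta> \<le> 1" using rate(3) by (simp only: \<eta>_def q_def p_def R_def)
    have rt: "rt \<le> (1 - real (Suc (depth n)) ^ 2 * \<kappa>) * (1 - \<eta>)"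
      using rate(4) by (simp only: rt_def \<kappa>_def \<eta>_def q_def p_def R_def)
    have B: "blocks n = n div p + 1" by (simp add: blocks_def p_def)
    have Hg: "greedy_choice (blocks n * blocks n * p) p (bits n) (hash_bad (blocks n) p) H r" if "r < R * blocks n" for r
      using H that by (simp add: good_hash_def p_def R_def)
    have Gg: "greedy_choice (p ^ Suc (depth n)) (p ^ p) (bits n) (perm_bad p (depth n) (threshold n - 1) (threshold n + 3)) G r"
      if "r < R" for r using G that unfolding good_perms_def p_def R_def by blast
    have cuts: "threshold n - 1 \<le> threshold n + 3" "threshold n + 3 \<le> p" using rate(2) by (simp_all add: p_def)
    have cp: "(threshold n - 1) * (n div p + 1) \<le> ?m" "?m \<le> (threshold n + 3) * (n div p)"
      unfolding p_def using checkpoint_bounds[OF p2 par(3)] by blast+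
    have "real (R * R) * ((1 - real (Suc (depth n)) ^ 2 * \<kappa>) * (1 - \<eta>)) \<le> real c"
      using orders_success[OF p0 k pn bits0 R0 B Hg Gg rate(1) cuts cp v \<eta>1[unfolded \<eta>_def q_def]]
      by (simp only: c_def \<kappa>_def \<eta>_def q_def of_nat_mult)
    then have "real R * real R * rt \<le> real c"
      using mult_left_mono[OF rt, of "real R * real R"] by simp
    then have "rt \<le> real c / (real R * real R)" using R0 by (simp add: pos_le_divide_eq mult.commute)
    also have "\<dots> = measure_pmf.prob (pmf_of_multiset (mset xs)) {ord. picks_max n ?m v ord}"
      unfolding prob_pmf_of_multiset[OF ne] size_mset len mset_filter[symmetric]
      by (simp add: c_def xs_def length_filter_orders)
    finally show ?thesis using par(4) unfolding rt_def p_def by linarith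
  qed
  show ?thesis
    unfolding good_family_def p_def[symmetric] R_def[symmetric] xs_def[symmetric]
    using ne sub prob by simp
qed

lemma error_term_nonneg: "0 < n \<Longrightarrow> 0 \<le> error_term n"
  unfolding error_term_def by (intro divide_nonneg_nonneg mult_nonneg_nonneg) auto

text \<open>With all permutations, rounding the checkpoint down costs at most \<open>1 / n\<close>,
  and this shows that the error term pays for it. The value 8 is convenient since
  \<open>e ^ 2 \<le> 8\<close> gives \<open>ln 8 \<ge> 2\<close> and hence
  \<open>ln 2 \<ge> 2 / 3\<close>.\<close>

lemma error_term_ge:
  assumes "8 \<le> n"
  shows "1 / real n \<le> error_term n"
proof -
  define \<Lambda> where "\<Lambda> = ln (real n)"
  have "exp (2::real) = exp 1 ^ 2" by (simp flip: exp_of_nat_mult)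
  also have "\<dots> \<le> (28/10) ^ 2" by (intro power_mono exp_1_bounds) simp
  also have "\<dots> \<le> (8::real)" by (simp add: power2_eq_square)
  finally have "ln (exp 2) \<le> ln (8::real)" by (subst ln_le_cancel_iff) auto
  then have ln8: "2 \<le> ln (8::real)" by simp
  moreover have "ln 8 \<le> \<Lambda>" using assms by (simp add: \<Lambda>_def)
  ultimately have \<Lambda>2: "2 \<le> \<Lambda>" by linarith
  have ln2: "2 / 3 \<le> ln (2::real)" using ln8 ln_realpow[of 2 3] by simp
  have "ln 2 \<le> ln \<Lambda>" using \<Lambda>2 by simp
  then have l: "2 / 3 \<le> ln \<Lambda>" using ln2 by linarith
  have "(2 / 3)\<^sup>2 \<le> (ln \<Lambda>)\<^sup>2" using l by (intro power_mono) auto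
  then have l2: "1 \<le> 3 * (ln \<Lambda>)\<^sup>2" by (simp add: power2_eq_square)
  have "sqrt \<Lambda> \<le> \<Lambda>" using \<Lambda>2 by (intro real_le_lsqrt) (auto simp: power2_eq_square)
  also have "\<dots> \<le> exp (\<Lambda> - 1)" using exp_ge_add_one_self[of "\<Lambda> - 1"] by simp
  finally have "exp 1 * sqrt \<Lambda> \<le> exp 1 * exp (\<Lambda> - 1)" by simp
  also have "\<dots> = exp \<Lambda>" by (simp flip: exp_add)
  also have "\<dots> = n" using assms by (simp add: \<Lambda>_def)
  finally have "1 / real n \<le> 1 / (exp 1 * sqrt \<Lambda>)"
    using \<Lambda>2 assms by (intro divide_left_mono) auto
  also have "\<dots> \<le> 3 * (ln \<Lambda>)\<^sup>2 / (exp 1 * sqrt \<Lambda>)"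
    using l2 \<Lambda>2 by (intro divide_right_mono) auto
  finally show ?thesis by (simp add: error_term_def \<Lambda>_def)
qed

lemma good_family_exists:
  assumes "0 < n"
  shows "\<exists>M. good_family n M"
proof -
  let ?m = "nat \<lfloor>real n / exp 1\<rfloor>"
  have e: "(27/10::real) \<le> exp 1" "exp 1 \<le> (28/10::real)" by (rule exp_1_bounds)+
  have ei: "1 / exp 1 \<le> (38/100::real)" using e by (simp add: field_simps)
  have m: "?m = j" if "real j * exp 1 \<le> n" "real n < (real j + 1) * exp 1" for j
  proof -
    have "\<lfloor>real n / exp 1\<rfloor> = int j" using that by (intro floor_unique) (simp_all add: field_simps)
    then show ?thesis by simp
  qed
  have err: "1 / exp 1 - error_term n \<le> 38/100" using ei error_term_nonneg[OF assms] by linarith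
  show ?thesis
  proof (cases "n < 3")
    case True
    \<comment> \<open>With checkpoint 0 the first element is accepted at once, so the secretary sum,
      which needs a positive checkpoint, does not apply. For \<open>n = 1\<close> the error term is
      0 by the default values \<open>ln 0 = 0\<close> and \<open>x / 0 = 0\<close>.\<close>
    then have m0: "?m = 0" using e by (intro m) auto
    consider "n = 1" | "n = 2" using True assms by linarith
    then show ?thesis
    proof cases
      case 1
      have "picks_max 1 0 v [1]" for v by (simp add: picks_max_def wait_and_pick_def)
      then have "good_family 1 {#[1]#}"
        using err m0 1 unfolding good_family_def
        by (simp add: prob_pmf_of_multiset permutations_of_set_def)
      then show ?thesis using 1 by blast
    next
      case 2
      have w: "wait_and_pick 0 v [a, b] = a" for v :: "nat \<Rightarrow> real" and a b
        by (simp add: wait_and_pick_def upt_rec)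
      have s: "{1..2} = {1, 2 :: nat}" by auto
      have pk: "picks_max 2 0 v [1, 2] \<or> picks_max 2 0 v [2, 1]" for v
        unfolding picks_max_def w s by (auto simp: max_def)
      let ?M = "{#[1, 2], [2, 1 :: nat]#}"
      have "1 / exp 1 - error_term 2 \<le> measure_pmf.prob (pmf_of_multiset ?M) {ord. picks_max 2 0 v ord}" for v
      proof -
        have "1 \<le> size (filter_mset (picks_max 2 0 v) ?M)" using pk[of v] by auto
        moreover have "size ?M = 2" by simp
        ultimately have "1 / 2 \<le> measure_pmf.prob (pmf_of_multiset ?M) {ord. picks_max 2 0 v ord}"
          by (subst prob_pmf_of_multiset) auto
        then show ?thesis using err 2 by simp
      qed
      then have "good_family 2 ?M"
        using m0 2 unfolding good_family_def permutations_of_set_def by auto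
      then show ?thesis using 2 by blast
    qed
  next
    case False
    then have m0: "0 < ?m" "?m < n"
    proof -
      have "1 \<le> real n / exp 1" using False e by (simp add: field_simps)
      then show "0 < ?m" by (simp add: le_floor_iff zero_less_nat_eq)
      have "real n / exp 1 < n" using False e by (simp add: field_simps)
      then show "?m < n" by (simp add: nat_less_iff floor_less_iff)
    qed
    have rate: "1 / exp 1 - error_term n \<le> real ?m / n * (\<Sum>t=?m..<n. 1 / real t)"
    \<comment> \<open>Near \<open>e\<close> the error term almost vanishes, because
      \<open>ln (ln n)\<close> is near 0. For small \<open>n\<close> the sum itself is therefore
      shown to be at least \<open>38 / 100\<close>, which exceeds \<open>1 / e\<close>.\<close>
    proof (cases "n < 8")
      case True
      then consider "n = 3" | "n = 4" | "n = 5" | "n = 6" | "n = 7" using False by linarith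
      then have "38/100 \<le> real ?m / n * (\<Sum>t=?m..<n. 1 / real t)"
      proof cases
        case 1
        then have "?m = 1" using e by (intro m) auto
        then show ?thesis using 1 by (simp add: numeral_eq_Suc)
      next
        case 2
        then have "?m = 1" using e by (intro m) auto
        then show ?thesis using 2 by (simp add: numeral_eq_Suc)
      next
        case 3
        then have "?m = 1" using e by (intro m) auto
        then show ?thesis using 3 by (simp add: numeral_eq_Suc)
      next
        case 4
        then have "?m = 2" using e by (intro m) auto
        then show ?thesis using 4 by (simp add: numeral_eq_Suc)
      next
        case 5
        then have "?m = 2" using e by (intro m) auto
        then show ?thesis using 5 by (simp add: numeral_eq_Suc)
      qed
      then show ?thesis using err by linarith
    next
      case False
      have n: "0 < real n" using assms by simp
      have mn: "real ?m \<le> n / exp 1" "n / exp 1 - 1 \<le> real ?m"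
      proof -
        have "real ?m = real_of_int \<lfloor>real n / exp 1\<rfloor>" by (simp add: of_nat_nat)
        then show "real ?m \<le> n / exp 1" "n / exp 1 - 1 \<le> real ?m" by linarith+
      qed
      have "1 = ln (exp 1 :: real)" by simp
      also have "\<dots> \<le> ln (real n / real ?m)"
      proof (subst ln_le_cancel_iff)
        have "real ?m * exp 1 \<le> n / exp 1 * exp 1" by (intro mult_right_mono mn(1)) simp
        then have "exp 1 * real ?m \<le> real n" by (simp add: mult.commute)
        moreover have "0 < real ?m" using m0(1) by (rule of_nat_0_less_iff[THEN iffD2])
        ultimately show "exp 1 \<le> real n / real ?m" by (simp only: pos_le_divide_eq)
      qed (use m0 n in auto)
      also have "\<dots> \<le> (\<Sum>t=?m..<n. 1 / real t)" using m0 by (intro harmonic_sum_ge_ln) auto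
      finally have "real ?m / n * 1 \<le> real ?m / n * (\<Sum>t=?m..<n. 1 / real t)"
        by (intro mult_left_mono) auto
      moreover have "(n / exp 1 - 1) / n \<le> real ?m / n" using mn(2) n by (intro divide_right_mono) auto
      moreover have "(n / exp 1 - 1) / n = 1 / exp 1 - 1 / n" using n by (simp add: diff_divide_distrib)
      ultimately show ?thesis using error_term_ge[of n] False by linarith
    qed
    show ?thesis
      using symmetric_family[OF assms m0] rate unfolding good_family_def
      by (intro exI[of _ "image_mset (arrange n n) (mset_set {g. g permutes {..<n}})"])
         (meson order_trans)
  qed
qed

lemma program_output:
  assumes par: "200 \<le> buckets n" "8 * Suc (depth n) ^ 2 \<le> buckets n" "buckets n * (buckets n + 1) \<le> n"
      "(16 + 8 * real (Suc (depth n)) ^ 2) / buckets n \<le> error_term n"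
  shows "\<exists>xs. ok Program (input_memory n) (time_bound n) (\<lambda>\<tau>. outputs \<tau> xs) \<and>
     good_family n (mset xs) \<and> length xs = rounds n * rounds n"
proof -
  have "Suc (depth n) \<le> Suc (depth n) ^ 2" by (simp add: power2_eq_square)
  also have "\<dots> \<le> 8 * Suc (depth n) ^ 2" by simp
  also note par(2)
  finally have k: "depth n < buckets n" by simp
  obtain u \<tau> H G where u: "exec Program (input_memory n) u \<tau>" "u \<le> program_time n"
    "good_hash n H" "good_perms n G" "outputs \<tau> (orders n (buckets n) (blocks n) (rounds n) H G)"
    using ok_Program[OF k] unfolding ok_def program_time_def by blast
  have "ok Program (input_memory n) (time_bound n)
      (\<lambda>\<tau>. outputs \<tau> (orders n (buckets n) (blocks n) (rounds n) H G))"
    unfolding ok_def using u(1,5) order_trans[OF u(2) program_time_le[OF k]] by blast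
  then show ?thesis using good_family_orders[OF par u(3,4)] length_orders by blast
qed

theorem theorem4:
  "\<exists>L :: nat \<Rightarrow> nat list multiset.
     (\<forall>n\<ge>1. L n \<noteq> {#} \<and> set_mset (L n) \<subseteq> permutations_of_set {1..n} \<and>
        (\<forall>v :: nat \<Rightarrow> real. inj_on v {1..n} \<longrightarrow>
           measure_pmf.prob (pmf_of_multiset (L n))
               {ord. picks_max n (nat \<lfloor>real n / exp 1\<rfloor>) v ord}
             \<ge> 1 / exp 1 - 3 * (ln (ln (real n)))\<^sup>2 / (exp 1 * sqrt (ln (real n))))) \<and>
     polytime_computable L \<and>
     (\<lambda>n. shannon_entropy (pmf_of_multiset (L n))) \<in> O(\<lambda>n. ln (ln (real n)))"
proof -
  obtain n1 where n1: "\<And>n. n1 \<le> n \<Longrightarrow> 200 \<le> buckets n \<and> 8 * Suc (depth n) ^ 2 \<le> buckets n \<and>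
     buckets n * (buckets n + 1) \<le> n \<and> (16 + 8 * real (Suc (depth n)) ^ 2) / buckets n \<le> error_term n"
    using eventually_parameters unfolding eventually_sequentially by blast
  \<comment> \<open>The successor makes every \<open>n \<ge> n0\<close> positive, as the polynomial
    time bound requires.\<close>
  define n0 where "n0 = Suc n1"
  have "\<exists>xs. (0 < n \<longrightarrow> good_family n (mset xs)) \<and> (n0 \<le> n \<longrightarrow>
      ok Program (input_memory n) (time_bound n) (\<lambda>\<tau>. outputs \<tau> xs) \<and> length xs = rounds n * rounds n)" for n
  proof (cases "n0 \<le> n")
    case True
    then have "n1 \<le> n" by (simp add: n0_def)
    then show ?thesis using program_output[of n] n1[of n] by blast
  next
    case False
    show ?thesis
    proof (cases "0 < n")
      case True
      then obtain M where "good_family n M" using good_family_exists by blast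
      moreover obtain xs where "mset xs = M" using ex_mset by blast
      ultimately show ?thesis using False by blast
    qed (use False in auto)
  qed
  then obtain xs where good: "\<And>n. 0 < n \<Longrightarrow> good_family n (mset (xs n))"
    and prog: "\<And>n. n0 \<le> n \<Longrightarrow> ok Program (input_memory n) (time_bound n) (\<lambda>\<tau>. outputs \<tau> (xs n))"
    and len: "\<And>n. n0 \<le> n \<Longrightarrow> length (xs n) = rounds n * rounds n"
    by metis
  obtain q where q: "\<And>n. 0 < n \<Longrightarrow> time_bound n \<le> poly q n"
    using poly_bounded_time unfolding poly_bounded_def by blast
  have "polytime_computable (\<lambda>n. mset (xs n))"
  proof (rule polytime_computableI[of n0])
    fix n assume n: "n0 \<le> n"
    then have "0 < n" by (simp add: n0_def)
    from prog[OF n] q[OF this] show "ok Program (input_memory n) (poly q n) (\<lambda>\<tau>. outputs \<tau> (xs n))"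
      by (rule ok_mono)
  qed
  moreover have "(\<lambda>n. shannon_entropy (pmf_of_multiset (mset (xs n)))) \<in> O(\<lambda>n. ln (ln (real n)))"
  proof (rule landau_o.big.trans[OF landau_o.big_mono])
    show "\<forall>\<^sub>F n in sequentially. norm (shannon_entropy (pmf_of_multiset (mset (xs n))))
        \<le> norm (6 * ln (log 2 (real n) + 1))"
      using eventually_ge_at_top[of n0]
    proof eventually_elim
      case (elim n)
      then have n: "0 < n" by (simp add: n0_def)
      have b: "bits n \<le> log 2 (real n) + 1" by (rule parameter_bounds(2)[OF n])
      have b0: "0 < bits n" using bits_bounds(1)[of n] n by (intro gr0I) simp
      have "mset (xs n) \<noteq> {#}" using good[OF n] by (simp add: good_family_def)
      note ent = shannon_entropy_bounds[OF this]
      \<comment> \<open>The entropy of a uniform choice from a multiset is at most the logarithm of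
        its size with multiplicity, here \<open>6 * ln (bits n)\<close>.\<close>
      have "real (size (mset (xs n))) = real (bits n) ^ 6"
        using len[OF elim] by (simp add: rounds_def power_add[symmetric])
      then have "ln (size (mset (xs n))) = 6 * ln (real (bits n))"
        using b0 ln_realpow[of "real (bits n)" 6] by simp
      also have "\<dots> \<le> 6 * ln (log 2 (real n) + 1)"
        using b b0 by simp
      finally show ?case using ent by simp
    qed
    show "(\<lambda>n. 6 * ln (log 2 (real n) + 1)) \<in> O(\<lambda>n. ln (ln (real n)))" by real_asymp
  qed
  ultimately show ?thesis
    using good unfolding good_family_def error_term_def
    by (intro exI[of _ "\<lambda>n. mset (xs n)"]) (simp add: Suc_le_eq)
qed

end
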